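(* Let $f\in\mathrm{Hol}_3(S^2,\mathbb{C}P^1)$ be a holomorphic map of degree $3$. Then the following are equivalent: (a) $f$ is a collapse point; (b) $f$ admits extra eigenfunctions; (c) up to fractional linear transformations of the domain and codomain, $f$ is given by $[F_0,F_2]=[z^3+2,\,-\tfrac13z]$; (d) $f$ has (four) simple branch points which form an equianharmonic quadruplet.
   Context: $S^2$ is identified with $\mathbb{C}\cup\{\infty\}$. Any $f\in\mathrm{Hol}_d(S^2,\mathbb{C}P^1)$ (holomorphic maps of degree $d$) is written $f=[F_0,F_2]$ with $F_0,F_2$ coprime polynomials of maximum degree exactly $d$; it is identified with the map $[F_0,0,F_2,0]:S^2\to\mathbb{C}P^3$. A holomorphic map $f=[F_0,F_1,F_2,F_3]:S^2\to\mathbb{C}P^3$ ($F_i$ polynomials) is horizontal (for the twistor fibration $\mathbb{C}P^3\to\mathbb HP^1= S^4$) if $F_1F_0'-F_0F_1'+F_3F_2'-F_2F_3'=0$. It is full if its image lies in no projective subspace $\mathbb{C}P^2$. A map $f\in\mathrm{Hol}_d(S^2,\mathbb{C}P^1)$ is a collapse point if $[F_0,0,F_2,0]$ lies in the closure, in the space of horizontal holomorphic maps $S^2\to\mathbb{C}P^3$ of degree $d$ (compact-open topology), of the subspace of full ones. Identifying $\mathbb{C}P^1$ with the unit sphere $S^2\subset\mathbb{R}^3$ in the standard way and writing $\Phi=(\Phi_1,\Phi_2,\Phi_3):S^2\to S^2\subset\mathbb{R}^3$ for $f$, an eigenfunction of $f$ is a real solution $v$ on $S^2$ of $\Delta v=|d\Phi|^2v$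 ($\Delta=-\mathrm{div}\,\mathrm{grad}$ on the round unit sphere, sign such that $\Delta\Phi=|d\Phi|^2\Phi$); it is extra if it is not a linear combination of $\Phi_1,\Phi_2,\Phi_3$. A branch point is simple if $df$ vanishes there to order exactly one. Four distinct points of $\mathbb{C}\cup\{\infty\}$ form an equianharmonic quadruplet if their six cross ratios reduce to two values (which are then $e^{\pm i\pi/3}$); equivalently a fractional linear transformation places them at the vertices of a regular tetrahedron in $S^2$. *)

theory Defs
  imports
    "HOL-Complex_Analysis.Complex_Analysis"
    "HOL-Computational_Algebra.Computational_Algebra"
begin

section \<open>The Riemann sphere and holomorphic maps given by polynomials\<close>

text \<open>
  Both the domain \<open>S\<^sup>2 = \<complex> \<union> {\<infinity>}\<close> and the codomain \<open>\<complex>P\<^sup>1\<close> are modelled by \<open>complex option\<close>, with \<^term>\<open>None\<close>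
  for \<open>\<infinity>\<close>; the point \<open>[w\<^sub>0, w\<^sub>1]\<close> of \<open>\<complex>P\<^sup>1\<close> is \<open>w\<^sub>0 / w\<^sub>1\<close>, so that \<open>[F\<^sub>0, F\<^sub>2]\<close> is the rational
  function \<open>F\<^sub>0 / F\<^sub>2\<close>.
\<close>

type_synonym riemann_sphere = "complex option"

definition cp1_point :: "complex \<Rightarrow> complex \<Rightarrow> riemann_sphere" where
  "cp1_point w0 w1 = (if w1 = 0 then None else Some (w0 / w1))"

text \<open>
  Value of \<open>F\<close>, regarded as a form of degree \<open>d \<ge> degree F\<close>, at \<open>(z, 1)\<close> respectively at \<open>(1, 0)\<close>.
\<close>

definition hom_eval :: "nat \<Rightarrow> complex poly \<Rightarrow> riemann_sphere \<Rightarrow> complex" where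
  "hom_eval d F p = (case p of None \<Rightarrow> coeff F d | Some z \<Rightarrow> poly F z)"

definition cp1_map :: "complex poly \<Rightarrow> complex poly \<Rightarrow> riemann_sphere \<Rightarrow> riemann_sphere" where
  "cp1_map F0 F2 p =
     (let d = max (degree F0) (degree F2) in cp1_point (hom_eval d F0 p) (hom_eval d F2 p))"

definition Hol :: "nat \<Rightarrow> (riemann_sphere \<Rightarrow> riemann_sphere) set" where
  "Hol d = {cp1_map F0 F2 | F0 F2. coprime F0 F2 \<and> max (degree F0) (degree F2) = d}"

text \<open>The transformations \<open>z \<mapsto> (a z + b) / (c z + e)\<close> of \<open>\<complex> \<union> {\<infinity>}\<close>.\<close>

definition fractional_linear :: "(riemann_sphere \<Rightarrow> riemann_sphere) \<Rightarrow> bool" where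
  "fractional_linear \<phi> \<longleftrightarrow> (\<exists>a b c e. a * e - b * c \<noteq> 0 \<and> \<phi> = cp1_map [:b, a:] [:e, c:])"


section \<open>Complex projective 3-space and collapse points\<close>

text \<open>Points of projective space are lines through the origin.\<close>

definition proj_point :: "complex ^ 'n \<Rightarrow> (complex ^ 'n) set" where
  "proj_point v = vec.span {v}"

definition proj_space :: "(complex ^ 'n) set set" where
  "proj_space = proj_point ` (- {0})"

definition proj_topology :: "(complex ^ 'n) set topology" where
  "proj_topology = topology (\<lambda>U. U \<subseteq> proj_space \<and> open {v. v \<noteq> 0 \<and> proj_point v \<in> U})"

lemma openin_proj_topology:
  "openin (proj_topology :: (complex ^ 'n) set topology) U \<longleftrightarrow>
     U \<subseteq> proj_space \<and> open {v. v \<noteq> 0 \<and> proj_point v \<in> U}"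
proof -
  let ?P = "\<lambda>U :: (complex ^ 'n) set set. U \<subseteq> proj_space \<and> open {v. v \<noteq> 0 \<and> proj_point v \<in> U}"
  have "istopology ?P"
    unfolding istopology_def
  proof (intro conjI allI impI)
    fix S T assume S: "?P S" and T: "?P T"
    have eq: "{v. v \<noteq> 0 \<and> proj_point v \<in> S \<inter> T} =
        {v. v \<noteq> 0 \<and> proj_point v \<in> S} \<inter> {v. v \<noteq> 0 \<and> proj_point v \<in> T}"
      by auto
    show "S \<inter> T \<subseteq> proj_space" using S by auto
    show "open {v. v \<noteq> 0 \<and> proj_point v \<in> S \<inter> T}"
      unfolding eq using S T by (intro open_Int) auto
  next
    fix K assume K: "\<forall>S\<in>K. ?P S"
    have eq: "{v. v \<noteq> 0 \<and> proj_point v \<in> \<Union>K} = (\<Union>S\<in>K. {v. v \<noteq> 0 \<and> proj_point v \<in> S})"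
      by auto
    show "\<Union>K \<subseteq> proj_space" using K by auto
    show "open {v. v \<noteq> 0 \<and> proj_point v \<in> \<Union>K}"
      unfolding eq using K by (intro open_UN) auto
  qed
  then show ?thesis
    unfolding proj_topology_def by (simp add: topology_inverse')
qed

lemma topspace_proj_topology: "topspace proj_topology = proj_space"
proof -
  have "{v::complex ^ 'a. v \<noteq> 0 \<and> proj_point v \<in> proj_space} = - {0}"
    by (auto simp: proj_space_def)
  then have "openin proj_topology (proj_space :: (complex ^ 'a) set set)"
    by (simp add: openin_proj_topology open_Compl)
  then show ?thesis
    by (metis openin_proj_topology openin_subset openin_topspace subset_antisym)
qed

lemma quotient_map_proj_point:
  "quotient_map (top_of_set (- {0})) proj_topology proj_point"
  unfolding quotient_map_def topspace_proj_topology
proof (intro conjI allI impI)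
  show "proj_point ` topspace (top_of_set (- {0})) = proj_space"
    by (simp add: proj_space_def)
  fix U :: "(complex ^ 'a) set set"
  assume U: "U \<subseteq> proj_space"
  have "{x \<in> topspace (top_of_set (- {0})). proj_point x \<in> U} = {v. v \<noteq> 0 \<and> proj_point v \<in> U}"
    by auto
  then show "openin (top_of_set (- {0})) {x \<in> topspace (top_of_set (- {0})). proj_point x \<in> U} =
      openin proj_topology U"
    using U by (auto simp: openin_proj_topology openin_open_eq open_Compl)
qed

text \<open>
  The compact-open topology on the continuous maps from \<open>X\<close> to \<open>Y\<close>; it is used below only with
  \<^prop>\<open>topspace X = UNIV\<close>, so that values outside \<^term>\<open>topspace X\<close> play no role.
\<close>

definition compact_open_topology :: "'a topology \<Rightarrow> 'b topology \<Rightarrow> ('a \<Rightarrow> 'b) topology" where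
  "compact_open_topology X Y = topology_generated_by
     {{f. continuous_map X Y f \<and> f ` K \<subseteq> U} | K U. compactin X K \<and> openin Y U}"

definition riemann_sphere_topology :: "riemann_sphere topology" where
  "riemann_sphere_topology = Alexandroff_compactification euclidean"

type_synonym cp3 = "(complex ^ 4) set"

definition max_degree4 ::
    "complex poly \<Rightarrow> complex poly \<Rightarrow> complex poly \<Rightarrow> complex poly \<Rightarrow> nat" where
  "max_degree4 F0 F1 F2 F3 = Max {degree F0, degree F1, degree F2, degree F3}"

definition coprime4 ::
    "complex poly \<Rightarrow> complex poly \<Rightarrow> complex poly \<Rightarrow> complex poly \<Rightarrow> bool" where
  "coprime4 F0 F1 F2 F3 \<longleftrightarrow>
     (\<forall>p. p dvd F0 \<and> p dvd F1 \<and> p dvd F2 \<and> p dvd F3 \<longrightarrow> is_unit p)"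

definition cp3_map ::
    "complex poly \<Rightarrow> complex poly \<Rightarrow> complex poly \<Rightarrow> complex poly \<Rightarrow> riemann_sphere \<Rightarrow> cp3" where
  "cp3_map F0 F1 F2 F3 p =
     (let d = max_degree4 F0 F1 F2 F3 in
      proj_point (vector [hom_eval d F0 p, hom_eval d F1 p, hom_eval d F2 p, hom_eval d F3 p]))"

definition horizontal ::
    "complex poly \<Rightarrow> complex poly \<Rightarrow> complex poly \<Rightarrow> complex poly \<Rightarrow> bool" where
  "horizontal F0 F1 F2 F3 \<longleftrightarrow>
     F1 * pderiv F0 - F0 * pderiv F1 + F3 * pderiv F2 - F2 * pderiv F3 = 0"

definition HHol :: "nat \<Rightarrow> (riemann_sphere \<Rightarrow> cp3) set" where
  "HHol d = {cp3_map F0 F1 F2 F3 | F0 F1 F2 F3.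
     coprime4 F0 F1 F2 F3 \<and> max_degree4 F0 F1 F2 F3 = d \<and> horizontal F0 F1 F2 F3}"

text \<open>
  A projective subspace \<open>\<complex>P\<^sup>2\<close> consists of the lines contained in a 3-dimensional linear subspace \<open>H\<close>.
\<close>

definition full :: "(riemann_sphere \<Rightarrow> cp3) \<Rightarrow> bool" where
  "full f \<longleftrightarrow> \<not> (\<exists>H. vec.subspace H \<and> vec.dim H = 3 \<and> (\<forall>p. f p \<subseteq> H))"

definition collapse_point :: "nat \<Rightarrow> (riemann_sphere \<Rightarrow> riemann_sphere) \<Rightarrow> bool" where
  "collapse_point d f \<longleftrightarrow>
     (\<exists>F0 F2. coprime F0 F2 \<and> max (degree F0) (degree F2) = d \<and> f = cp1_map F0 F2 \<and>
        cp3_map F0 0 F2 0 \<in>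
          subtopology (compact_open_topology riemann_sphere_topology proj_topology) (HHol d)
            closure_of {g \<in> HHol d. full g})"


section \<open>Eigenfunctions\<close>

abbreviation unit_sphere :: "(real ^ 3) set" where
  "unit_sphere \<equiv> sphere 0 1"

text \<open>Stereographic projection from the north pole \<open>(0, 0, 1)\<close>, which corresponds to \<open>\<infinity>\<close>.\<close>

definition to_unit_sphere :: "riemann_sphere \<Rightarrow> real ^ 3" where
  "to_unit_sphere p = (case p of
       None \<Rightarrow> vector [0, 0, 1]
     | Some z \<Rightarrow> (1 / ((cmod z)\<^sup>2 + 1)) *\<^sub>R vector [2 * Re z, 2 * Im z, (cmod z)\<^sup>2 - 1])"

definition of_unit_sphere :: "real ^ 3 \<Rightarrow> riemann_sphere" where
  "of_unit_sphere x =
     (if x $ 3 = 1 then None else Some (Complex (x $ 1 / (1 - x $ 3)) (x $ 2 / (1 - x $ 3))))"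

definition sphere_map :: "(riemann_sphere \<Rightarrow> riemann_sphere) \<Rightarrow> real ^ 3 \<Rightarrow> real ^ 3" where
  "sphere_map f = to_unit_sphere \<circ> f \<circ> of_unit_sphere"

text \<open>
  The differential at \<open>x\<close> of a map on the unit sphere is determined on the tangent plane \<open>x\<^sup>\<bottom>\<close>; it is
  extended by 0 to the normal line.  Hence sums over the standard basis of \<open>\<real>\<^sup>3\<close> of quantities
  quadratic in the direction, as in \<open>sphere_div\<close> and \<open>energy_density\<close>, are sums over any orthonormal
  basis of the tangent plane.
\<close>

definition sphere_deriv ::
    "(real ^ 3 \<Rightarrow> 'b::real_normed_vector) \<Rightarrow> real ^ 3 \<Rightarrow> real ^ 3 \<Rightarrow> 'b" where
  "sphere_deriv X x = (THE D. (X has_derivative D) (at x within unit_sphere) \<and> D x = 0)"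

definition sphere_grad :: "(real ^ 3 \<Rightarrow> real) \<Rightarrow> real ^ 3 \<Rightarrow> real ^ 3" where
  "sphere_grad v x = (\<Sum>b\<in>Basis. sphere_deriv v x b *\<^sub>R b)"

text \<open>The divergence of a tangent vector field, \<open>\<Sum>\<^sub>e \<langle>\<nabla>\<^sub>e X, e\<rangle> = \<Sum>\<^sub>e \<langle>dX(e), e\<rangle>\<close>.\<close>

definition sphere_div :: "(real ^ 3 \<Rightarrow> real ^ 3) \<Rightarrow> real ^ 3 \<Rightarrow> real" where
  "sphere_div X x = (\<Sum>b\<in>Basis. sphere_deriv X x b \<bullet> b)"

definition sphere_laplacian :: "(real ^ 3 \<Rightarrow> real) \<Rightarrow> real ^ 3 \<Rightarrow> real" where
  "sphere_laplacian v x = - sphere_div (sphere_grad v) x"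

definition energy_density :: "(real ^ 3 \<Rightarrow> real ^ 3) \<Rightarrow> real ^ 3 \<Rightarrow> real" where
  "energy_density \<Phi> x = (\<Sum>b\<in>Basis. (norm (sphere_deriv \<Phi> x b))\<^sup>2)"

primrec sphere_Ck :: "nat \<Rightarrow> (real ^ 3 \<Rightarrow> real) \<Rightarrow> bool" where
  "sphere_Ck 0 v \<longleftrightarrow> continuous_on unit_sphere v"
| "sphere_Ck (Suc k) v \<longleftrightarrow>
     v differentiable_on unit_sphere \<and> (\<forall>i. sphere_Ck k (\<lambda>x. sphere_grad v x $ i))"

definition sphere_smooth :: "(real ^ 3 \<Rightarrow> real) \<Rightarrow> bool" where
  "sphere_smooth v \<longleftrightarrow> (\<forall>k. sphere_Ck k v)"

definition eigenfunction :: "(riemann_sphere \<Rightarrow> riemann_sphere) \<Rightarrow> (real ^ 3 \<Rightarrow> real) \<Rightarrow> bool" where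
  "eigenfunction f v \<longleftrightarrow> sphere_smooth v \<and>
     (\<forall>x\<in>unit_sphere. sphere_laplacian v x = energy_density (sphere_map f) x * v x)"

definition extra_eigenfunction ::
    "(riemann_sphere \<Rightarrow> riemann_sphere) \<Rightarrow> (real ^ 3 \<Rightarrow> real) \<Rightarrow> bool" where
  "extra_eigenfunction f v \<longleftrightarrow> eigenfunction f v \<and>
     \<not> (\<exists>c1 c2 c3. \<forall>x\<in>unit_sphere.
          v x = c1 * sphere_map f x $ 1 + c2 * sphere_map f x $ 2 + c3 * sphere_map f x $ 3)"


section \<open>Branch points and equianharmonic quadruplets\<close>

text \<open>
  Holomorphic charts: \<open>chart_inv p\<close> parametrizes a neighbourhood of \<open>p\<close> with \<open>0 \<mapsto> p\<close>, and \<open>chart p\<close> is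
  its inverse; \<open>chart p\<close> is meaningful only near \<open>p\<close>.
\<close>

definition chart_inv :: "riemann_sphere \<Rightarrow> complex \<Rightarrow> riemann_sphere" where
  "chart_inv p w = (case p of
       None \<Rightarrow> (if w = 0 then None else Some (1 / w))
     | Some a \<Rightarrow> Some (a + w))"

definition chart :: "riemann_sphere \<Rightarrow> riemann_sphere \<Rightarrow> complex" where
  "chart p q = (case (p, q) of
       (None, None) \<Rightarrow> 0
     | (None, Some z) \<Rightarrow> 1 / z
     | (Some a, None) \<Rightarrow> 0
     | (Some a, Some z) \<Rightarrow> z - a)"

definition local_rep :: "(riemann_sphere \<Rightarrow> riemann_sphere) \<Rightarrow> riemann_sphere \<Rightarrow> complex \<Rightarrow> complex" where
  "local_rep f p w = chart (f p) (f (chart_inv p w))"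

definition branch_point :: "(riemann_sphere \<Rightarrow> riemann_sphere) \<Rightarrow> riemann_sphere \<Rightarrow> bool" where
  "branch_point f p \<longleftrightarrow> deriv (local_rep f p) 0 = 0"

definition simple_branch_point ::
    "(riemann_sphere \<Rightarrow> riemann_sphere) \<Rightarrow> riemann_sphere \<Rightarrow> bool" where
  "simple_branch_point f p \<longleftrightarrow> branch_point f p \<and> zorder (deriv (local_rep f p)) 0 = 1"

text \<open>
  The determinant of the homogeneous coordinates \<open>(z, 1)\<close> or \<open>(1, 0)\<close> of two points.  In terms of it the
  cross ratio \<open>(a - c)(b - d) / ((a - d)(b - c))\<close> makes sense when one of the points is \<open>\<infinity>\<close>.
\<close>

definition hom_det :: "riemann_sphere \<Rightarrow> riemann_sphere \<Rightarrow> complex" where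
  "hom_det p q = (case (p, q) of
       (None, None) \<Rightarrow> 0
     | (None, Some z) \<Rightarrow> 1
     | (Some z, None) \<Rightarrow> - 1
     | (Some z, Some w) \<Rightarrow> z - w)"

definition cross_ratio ::
    "riemann_sphere \<Rightarrow> riemann_sphere \<Rightarrow> riemann_sphere \<Rightarrow> riemann_sphere \<Rightarrow> complex" where
  "cross_ratio a b c d = (hom_det a c * hom_det b d) / (hom_det a d * hom_det b c)"

text \<open>
  All orderings of the four points are considered; in general they yield six cross ratios.
\<close>

definition equianharmonic :: "riemann_sphere set \<Rightarrow> bool" where
  "equianharmonic Q \<longleftrightarrow> card Q = 4 \<and>
     card {cross_ratio a b c d | a b c d. Q = {a, b, c, d}} = 2"

end

theory Submission
  imports Defs "HOL-Computational_Algebra.Field_as_Ring"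
begin

text \<open>
  Write \<open>f = [F, G]\<close> and let \<open>W = F' G - F G'\<close>.  Each of (a)--(d) is equivalent to the single equation
  \<open>omega F G = 0\<close> for the \<open>SL\<^sub>2\<close>-invariant symplectic form \<open>omega\<close> on binary cubics.

  (a) Cubics \<open>F0, F1, F2, F3\<close> are horizontal iff \<open>F0 \<and> F1 + F2 \<and> F3\<close> is a multiple of the bivector
  dual to \<open>omega\<close>, so fullness forces \<open>omega F0 F2 = 0\<close>, a closed condition.  Conversely, if it holds,
  \<open>(F, G)\<close> extends to a symplectic basis, and \<open>t \<rightarrow> 0\<close> in \<open>[F, t F1, G, t F3]\<close> exhibits the collapse.

  (b) For horizontal \<open>(F1, F3)\<close> the function \<open>Re ((F1 cnj G - F3 cnj F) / (|F|\<^sup>2 + |G|\<^sup>2))\<close> is an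
  eigenfunction.  Conversely, the traceless Hessian of an eigenfunction \<open>v\<close> with respect to the pulled
  back metric is a holomorphic quadratic differential with poles bounded by the zeros of \<open>W\<close>; in
  degree 3 it is \<open>c / W\<close> for a constant \<open>c\<close>.  If \<open>c = 0\<close>, then \<open>v\<close> is determined by its 1-jet at
  a point and is a linear combination of the coordinates of \<open>f\<close>.  If \<open>c\<close> is nonzero, the Taylor
  expansion at a zero of \<open>W\<close> yields \<open>omega F G = 0\<close>.

  (c) The form \<open>omega\<close> is invariant up to factors under fractional linear transformations; with a branch
  point at infinity mapped to infinity it is the quadratic coefficient of \<open>z\<^sup>3 + p z\<^sup>2 + q\<close> in
  \<open>[z\<^sup>3 + p z\<^sup>2 + q, z]\<close>.

  (d) The square of \<open>omega F G\<close> is the invariant \<open>I\<close> of the quartic \<open>W\<close>, which for distinct roots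
  vanishes iff they are equianharmonic.
\<close>


section \<open>Wirtinger derivatives\<close>

text \<open>Degree 3 enters through a count. As a form \<open>W\<close> has degree 4, while
  quadratic differentials on the sphere are sections of degree -4; so \<open>W\<close> times the
  differential is a global function and Liouville's theorem makes it constant. In degree d it would
  be a polynomial of degree at most 2d - 6. Likewise cubics form a space of dimension 4 with an
  alternating invariant form, so the components of a full map are a basis of it.

  The recurring obstacle is infinity. In the algebra it is absorbed by reading polynomials as forms
  of degree 3 or 4. In the analysis all computations take place in one stereographic chart with
  Wirtinger derivatives; the missing pole is recovered by continuity on the sphere, and smoothness
  there turns into decay estimates in the chart. For the compact-open closure, values at seven
  points are enough, because the polynomials to be identified have degree at most 3 + 3; the
  remaining difficulty, that homogeneous coordinates may degenerate in the limit, is met by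
  normalizing the coefficient matrix.\<close>

lemma symmetric_second_derivative:
  fixes f :: "'a::real_normed_vector \<Rightarrow> 'b::real_normed_vector"
  assumes f: "\<And>z. (f has_derivative f' z) (at z)"
    and L: "((\<lambda>z. f' z h) has_derivative L) (at x)"
    and M: "((\<lambda>z. f' z k) has_derivative M) (at x)"
  shows "L k = M h"
proof -
  define C where "C = norm h + norm k"
  \<comment> \<open>This second difference is symmetric in \<open>h\<close> and \<open>k\<close>.
    Divided by \<open>t\<^sup>2\<close> it tends to \<open>L k\<close> and, with the roles
    exchanged, to \<open>M h\<close>.\<close>
  define \<Delta> where "\<Delta> t = f (x + t *\<^sub>R h + t *\<^sub>R k) - f (x + t *\<^sub>R h) - f (x + t *\<^sub>R k) + f x" for t :: real
  have main: "\<exists>d>0. \<forall>t. 0 < t \<and> t < d \<longrightarrow>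
      norm (f (x + t *\<^sub>R u + t *\<^sub>R w) - f (x + t *\<^sub>R u) - f (x + t *\<^sub>R w) + f x - t\<^sup>2 *\<^sub>R N w) \<le> 2 * e * (norm u + norm w) * t\<^sup>2"
    if N: "((\<lambda>z. f' z u) has_derivative N) (at x)" and e: "e > 0" for u w N and e :: real
  proof -
    interpret N: bounded_linear N using N by (rule has_derivative_bounded_linear)
    from N e obtain d where d: "d > 0"
      and dN: "\<And>y. norm (y - x) < d \<Longrightarrow> norm (f' y u - f' x u - N (y - x)) \<le> e * norm (y - x)"
      unfolding has_derivative_at_alt by blast
    define D where "D = d / (norm u + norm w + 1)"
    have pos: "norm u + norm w + 1 > 0" by (smt (verit) norm_ge_zero)
    have D: "D > 0" using d pos by (simp add: D_def)
    have "norm (f (x + t *\<^sub>R u + t *\<^sub>R w) - f (x + t *\<^sub>R u) - f (x + t *\<^sub>R w) + f x - t\<^sup>2 *\<^sub>R N w) \<le> 2 * e * (norm u + norm w) * t\<^sup>2"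
      if t: "0 < t" "t < D" for t
    proof -
      have small: "t * (norm u + norm w) < d"
      proof -
        have "t * (norm u + norm w + 1) < d" using t(2) pos by (simp add: D_def field_simps)
        then show ?thesis using t(1) by (simp add: algebra_simps)
      qed
      \<comment> \<open>\<open>g t - g 0\<close> is the second difference minus its expected value
        \<open>t\<^sup>2 *\<^sub>R N w\<close>, so the mean value inequality in \<open>s\<close>
        reduces the estimate to the differentiability of \<open>f' _ u\<close> at the single point
        \<open>x\<close>.\<close>
      define g where "g s = f (x + s *\<^sub>R u + t *\<^sub>R w) - f (x + s *\<^sub>R u) - (s * t) *\<^sub>R N w" for s
      have der: "(g has_derivative (\<lambda>r. r *\<^sub>R (f' (x + s *\<^sub>R u + t *\<^sub>R w) u - f' (x + s *\<^sub>R u) u - t *\<^sub>R N w))) (at s within {0..t})" for s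
      proof -
        have l1: "f' y (r *\<^sub>R u) = r *\<^sub>R f' y u" for y r
          using has_derivative_linear[OF f[of y]] by (simp add: linear_scale)
        have 1: "((\<lambda>s. f (x + s *\<^sub>R u + t *\<^sub>R w)) has_derivative (\<lambda>r. f' (x + s *\<^sub>R u + t *\<^sub>R w) (r *\<^sub>R u))) (at s within {0..t})"
          by (rule has_derivative_compose[where g=f and f="\<lambda>s. x + s *\<^sub>R u + t *\<^sub>R w", OF _ f]) (auto intro!: derivative_eq_intros)
        have 2: "((\<lambda>s. f (x + s *\<^sub>R u)) has_derivative (\<lambda>r. f' (x + s *\<^sub>R u) (r *\<^sub>R u))) (at s within {0..t})"
          by (rule has_derivative_compose[where g=f and f="\<lambda>s. x + s *\<^sub>R u", OF _ f]) (auto intro!: derivative_eq_intros)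
        show ?thesis unfolding g_def
          by (rule has_derivative_eq_rhs, (rule derivative_intros 1 2)+) (auto simp: l1 algebra_simps)
      qed
      have "norm (g t - g 0) \<le> (2 * e * (norm u + norm w) * t) * norm (t - 0)"
      proof (rule differentiable_bound[where S="{0..t}"])
        fix s assume s: "s \<in> {0..t}"
        show "(g has_derivative (\<lambda>r. r *\<^sub>R (f' (x + s *\<^sub>R u + t *\<^sub>R w) u - f' (x + s *\<^sub>R u) u - t *\<^sub>R N w))) (at s within {0..t})"
          by (rule der)
        have n1: "norm (s *\<^sub>R u + t *\<^sub>R w) \<le> t * (norm u + norm w)"
        proof -
          have "norm (s *\<^sub>R u + t *\<^sub>R w) \<le> s * norm u + t * norm w"
            using norm_triangle_ineq[of "s *\<^sub>R u" "t *\<^sub>R w"] s t by simp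
          also have "\<dots> \<le> t * norm u + t * norm w" using s by (intro add_right_mono mult_right_mono) auto
          finally show ?thesis by (simp add: algebra_simps)
        qed
        have n2: "norm (s *\<^sub>R u) \<le> t * (norm u + norm w)"
        proof -
          have "norm (s *\<^sub>R u) \<le> t * norm u" using s by (auto intro: mult_right_mono)
          also have "\<dots> \<le> t * (norm u + norm w)" using t by (intro mult_left_mono) auto
          finally show ?thesis .
        qed
        let ?A = "f' (x + s *\<^sub>R u + t *\<^sub>R w) u - f' x u - N (s *\<^sub>R u + t *\<^sub>R w)"
        let ?B = "f' (x + s *\<^sub>R u) u - f' x u - N (s *\<^sub>R u)"
        have A: "norm ?A \<le> e * (t * (norm u + norm w))"
          using dN[of "x + s *\<^sub>R u + t *\<^sub>R w"] n1 small e
          by (smt (verit) add.assoc add_diff_cancel_left' mult_left_mono)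
        have B: "norm ?B \<le> e * (t * (norm u + norm w))"
          using dN[of "x + s *\<^sub>R u"] n2 small e
          by (smt (verit) add_diff_cancel_left' mult_left_mono)
        have "f' (x + s *\<^sub>R u + t *\<^sub>R w) u - f' (x + s *\<^sub>R u) u - t *\<^sub>R N w = ?A - ?B"
          by (simp add: N.add N.scaleR)
        then have "norm (f' (x + s *\<^sub>R u + t *\<^sub>R w) u - f' (x + s *\<^sub>R u) u - t *\<^sub>R N w) \<le> 2 * e * (norm u + norm w) * t"
          using norm_triangle_ineq4[of ?A ?B] A B by (simp add: algebra_simps)
        then show "onorm (\<lambda>r. r *\<^sub>R (f' (x + s *\<^sub>R u + t *\<^sub>R w) u - f' (x + s *\<^sub>R u) u - t *\<^sub>R N w)) \<le> 2 * e * (norm u + norm w) * t"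
          by (intro onorm_le) (auto simp: mult.commute mult_left_mono)
      qed (use t in auto)
      then show ?thesis using t by (simp add: g_def power2_eq_square algebra_simps)
    qed
    with D show ?thesis by blast
  qed
  have "norm (L k - M h) \<le> e" if e: "e > 0" for e :: real
  proof -
    define e' where "e' = e / (4 * (C + 1))"
    have C: "C \<ge> 0" by (simp add: C_def)
    have e': "e' > 0" using e C by (simp add: e'_def)
    obtain d1 where d1: "d1 > 0" and A1: "\<And>t. 0 < t \<and> t < d1 \<Longrightarrow> norm (\<Delta> t - t\<^sup>2 *\<^sub>R L k) \<le> 2 * e' * C * t\<^sup>2"
      using main[OF L e', of k] unfolding C_def \<Delta>_def by blast
    obtain d2 where d2: "d2 > 0" and A2: "\<And>t. 0 < t \<and> t < d2 \<Longrightarrow> norm (\<Delta> t - t\<^sup>2 *\<^sub>R M h) \<le> 2 * e' * C * t\<^sup>2"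
    proof -
      obtain d2 where d2: "d2 > 0" and A2: "\<And>t. 0 < t \<and> t < d2 \<Longrightarrow> norm (f (x + t *\<^sub>R k + t *\<^sub>R h) - f (x + t *\<^sub>R k) - f (x + t *\<^sub>R h) + f x - t\<^sup>2 *\<^sub>R M h) \<le> 2 * e' * (norm k + norm h) * t\<^sup>2"
        using main[OF M e', of h] by blast
      have "f (x + t *\<^sub>R k + t *\<^sub>R h) - f (x + t *\<^sub>R k) - f (x + t *\<^sub>R h) + f x = \<Delta> t" for t
        by (simp add: \<Delta>_def algebra_simps)
      with d2 A2 that show ?thesis by (simp add: C_def add.commute)
    qed
    define t where "t = min d1 d2 / 2"
    have t: "t > 0" "t < d1" "t < d2" using d1 d2 by (auto simp: t_def)
    have "norm (t\<^sup>2 *\<^sub>R (L k - M h)) \<le> 4 * e' * C * t\<^sup>2"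
      using A1[of t] A2[of t] t norm_triangle_ineq4[of "\<Delta> t - t\<^sup>2 *\<^sub>R M h" "\<Delta> t - t\<^sup>2 *\<^sub>R L k"]
      by (simp add: algebra_simps)
    then have "norm (L k - M h) \<le> 4 * e' * C" using t by simp
    also have "\<dots> \<le> e" using e C by (simp add: e'_def field_simps)
    finally show ?thesis .
  qed
  then have "norm (L k - M h) \<le> 0" by (rule field_le_epsilon) simp
  then show ?thesis by simp
qed

text \<open>\<open>a = \<partial>u/\<partial>z\<close> and \<open>b = \<partial>u/\<partial>(cnj z)\<close>; \<open>u\<close> is only required to be real differentiable.\<close>

definition wirtinger :: "(complex \<Rightarrow> complex) \<Rightarrow> complex \<Rightarrow> complex \<Rightarrow> complex \<Rightarrow> bool" where
  "wirtinger u z a b \<longleftrightarrow> (u has_derivative (\<lambda>h. a * h + b * cnj h)) (at z)"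

lemma wirtinger_cong: "wirtinger u z a b \<Longrightarrow> a = a' \<Longrightarrow> b = b' \<Longrightarrow> wirtinger u z a' b'"
  by simp

lemma wirtinger_const: "wirtinger (\<lambda>_. k) z 0 0"
  by (simp add: wirtinger_def)

lemma wirtinger_id: "wirtinger (\<lambda>z. z) z 1 0"
  by (simp add: wirtinger_def)

lemma wirtinger_add:
  "wirtinger u z a b \<Longrightarrow> wirtinger v z c d \<Longrightarrow> wirtinger (\<lambda>z. u z + v z) z (a + c) (b + d)"
  unfolding wirtinger_def
  by (rule has_derivative_eq_rhs, rule has_derivative_add, assumption+) (auto simp: algebra_simps)

lemma wirtinger_diff:
  "wirtinger u z a b \<Longrightarrow> wirtinger v z c d \<Longrightarrow> wirtinger (\<lambda>z. u z - v z) z (a - c) (b - d)"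
  unfolding wirtinger_def
  by (rule has_derivative_eq_rhs, rule has_derivative_diff, assumption+) (auto simp: algebra_simps)

lemma wirtinger_mult:
  "wirtinger u z a b \<Longrightarrow> wirtinger v z c d \<Longrightarrow>
     wirtinger (\<lambda>z. u z * v z) z (a * v z + u z * c) (b * v z + u z * d)"
  unfolding wirtinger_def
  by (rule has_derivative_eq_rhs, rule has_derivative_mult, assumption+) (auto simp: algebra_simps)

lemma wirtinger_cmult: "wirtinger u z a b \<Longrightarrow> wirtinger (\<lambda>z. k * u z) z (k * a) (k * b)"
  using wirtinger_mult[OF wirtinger_const] by fastforce

lemma wirtinger_inverse:
  "wirtinger u z a b \<Longrightarrow> u z \<noteq> 0 \<Longrightarrow>
     wirtinger (\<lambda>z. inverse (u z)) z (- a / (u z)\<^sup>2) (- b / (u z)\<^sup>2)"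
  unfolding wirtinger_def
  by (rule has_derivative_eq_rhs, rule Deriv.has_derivative_inverse, assumption+)
     (auto simp: field_simps power2_eq_square)

lemma wirtinger_divide:
  "wirtinger u z a b \<Longrightarrow> wirtinger v z c d \<Longrightarrow> v z \<noteq> 0 \<Longrightarrow>
     wirtinger (\<lambda>z. u z / v z) z ((a * v z - u z * c) / (v z)\<^sup>2) ((b * v z - u z * d) / (v z)\<^sup>2)"
  unfolding divide_inverse[of "u _"]
  by (rule wirtinger_cong, rule wirtinger_mult, assumption, rule wirtinger_inverse, assumption+)
     (auto simp: field_simps power2_eq_square)

lemma wirtinger_cnj: "wirtinger u z a b \<Longrightarrow> wirtinger (\<lambda>z. cnj (u z)) z (cnj b) (cnj a)"
  unfolding wirtinger_def
  by (rule has_derivative_eq_rhs, rule has_derivative_cnj, assumption) (auto simp: algebra_simps)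

lemma wirtinger_sum:
  "(\<And>i. i \<in> I \<Longrightarrow> wirtinger (u i) z (a i) (b i)) \<Longrightarrow>
     wirtinger (\<lambda>z. \<Sum>i\<in>I. u i z) z (\<Sum>i\<in>I. a i) (\<Sum>i\<in>I. b i)"
  unfolding wirtinger_def
  by (rule has_derivative_eq_rhs, rule has_derivative_sum, assumption)
     (auto simp: sum.distrib sum_distrib_right)

lemma wirtinger_holomorphic:
  "(u has_field_derivative a) (at z) \<Longrightarrow> wirtinger u z a 0"
  by (simp add: wirtinger_def has_field_derivative_def)

lemma wirtinger_poly: "wirtinger (poly F) z (poly (pderiv F) z) 0"
  by (intro wirtinger_holomorphic poly_DERIV)

lemma wirtinger_unique:
  assumes "wirtinger u z a b" "wirtinger u z c d" shows "a = c" "b = d"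
proof -
  have *: "(\<lambda>h. a * h + b * cnj h) = (\<lambda>h. c * h + d * cnj h)"
    using assms unfolding wirtinger_def by (rule has_derivative_unique)
  have 1: "a + b = c + d" using fun_cong[OF *, of 1] by simp
  have "\<i> * (a - b) = \<i> * (c - d)" using fun_cong[OF *, of \<i>] by (simp add: algebra_simps)
  then have 2: "a - b = c - d" by simp
  have "2 * a = (a + b) + (a - b)" "2 * b = (a + b) - (a - b)" by simp_all
  then have "2 * a = 2 * c" "2 * b = 2 * d" unfolding 1 2 by simp_all
  then show "a = c" "b = d" by simp_all
qed

lemma wirtinger_continuous: "wirtinger u z a b \<Longrightarrow> isCont u z"
  unfolding wirtinger_def by (rule has_derivative_continuous)

text \<open>Symmetry of the second derivative in the real directions 1 and \<open>\<i>\<close>. It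
  yields derivatives that would be laborious to compute directly from those in the other
  order.\<close>

lemma wirtinger_mixed:
  assumes u: "\<And>z. wirtinger u z (a z) (b z)"
    and a: "wirtinger a z a1 a2" and b: "wirtinger b z b1 b2"
  shows "a2 = b1"
proof -
  have A: "((\<lambda>w. a w * h + b w * cnj h) has_derivative (\<lambda>k. (a1 * k + a2 * cnj k) * h + (b1 * k + b2 * cnj k) * cnj h)) (at z)" for h
    using a b unfolding wirtinger_def by (auto intro!: derivative_eq_intros)
  have "(a1 * \<i> + a2 * cnj \<i>) * 1 + (b1 * \<i> + b2 * cnj \<i>) * cnj 1 = (a1 * 1 + a2 * cnj 1) * \<i> + (b1 * 1 + b2 * cnj 1) * cnj \<i>"
    by (rule symmetric_second_derivative[OF u[unfolded wirtinger_def] A A])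
  then have "2 * \<i> * a2 = 2 * \<i> * b1" by (simp add: algebra_simps)
  then show ?thesis by simp
qed


section \<open>Pencils of cubics\<close>

definition wronskian :: "complex poly \<Rightarrow> complex poly \<Rightarrow> complex poly" where
  "wronskian F G = pderiv F * G - F * pderiv G"

definition cubic_pair :: "complex poly \<Rightarrow> complex poly \<Rightarrow> bool" where
  "cubic_pair F G \<longleftrightarrow> coprime F G \<and> max (degree F) (degree G) = 3"

text \<open>The \<open>SL\<^sub>2\<close>-invariant symplectic form on binary cubics.\<close>

definition omega :: "complex poly \<Rightarrow> complex poly \<Rightarrow> complex" where
  "omega F G = 3 * coeff F 0 * coeff G 3 - coeff F 1 * coeff G 2 + coeff F 2 * coeff G 1
     - 3 * coeff F 3 * coeff G 0"

abbreviation plucker :: "complex poly \<Rightarrow> complex poly \<Rightarrow> nat \<Rightarrow> nat \<Rightarrow> complex" where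
  "plucker F G i j \<equiv> coeff F i * coeff G j - coeff F j * coeff G i"

lemma cubic_pairD:
  assumes "cubic_pair F G"
  shows "coprime F G" "degree F \<le> 3" "degree G \<le> 3" "degree F = 3 \<or> degree G = 3"
    "F \<noteq> 0" "G \<noteq> 0"
proof -
  show "coprime F G" "degree F \<le> 3" "degree G \<le> 3" "degree F = 3 \<or> degree G = 3"
    using assms by (auto simp: cubic_pair_def)
  show "F \<noteq> 0"
  proof
    assume "F = 0"
    then have "is_unit G" "degree G = 3" using assms by (simp_all add: cubic_pair_def)
    then show False using is_unit_iff_degree[of G] by (cases "G = 0") auto
  qed
  show "G \<noteq> 0"
  proof
    assume "G = 0"
    then have "is_unit F" "degree F = 3" using assms by (simp_all add: cubic_pair_def)
    then show False using is_unit_iff_degree[of F] by (cases "F = 0") auto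
  qed
qed

lemma Hol_3E:
  assumes "f \<in> Hol 3"
  obtains F G where "cubic_pair F G" "f = cp1_map F G"
  using assms by (auto simp: Hol_def cubic_pair_def)

lemma cubic_coeffs:
  fixes F :: "complex poly"
  assumes "degree F \<le> 3"
  shows "F = [:coeff F 0, coeff F 1, coeff F 2, coeff F 3:]"
proof (rule poly_eqI)
  fix n
  show "coeff F n = coeff [:coeff F 0, coeff F 1, coeff F 2, coeff F 3:] n"
    using assms coeff_eq_0[of F n]
    by (cases "n = 0 \<or> n = 1 \<or> n = 2 \<or> n = 3")
       (auto simp: coeff_pCons numeral_eq_Suc split: nat.splits)
qed

lemma poly_cubic:
  fixes F :: "complex poly"
  assumes "degree F \<le> 3"
  shows "poly F z = coeff F 0 + coeff F 1 * z + coeff F 2 * z\<^sup>2 + coeff F 3 * z ^ 3"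
proof -
  have "poly [:a, b, c, d:] z = a + b * z + c * z\<^sup>2 + d * z ^ 3" for a b c d
    by (simp add: algebra_simps power2_eq_square power3_eq_cube)
  then show ?thesis using cubic_coeffs[OF assms] by metis
qed

text \<open>Only the coefficient of z^2 mixes two Pluecker coordinates, p30 and p21. The
  complementary combination -3 p30 + p21 is \<open>omega\<close>: bivectors of cubics split into
  quartics, seen by the Wronskian, and one invariant.\<close>

lemma wronskian_cubic:
  assumes "degree F \<le> 3" "degree G \<le> 3"
  shows "wronskian F G = [: plucker F G 1 0, 2 * plucker F G 2 0,
            3 * plucker F G 3 0 + plucker F G 2 1, 2 * plucker F G 3 1, plucker F G 3 2 :]"
proof -
  have "wronskian [:a0, a1, a2, a3:] [:b0, b1, b2, b3:] =
     [: a1 * b0 - a0 * b1, 2 * (a2 * b0 - a0 * b2), 3 * (a3 * b0 - a0 * b3) + (a2 * b1 - a1 * b2),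
        2 * (a3 * b1 - a1 * b3), a3 * b2 - a2 * b3 :]" for a0 a1 a2 a3 b0 b1 b2 b3
    by (simp add: wronskian_def pderiv_pCons algebra_simps)
  from this[of "coeff F 0" "coeff F 1" "coeff F 2" "coeff F 3" "coeff G 0" "coeff G 1" "coeff G 2" "coeff G 3"]
  show ?thesis using cubic_coeffs[OF assms(1)] cubic_coeffs[OF assms(2)] by simp
qed

lemma coeff_wronskian:
  assumes "degree F \<le> 3" "degree G \<le> 3"
  shows "coeff (wronskian F G) 0 = plucker F G 1 0"
    "coeff (wronskian F G) 1 = 2 * plucker F G 2 0"
    "coeff (wronskian F G) 2 = 3 * plucker F G 3 0 + plucker F G 2 1"
    "coeff (wronskian F G) 3 = 2 * plucker F G 3 1"
    "coeff (wronskian F G) 4 = plucker F G 3 2"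
    "degree (wronskian F G) \<le> 4"
  unfolding wronskian_cubic[OF assms] by (simp_all add: numeral_eq_Suc)

text \<open>The invariant \<open>I = 12 w4 w0 - 3 w3 w1 + w2\<^sup>2\<close> of a quartic with coefficients \<open>wi\<close>; for a
  Wronskian of cubics it is a square, by the Pluecker relation.\<close>

lemma quartic_invariant:
  assumes "degree F \<le> 3" "degree G \<le> 3"
  shows "12 * coeff (wronskian F G) 4 * coeff (wronskian F G) 0
      - 3 * coeff (wronskian F G) 3 * coeff (wronskian F G) 1 + (coeff (wronskian F G) 2)\<^sup>2
      = (omega F G)\<^sup>2"
  unfolding coeff_wronskian[OF assms] omega_def by algebra

text \<open>By coprimality the two pairs differ by a common polynomial factor, and the degree bounds
  leave room only for a constant, since \<open>F\<close> or \<open>G\<close> already has degree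
  3.\<close>

lemma cubic_pair_proportional:
  assumes "cubic_pair F G" and eq: "F * G' = G * F'" and deg: "degree F' \<le> 3" "degree G' \<le> 3"
  shows "\<exists>k. F' = smult k F \<and> G' = smult k G"
proof -
  note D = cubic_pairD[OF assms(1)]
  have "F dvd G * F'" unfolding eq[symmetric] by (rule dvd_triv_left)
  then have "F dvd F'" using coprime_dvd_mult_right_iff[OF D(1)] by blast
  then obtain q where q: "F' = F * q" by (rule dvdE)
  have "F * G' = F * (G * q)" using eq q by (simp add: algebra_simps)
  then have q': "G' = G * q" using D(5) by simp
  have "degree q = 0"
  proof (cases "q = 0")
    case False
    then have "degree F' = degree F + degree q" "degree G' = degree G + degree q"
      using q q' D(5,6) by (simp_all add: degree_mult_eq)
    then show ?thesis using deg D(4) by linarith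
  qed simp
  then obtain k where "q = [:k:]" by (metis degree_eq_zeroE)
  then show ?thesis using q q' by auto
qed

lemma omega_smult: "omega (smult k F) (smult l G) = k * l * omega F G"
  by (simp add: omega_def algebra_simps)

lemma poly_eqI_nat:
  assumes "degree (p :: complex poly) < n" "degree q < n" "\<And>i. i < n \<Longrightarrow> poly p (of_nat i) = poly q (of_nat i)"
  shows "p = q"
proof (rule ccontr)
  assume "p \<noteq> q"
  then have "p - q \<noteq> 0" by simp
  have "card (of_nat ` {..<n} :: complex set) \<le> card {x. poly (p - q) x = 0}"
    using assms(3) poly_roots_finite[OF \<open>p - q \<noteq> 0\<close>] by (intro card_mono) auto
  also have "\<dots> \<le> degree (p - q)" by (rule card_poly_roots_bound[OF \<open>p - q \<noteq> 0\<close>])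
  also have "\<dots> \<le> max (degree p) (degree q)" by (rule degree_diff_le_max)
  also have "\<dots> < n" using assms(1,2) by simp
  finally show False by (simp add: card_image inj_on_def)
qed

lemma cp1_point_cross:
  "cp1_point a b = cp1_point c d \<Longrightarrow> a * d = b * c"
  by (auto simp: cp1_point_def field_simps split: if_splits)

lemma cp1_map_cubic:
  assumes "cubic_pair F G"
  shows "cp1_map F G p = cp1_point (hom_eval 3 F p) (hom_eval 3 G p)"
  using assms by (simp add: cp1_map_def cubic_pair_def)

lemma cp1_map_eq_imp:
  assumes "cubic_pair F G" "degree F' \<le> 3" "degree G' \<le> 3"
    "\<And>z. cp1_map F G (Some z) = cp1_point (poly F' z) (poly G' z)"
  shows "\<exists>k. F' = smult k F \<and> G' = smult k G"
proof (rule cubic_pair_proportional[OF assms(1) _ assms(2,3)])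
  have "poly (F * G') z = poly (G * F') z" for z
    using cp1_point_cross[OF assms(4)[of z, unfolded cp1_map_cubic[OF assms(1)]]]
    by (simp add: hom_eval_def)
  then show "F * G' = G * F'" by (subst poly_eq_poly_eq_iff[symmetric]) (rule ext)
qed

lemma cubic_pair_hom_eval_nonzero:
  assumes "cubic_pair F G" shows "hom_eval 3 F p \<noteq> 0 \<or> hom_eval 3 G p \<noteq> 0"
proof (cases p)
  case None
  then show ?thesis using cubic_pairD[OF assms]
    by (auto simp: hom_eval_def) (metis leading_coeff_0_iff)+
next
  case (Some a)
  then show ?thesis using coprime_poly_0[OF cubic_pairD(1)[OF assms], of a]
    by (auto simp: hom_eval_def)
qed

text \<open>Otherwise \<open>F\<close> would be a scalar multiple of \<open>G\<close>; coprimality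
  would then make \<open>G\<close> a unit and both polynomials constant.\<close>

lemma plucker_nonzero:
  assumes "cubic_pair F G"
  shows "\<exists>i\<le>3. \<exists>j\<le>3. plucker F G i j \<noteq> 0"
proof (rule ccontr)
  assume *: "\<not> ?thesis"
  note D = cubic_pairD[OF assms]
  obtain i where i: "coeff G i \<noteq> 0" using D(6) by (metis leading_coeff_0_iff)
  have i3: "i \<le> 3" using i D(3) le_degree order_trans by blast
  have "smult (coeff G i) F = smult (coeff F i) G"
  proof (rule poly_eqI)
    fix n show "coeff (smult (coeff G i) F) n = coeff (smult (coeff F i) G) n"
    proof (cases "n \<le> 3")
      case True then show ?thesis using * i3 by (auto simp: algebra_simps)
    next
      case False then show ?thesis using D(2,3) by (simp add: coeff_eq_0)
    qed
  qed
  then have "smult (inverse (coeff G i)) (smult (coeff G i) F) = smult (inverse (coeff G i)) (smult (coeff F i) G)" by simp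
  then have "F = smult (coeff F i / coeff G i) G" using i by (simp add: field_simps)
  then have "G dvd F" by (metis dvd_smult dvd_refl)
  then have "is_unit G" using D(1) by (meson coprime_common_divisor dvd_refl)
  then have "degree G = 0" by (simp add: is_unit_iff_degree D(6))
  moreover have "degree F \<le> degree G" using \<open>F = smult _ G\<close> by (metis degree_smult_le)
  ultimately show False using D(4) by simp
qed


section \<open>Fractional linear transformations of domain and codomain\<close>

definition hom_coords :: "riemann_sphere \<Rightarrow> complex \<times> complex" where
  "hom_coords p = (case p of None \<Rightarrow> (1, 0) | Some z \<Rightarrow> (z, 1))"

definition cubic_form :: "complex poly \<Rightarrow> complex \<Rightarrow> complex \<Rightarrow> complex" where
  "cubic_form F x y = coeff F 0 * y ^ 3 + coeff F 1 * x * y\<^sup>2 + coeff F 2 * x\<^sup>2 * y + coeff F 3 * x ^ 3"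

text \<open>Here 3 is the nominal degree, whatever the actual degrees are. A linear substitution may
  lower the degree of both cubics, and in this form it still acts without case distinctions at
  infinity.\<close>

definition cubic_map :: "complex poly \<Rightarrow> complex poly \<Rightarrow> riemann_sphere \<Rightarrow> riemann_sphere" where
  "cubic_map F G p = (case hom_coords p of (x, y) \<Rightarrow> cp1_point (cubic_form F x y) (cubic_form G x y))"

definition mobius :: "complex \<Rightarrow> complex \<Rightarrow> complex \<Rightarrow> complex \<Rightarrow> riemann_sphere \<Rightarrow> riemann_sphere" where
  "mobius a b c e p = (case hom_coords p of (x, y) \<Rightarrow> cp1_point (a * x + b * y) (c * x + e * y))"

text \<open>No common zero on the projective line, infinity included. It stands in for
  \<open>cubic_pair\<close> in a form that linear substitutions visibly preserve.\<close>

definition nonvanishing :: "complex poly \<Rightarrow> complex poly \<Rightarrow> bool" where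
  "nonvanishing F G \<longleftrightarrow> (\<forall>x y. (x, y) \<noteq> (0, 0) \<longrightarrow> cubic_form F x y \<noteq> 0 \<or> cubic_form G x y \<noteq> 0)"

lemma cubic_form_scale: "cubic_form F (k * x) (k * y) = k ^ 3 * cubic_form F x y"
  by (simp add: cubic_form_def algebra_simps power2_eq_square power3_eq_cube)

lemma cp1_point_scale: "k \<noteq> 0 \<Longrightarrow> cp1_point (k * u) (k * v) = cp1_point u v"
  by (simp add: cp1_point_def)

lemma hom_coords_cp1_point:
  assumes "(u, v) \<noteq> (0, 0)"
  obtains k where "k \<noteq> 0" "hom_coords (cp1_point u v) = (k * u, k * v)"
proof (cases "v = 0")
  case True
  then show ?thesis using assms that[of "1 / u"] by (simp add: hom_coords_def cp1_point_def)
next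
  case False
  then show ?thesis using that[of "1 / v"] by (simp add: hom_coords_def cp1_point_def)
qed

lemma hom_eval_cubic_form:
  assumes "degree F \<le> 3"
  shows "hom_eval 3 F p = (case hom_coords p of (x, y) \<Rightarrow> cubic_form F x y)"
  using poly_cubic[OF assms]
  by (cases p) (simp_all add: hom_eval_def hom_coords_def cubic_form_def)

lemma cp1_map_cubic_map: "cubic_pair F G \<Longrightarrow> cp1_map F G = cubic_map F G"
  by (rule ext) (simp add: cp1_map_cubic hom_eval_cubic_form cubic_pairD cubic_map_def split: prod.splits)

lemma nonvanishing_cubic_pair:
  assumes "cubic_pair F G"
  shows "nonvanishing F G"
  unfolding nonvanishing_def
proof (intro allI impI)
  fix x y :: complex
  assume xy: "(x, y) \<noteq> (0, 0)"
  then obtain k where k: "k \<noteq> 0" "hom_coords (cp1_point x y) = (k * x, k * y)"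
    by (rule hom_coords_cp1_point)
  show "cubic_form F x y \<noteq> 0 \<or> cubic_form G x y \<noteq> 0"
    using cubic_pair_hom_eval_nonzero[OF assms, of "cp1_point x y"] k
    by (simp add: hom_eval_cubic_form cubic_pairD[OF assms] cubic_form_scale)
qed

lemma cubic_map_cp1_point:
  assumes "(x, y) \<noteq> (0, 0)"
  shows "cubic_map F G (cp1_point x y) = cp1_point (cubic_form F x y) (cubic_form G x y)"
proof -
  obtain k where k: "k \<noteq> 0" "hom_coords (cp1_point x y) = (k * x, k * y)"
    using assms by (rule hom_coords_cp1_point)
  then show ?thesis by (simp add: cubic_map_def cubic_form_scale cp1_point_scale)
qed

lemma mobius_cp1_point:
  assumes "(x, y) \<noteq> (0, 0)"
  shows "mobius a b c e (cp1_point x y) = cp1_point (a * x + b * y) (c * x + e * y)"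
proof -
  obtain k where k: "k \<noteq> 0" "hom_coords (cp1_point x y) = (k * x, k * y)"
    using assms by (rule hom_coords_cp1_point)
  then have "mobius a b c e (cp1_point x y) = cp1_point (k * (a * x + b * y)) (k * (c * x + e * y))"
    by (simp add: mobius_def algebra_simps)
  then show ?thesis using k by (simp add: cp1_point_scale)
qed

lemma hom_coords_nonzero: "hom_coords p = (x, y) \<Longrightarrow> (x, y) \<noteq> (0, 0)"
  by (auto simp: hom_coords_def split: option.splits)

lemma linear_nonzero:
  fixes a b c e x y :: complex
  assumes "a * e - b * c \<noteq> 0" "(x, y) \<noteq> (0, 0)"
  shows "(a * x + b * y, c * x + e * y) \<noteq> (0, 0)"
proof
  assume "(a * x + b * y, c * x + e * y) = (0, 0)"
  then have 0: "a * x + b * y = 0" "c * x + e * y = 0" by auto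
  have "(a * e - b * c) * x = e * (a * x + b * y) - b * (c * x + e * y)"
    "(a * e - b * c) * y = a * (c * x + e * y) - c * (a * x + b * y)" by (simp_all add: algebra_simps)
  then show False using assms 0 by simp
qed

lemma cp1_map_linear:
  assumes "a * e - b * c \<noteq> 0"
  shows "cp1_map [:b, a:] [:e, c:] = mobius a b c e"
proof
  fix p
  have "max (degree [:b, a:]) (degree [:e, c:]) = 1" using assms by auto
  then show "cp1_map [:b, a:] [:e, c:] p = mobius a b c e p"
    by (cases p) (simp_all add: cp1_map_def mobius_def hom_coords_def hom_eval_def algebra_simps)
qed

lemma fractional_linear_mobius:
  "fractional_linear \<phi> \<longleftrightarrow> (\<exists>a b c e. a * e - b * c \<noteq> 0 \<and> \<phi> = mobius a b c e)"
  unfolding fractional_linear_def by (metis cp1_map_linear)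

lemma mobius_mobius:
  assumes "a' * e' - b' * c' \<noteq> 0"
  shows "mobius a b c e (mobius a' b' c' e' p) =
    mobius (a * a' + b * c') (a * b' + b * e') (c * a' + e * c') (c * b' + e * e') p"
proof -
  obtain x y where xy: "hom_coords p = (x, y)" by fastforce
  show ?thesis
    unfolding mobius_def[of a' b' c' e'] mobius_def[of "a * a' + b * c'"] xy
    using mobius_cp1_point[OF linear_nonzero[OF assms hom_coords_nonzero[OF xy]], of a b c e]
    by (simp add: algebra_simps)
qed

lemma fractional_linear_comp:
  assumes "fractional_linear \<phi>" "fractional_linear \<psi>"
  shows "fractional_linear (\<phi> \<circ> \<psi>)"
proof -
  obtain a b c e a' b' c' e' where
    1: "a * e - b * c \<noteq> 0" "\<phi> = mobius a b c e" and 2: "a' * e' - b' * c' \<noteq> 0" "\<psi> = mobius a' b' c' e'"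
    using assms unfolding fractional_linear_mobius by metis
  have "(a * a' + b * c') * (c * b' + e * e') - (a * b' + b * e') * (c * a' + e * c') =
    (a * e - b * c) * (a' * e' - b' * c')" by (simp add: algebra_simps)
  then show ?thesis unfolding fractional_linear_mobius
    using 1 2 by (intro exI[of _ "a * a' + b * c'"] exI[of _ "a * b' + b * e'"] exI[of _ "c * a' + e * c'"] exI[of _ "c * b' + e * e'"])
      (auto simp: mobius_mobius)
qed

text \<open>The coefficients of the form after a linear substitution, expanded by hand so that the
  invariance of \<open>omega\<close> becomes a polynomial identity.\<close>

definition cubic_pullback :: "complex \<Rightarrow> complex \<Rightarrow> complex \<Rightarrow> complex \<Rightarrow> complex poly \<Rightarrow> complex poly" where
  "cubic_pullback a b c e F = (let f0 = coeff F 0; f1 = coeff F 1; f2 = coeff F 2; f3 = coeff F 3 in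
    [: f0 * e ^ 3 + f1 * b * e\<^sup>2 + f2 * b\<^sup>2 * e + f3 * b ^ 3,
       3 * f0 * c * e\<^sup>2 + f1 * (a * e\<^sup>2 + 2 * b * c * e) + f2 * (2 * a * b * e + b\<^sup>2 * c) + 3 * f3 * a * b\<^sup>2,
       3 * f0 * c\<^sup>2 * e + f1 * (2 * a * c * e + b * c\<^sup>2) + f2 * (a\<^sup>2 * e + 2 * a * b * c) + 3 * f3 * a\<^sup>2 * b,
       f0 * c ^ 3 + f1 * a * c\<^sup>2 + f2 * a\<^sup>2 * c + f3 * a ^ 3 :])"

lemma coeff_list4:
  "coeff [:a, b, c, d:] 0 = a" "coeff [:a, b, c, d:] 1 = b" "coeff [:a, b, c, d:] (Suc 0) = b"
  "coeff [:a, b, c, d:] 2 = c" "coeff [:a, b, c, d:] 3 = d"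
  by (simp_all add: numeral_eq_Suc)

lemma cubic_form_pullback:
  "cubic_form (cubic_pullback a b c e F) x y = cubic_form F (a * x + b * y) (c * x + e * y)"
  unfolding cubic_form_def cubic_pullback_def Let_def coeff_list4 by algebra

lemma omega_pullback:
  "omega (cubic_pullback a b c e F) (cubic_pullback a b c e G) = (a * e - b * c) ^ 3 * omega F G"
  unfolding omega_def cubic_pullback_def Let_def coeff_list4 by algebra

lemma nonvanishing_pullback:
  assumes "nonvanishing F G" "a * e - b * c \<noteq> 0"
  shows "nonvanishing (cubic_pullback a b c e F) (cubic_pullback a b c e G)"
  using assms linear_nonzero[OF assms(2)] unfolding nonvanishing_def cubic_form_pullback by metis

lemma cubic_map_mobius:
  assumes "a * e - b * c \<noteq> 0"
  shows "cubic_map F G (mobius a b c e p) = cubic_map (cubic_pullback a b c e F) (cubic_pullback a b c e G) p"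
proof -
  obtain x y where xy: "hom_coords p = (x, y)" by fastforce
  show ?thesis
    using cubic_map_cp1_point[OF linear_nonzero[OF assms hom_coords_nonzero[OF xy]], of F G]
    by (simp add: mobius_def cubic_map_def[of _ _ p] xy cubic_form_pullback)
qed

section \<open>The model map and the normal form of pencils with vanishing
  \<open>omega\<close>\<close>

abbreviation (input) "model_num \<equiv> [:2, 0, 0, 1:] :: complex poly"
abbreviation (input) "model_den \<equiv> [:0, - (1 / 3):] :: complex poly"

lemma cubic_form_model: "cubic_form model_num x y = x ^ 3 + 2 * y ^ 3" "cubic_form model_den x y = - (x * y\<^sup>2) / 3"
  by (simp_all add: cubic_form_def numeral_eq_Suc)

lemma nonvanishing_model: "nonvanishing model_num model_den"
  by (auto simp: nonvanishing_def cubic_form_model)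

lemma cp1_map_model: "cp1_map model_num model_den = cubic_map model_num model_den"
proof
  fix p
  have m: "max (degree model_num) (degree model_den) = 3" by simp
  have d: "degree model_num \<le> 3" "degree model_den \<le> 3" by simp_all
  show "cp1_map model_num model_den p = cubic_map model_num model_den p"
    unfolding cp1_map_def m Let_def hom_eval_cubic_form[OF d(1)] hom_eval_cubic_form[OF d(2)] cubic_map_def
    by (simp split: prod.splits)
qed

definition mobius_equivalent_model :: "(riemann_sphere \<Rightarrow> riemann_sphere) \<Rightarrow> bool" where
  "mobius_equivalent_model f \<longleftrightarrow> (\<exists>\<phi> \<psi>. fractional_linear \<phi> \<and> fractional_linear \<psi> \<and>
     f = \<psi> \<circ> cp1_map model_num model_den \<circ> \<phi>)"

lemma model_imp_omega:
  assumes FG: "cubic_pair F G" and "mobius_equivalent_model (cp1_map F G)"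
  shows "omega F G = 0"
proof -
  obtain a b c e \<alpha> \<beta> \<gamma> \<delta> where det: "a * e - b * c \<noteq> 0" and det': "\<alpha> * \<delta> - \<beta> * \<gamma> \<noteq> 0"
    and eq: "cp1_map F G = mobius \<alpha> \<beta> \<gamma> \<delta> \<circ> cubic_map model_num model_den \<circ> mobius a b c e"
    using assms(2) unfolding mobius_equivalent_model_def fractional_linear_mobius cp1_map_model by metis
  define U where "U = cubic_pullback a b c e model_num"
  define V where "V = cubic_pullback a b c e model_den"
  have nv: "nonvanishing U V" unfolding U_def V_def by (rule nonvanishing_pullback[OF nonvanishing_model det])
  define F' where "F' = smult \<alpha> U + smult \<beta> V"
  define G' where "G' = smult \<gamma> U + smult \<delta> V"
  have dU: "degree U \<le> 3" "degree V \<le> 3" by (simp_all add: U_def V_def cubic_pullback_def Let_def)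
  have deg: "degree F' \<le> 3" "degree G' \<le> 3"
    unfolding F'_def G'_def using dU by (auto intro!: degree_add_le order_trans[OF degree_smult_le])
  have cfz: "cubic_form P z 1 = poly P z" if "degree P \<le> 3" for P z
    using poly_cubic[OF that] by (simp add: cubic_form_def)
  have "cp1_map F G (Some z) = cp1_point (poly F' z) (poly G' z)" for z
  proof -
    have "cp1_map F G (Some z) = mobius \<alpha> \<beta> \<gamma> \<delta> (cubic_map U V (Some z))"
      by (simp add: eq cubic_map_mobius[OF det] U_def V_def)
    also have "cubic_map U V (Some z) = cp1_point (poly U z) (poly V z)"
      by (simp add: cubic_map_def hom_coords_def cfz dU)
    also have "mobius \<alpha> \<beta> \<gamma> \<delta> \<dots> = cp1_point (poly F' z) (poly G' z)"
      using nv cfz[OF dU(1), of z] cfz[OF dU(2), of z]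
      by (subst mobius_cp1_point) (auto simp: nonvanishing_def F'_def G'_def)
    finally show ?thesis .
  qed
  from cp1_map_eq_imp[OF FG deg this] obtain k where k: "F' = smult k F" "G' = smult k G" by blast
  have "k \<noteq> 0"
  proof
    assume "k = 0"
    then have "poly F' 0 = 0" "poly G' 0 = 0" using k by simp_all
    then have "(\<alpha> * cubic_form U 0 1 + \<beta> * cubic_form V 0 1, \<gamma> * cubic_form U 0 1 + \<delta> * cubic_form V 0 1) = (0, 0)"
      by (simp add: F'_def G'_def cfz dU)
    moreover have "(cubic_form U 0 1, cubic_form V 0 1) \<noteq> (0, 0)" using nv by (auto simp: nonvanishing_def)
    ultimately show False using linear_nonzero[OF det'] by blast
  qed
  moreover have "k * k * omega F G = 0"
  proof -
    have "omega model_num model_den = 0" by (simp add: omega_def numeral_eq_Suc)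
    then have UV: "omega U V = 0" unfolding U_def V_def omega_pullback by simp
    \<comment> \<open>\<open>omega\<close> is bilinear and alternating, so a change of basis of the
      pencil multiplies it by the determinant.\<close>
    have "omega F' G' = (\<alpha> * \<delta> - \<beta> * \<gamma>) * omega U V"
      unfolding omega_def F'_def G'_def coeff_add coeff_smult by algebra
    then show ?thesis using UV k by (simp add: omega_smult)
  qed
  ultimately show ?thesis by simp
qed

lemma cubic_form_has_zero:
  "\<exists>x y. (x, y) \<noteq> (0, 0) \<and> cubic_form F x y = 0"
proof (cases "coeff F 3 = 0")
  case True
  then show ?thesis by (intro exI[of _ 1] exI[of _ 0]) (simp add: cubic_form_def)
next
  case False
  let ?p = "[:coeff F 0, coeff F 1, coeff F 2, coeff F 3:]"
  have "degree ?p \<noteq> 0" using False by simp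
  then have "\<not> constant (poly ?p)" by (simp add: constant_degree)
  then obtain z where "poly ?p z = 0" using fundamental_theorem_of_algebra by blast
  then have "cubic_form F z 1 = 0"
    by (simp add: cubic_form_def algebra_simps power2_eq_square power3_eq_cube)
  then show ?thesis by (intro exI[of _ z] exI[of _ 1]) simp
qed

text \<open>Were the pencil linearly dependent, a zero of one form would be a common zero, and every
  binary cubic has a zero on the projective line.\<close>

lemma nonvanishing_not_proportional:
  assumes "nonvanishing F G" "(a, b) \<noteq> (0, 0)"
  shows "\<exists>i\<le>3. a * coeff F i + b * coeff G i \<noteq> 0"
proof (rule ccontr)
  assume "\<not> ?thesis"
  then have *: "a * coeff F 0 + b * coeff G 0 = 0" "a * coeff F 1 + b * coeff G 1 = 0"
    "a * coeff F 2 + b * coeff G 2 = 0" "a * coeff F 3 + b * coeff G 3 = 0" by auto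
  have lin: "a * cubic_form F x y + b * cubic_form G x y = 0" for x y
    using * unfolding cubic_form_def by algebra
  show False
  proof (cases "a = 0")
    case True
    then obtain x y where "(x, y) \<noteq> (0, 0)" "cubic_form F x y = 0" using cubic_form_has_zero by blast
    then show False using lin[of x y] assms by (auto simp: nonvanishing_def True)
  next
    case False
    obtain x y where "(x, y) \<noteq> (0, 0)" "cubic_form G x y = 0" using cubic_form_has_zero by blast
    then show False using lin[of x y] assms(1) False by (auto simp: nonvanishing_def)
  qed
qed

text \<open>The hypothesis \<open>br\<close> says that infinity is a branch point. It makes the two
  top coefficients of \<open>F\<close> and \<open>G\<close> proportional, so one translation by
  \<open>m\<close> removes both quadratic terms. Then \<open>omega = 0\<close> makes the constant
  terms proportional to the leading ones, and both forms become combinations of X^3 + \<kappa> y^3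
  and X y^2. Rescaling X normalizes \<kappa>.\<close>

lemma model_normal_form_at_infinity:
  assumes nv: "nonvanishing F G" and om: "omega F G = 0" and br: "plucker F G 3 2 = 0"
  shows "\<exists>a b c e \<alpha> \<beta> \<gamma> \<delta>. a * e - b * c \<noteq> 0 \<and> \<alpha> * \<delta> - \<beta> * \<gamma> \<noteq> 0 \<and>
     (\<forall>p. cubic_map F G p = mobius \<alpha> \<beta> \<gamma> \<delta> (cubic_map model_num model_den (mobius a b c e p)))"
proof -
  define f0 where "f0 = coeff F 0"
  define f1 where "f1 = coeff F 1"
  define f2 where "f2 = coeff F 2"
  define f3 where "f3 = coeff F 3"
  define g0 where "g0 = coeff G 0"
  define g1 where "g1 = coeff G 1"
  define g2 where "g2 = coeff G 2"
  define g3 where "g3 = coeff G 3"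
  note defs = f0_def f1_def f2_def f3_def g0_def g1_def g2_def g3_def
  have top: "f3 \<noteq> 0 \<or> g3 \<noteq> 0"
    using nv[unfolded nonvanishing_def, rule_format, of 1 0] by (simp add: cubic_form_def defs)
  have proportional: "\<exists>\<mu>. u = \<mu> * f3 \<and> v = \<mu> * g3" if "u * g3 = f3 * v" for u v
  proof (cases "f3 = 0")
    case True then show ?thesis using top that by (intro exI[of _ "v / g3"]) auto
  next
    case False then show ?thesis using that by (intro exI[of _ "u / f3"]) (auto simp: field_simps)
  qed
  obtain m where m: "f2 = 3 * m * f3" "g2 = 3 * m * g3"
  proof -
    have "f2 * g3 = f3 * g2" using br by (simp add: defs algebra_simps)
    then obtain \<mu> where "f2 = \<mu> * f3" "g2 = \<mu> * g3" using proportional by blast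
    then show ?thesis using that[of "\<mu> / 3"] by simp
  qed
  define f1' where "f1' = f1 - 3 * f3 * m\<^sup>2"
  define g1' where "g1' = g1 - 3 * g3 * m\<^sup>2"
  define f0' where "f0' = f0 - f1' * m - f3 * m ^ 3"
  define g0' where "g0' = g0 - g1' * m - g3 * m ^ 3"
  \<comment> \<open>After the translation the quadratic coefficients are 0, and of
    \<open>omega\<close> only the pairing of constant with leading terms remains.\<close>
  have "3 * (f0' * g3 - f3 * g0') = 0"
    using om m unfolding omega_def defs[symmetric] f0'_def g0'_def f1'_def g1'_def by algebra
  then have "f0' * g3 = f3 * g0'" by simp
  then obtain \<kappa> where \<kappa>: "f0' = \<kappa> * f3" "g0' = \<kappa> * g3" using proportional by blast
  have F: "cubic_form F x y = f3 * ((x + m * y) ^ 3 + \<kappa> * y ^ 3) + f1' * ((x + m * y) * y\<^sup>2)" for x y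
    using m \<kappa> unfolding cubic_form_def defs[symmetric] f0'_def f1'_def by algebra
  have G: "cubic_form G x y = g3 * ((x + m * y) ^ 3 + \<kappa> * y ^ 3) + g1' * ((x + m * y) * y\<^sup>2)" for x y
    using m \<kappa> unfolding cubic_form_def defs[symmetric] g0'_def g1'_def by algebra
  have k0: "\<kappa> \<noteq> 0"
  proof
    assume "\<kappa> = 0"
    then have "cubic_form F (- m) 1 = 0" "cubic_form G (- m) 1 = 0" by (simp_all add: F G)
    then show False using nv by (auto simp: nonvanishing_def)
  qed
  have det: "f3 * g1' - f1' * g3 \<noteq> 0"
  proof
    assume 0: "f3 * g1' - f1' * g3 = 0"
    have "g3 * coeff F 0 + (- f3) * coeff G 0 = 0" "g3 * coeff F 1 + (- f3) * coeff G 1 = 0"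
      "g3 * coeff F 2 + (- f3) * coeff G 2 = 0" "g3 * coeff F 3 + (- f3) * coeff G 3 = 0"
      using 0 m \<kappa> unfolding f0'_def g0'_def f1'_def g1'_def defs[symmetric] by (algebra, algebra, algebra, simp)
    moreover have "i = 0 \<or> i = 1 \<or> i = 2 \<or> i = 3" if "i \<le> 3" for i :: nat using that by auto
    ultimately show False
      using nonvanishing_not_proportional[OF nv, of g3 "- f3"] top by (metis neg_equal_0_iff_equal prod.inject)
  qed
  \<comment> \<open>Replacing X by \<open>s\<close> X turns \<kappa> into the 2 of the model. The
    factors \<open>- 3 * s\<close> below compensate the -1/3 in \<open>model_den\<close> and the
    rescaling.\<close>
  obtain s where s: "s ^ 3 = \<kappa> / 2" using exists_complex_root[of 3 "\<kappa> / 2"] by (metis zero_neq_numeral)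
  have s0: "s \<noteq> 0" using s k0 by auto
  have main: "cubic_map F G p = mobius (f3 * s ^ 3) (- 3 * s * f1') (g3 * s ^ 3) (- 3 * s * g1')
      (cubic_map model_num model_den (mobius (1 / s) (m / s) 0 1 p))" for p
  proof -
    obtain x y where xy: "hom_coords p = (x, y)" by fastforce
    define X where "X = (x + m * y) / s"
    have X: "x + m * y = s * X" using s0 by (simp add: X_def)
    have Xy: "(X, y) \<noteq> (0, 0)" using hom_coords_nonzero[OF xy] s0 by (auto simp: X_def)
    have uv: "(cubic_form model_num X y, cubic_form model_den X y) \<noteq> (0, 0)"
      using nonvanishing_model Xy by (auto simp: nonvanishing_def)
    have "mobius (1 / s) (m / s) 0 1 p = cp1_point X y"
      using s0 by (simp add: mobius_def xy X_def add_divide_distrib)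
    then have "mobius (f3 * s ^ 3) (- 3 * s * f1') (g3 * s ^ 3) (- 3 * s * g1')
        (cubic_map model_num model_den (mobius (1 / s) (m / s) 0 1 p)) =
      cp1_point (f3 * s ^ 3 * cubic_form model_num X y + - 3 * s * f1' * cubic_form model_den X y)
        (g3 * s ^ 3 * cubic_form model_num X y + - 3 * s * g1' * cubic_form model_den X y)"
      by (simp only: cubic_map_cp1_point[OF Xy] mobius_cp1_point[OF uv])
    also have "\<dots> = cp1_point (cubic_form F x y) (cubic_form G x y)"
    proof -
      have \<kappa>2: "\<kappa> = 2 * s ^ 3" unfolding s by simp
      have *: "t * s ^ 3 * (X ^ 3 + 2 * y ^ 3) + - 3 * s * t' * (- (X * y\<^sup>2) / 3) = t * ((s * X) ^ 3 + 2 * s ^ 3 * y ^ 3) + t' * (s * X * y\<^sup>2)" for t t'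
        by (simp add: algebra_simps power_mult_distrib)
      show ?thesis unfolding F G X \<kappa>2 cubic_form_model * ..
    qed
    finally show ?thesis by (simp add: cubic_map_def xy)
  qed
  have "(1 / s) * 1 - (m / s) * 0 \<noteq> 0" using s0 by simp
  moreover have "(f3 * s ^ 3) * (- 3 * s * g1') - (- 3 * s * f1') * (g3 * s ^ 3) = - 3 * s ^ 4 * (f3 * g1' - f1' * g3)"
    by (simp add: algebra_simps power4_eq_xxxx power3_eq_cube)
  then have "(f3 * s ^ 3) * (- 3 * s * g1') - (- 3 * s * f1') * (g3 * s ^ 3) \<noteq> 0" using s0 det by simp
  ultimately show ?thesis using main by blast
qed

text \<open>A zero of the Wronskian is moved to infinity by \<open>z \<mapsto> 1 / (z - r)\<close>.\<close>

lemma omega_imp_model: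
  assumes FG: "cubic_pair F G" and om: "omega F G = 0"
  shows "mobius_equivalent_model (cp1_map F G)"
proof (cases "plucker F G 3 2 = 0")
  case True
  from model_normal_form_at_infinity[OF nonvanishing_cubic_pair[OF FG] om True]
  obtain a b c e \<alpha> \<beta> \<gamma> \<delta> where "a * e - b * c \<noteq> 0" "\<alpha> * \<delta> - \<beta> * \<gamma> \<noteq> 0"
     "\<And>p. cubic_map F G p = mobius \<alpha> \<beta> \<gamma> \<delta> (cubic_map model_num model_den (mobius a b c e p))" by blast
  then show ?thesis
    unfolding mobius_equivalent_model_def fractional_linear_mobius cp1_map_model cp1_map_cubic_map[OF FG]
    by (intro exI[of _ "mobius a b c e"] exI[of _ "mobius \<alpha> \<beta> \<gamma> \<delta>"]) (auto simp: fun_eq_iff)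
next
  case False
  note D = cubic_pairD[OF FG]
  let ?W = "wronskian F G"
  have "coeff ?W 4 \<noteq> 0" using False by (simp add: coeff_wronskian D)
  then have "degree ?W \<noteq> 0" by (metis coeff_eq_0 not_gr_zero zero_less_numeral)
  then have "\<not> constant (poly ?W)" by (simp add: constant_degree)
  then obtain r where r: "poly ?W r = 0" using fundamental_theorem_of_algebra by blast
  define P where "P = cubic_pullback r 1 1 0"
  have det: "r * 0 - 1 * 1 \<noteq> (0 :: complex)" "0 * (- r) - 1 * 1 \<noteq> (0 :: complex)" by simp_all
  have nv: "nonvanishing (P F) (P G)"
    unfolding P_def by (rule nonvanishing_pullback[OF nonvanishing_cubic_pair[OF FG] det(1)])
  have om': "omega (P F) (P G) = 0" using om by (simp add: P_def omega_pullback)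
  have P3: "coeff (P H) 3 = coeff H 0 + coeff H 1 * r + coeff H 2 * r\<^sup>2 + coeff H 3 * r ^ 3"
    and P2: "coeff (P H) 2 = coeff H 1 + 2 * coeff H 2 * r + 3 * coeff H 3 * r\<^sup>2" for H
    unfolding P_def cubic_pullback_def Let_def coeff_list4 by simp_all
  have br: "plucker (P F) (P G) 3 2 = 0"
  proof -
    have "plucker (P F) (P G) 3 2 = - poly ?W r"
      unfolding P2 P3 wronskian_cubic[OF D(2,3)] poly_pCons poly_0
      by algebra
    then show ?thesis using r by simp
  qed
  have inv: "cubic_map F G p = cubic_map (P F) (P G) (mobius 0 1 1 (- r) p)" for p
  proof -
    have "mobius r 1 1 0 (mobius 0 1 1 (- r) p) = mobius 1 0 0 1 p"
      by (simp add: mobius_mobius[OF det(2)])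
    also have "\<dots> = p" by (cases p) (simp_all add: mobius_def hom_coords_def cp1_point_def)
    finally show ?thesis unfolding P_def by (simp only: cubic_map_mobius[OF det(1), symmetric])
  qed
  from model_normal_form_at_infinity[OF nv om' br]
  obtain a b c e \<alpha> \<beta> \<gamma> \<delta> where *: "a * e - b * c \<noteq> 0" "\<alpha> * \<delta> - \<beta> * \<gamma> \<noteq> 0"
     "\<And>p. cubic_map (P F) (P G) p = mobius \<alpha> \<beta> \<gamma> \<delta> (cubic_map model_num model_den (mobius a b c e p))" by blast
  have fl: "fractional_linear (mobius a b c e)" "fractional_linear (mobius 0 1 1 (- r))"
    "fractional_linear (mobius \<alpha> \<beta> \<gamma> \<delta>)"
    unfolding fractional_linear_mobius using *(1,2) det(2) by blast+
  have "fractional_linear (mobius a b c e \<circ> mobius 0 1 1 (- r))" "fractional_linear (mobius \<alpha> \<beta> \<gamma> \<delta>)"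
    using fl by (auto intro: fractional_linear_comp)
  moreover have "cp1_map F G = mobius \<alpha> \<beta> \<gamma> \<delta> \<circ> cp1_map model_num model_den \<circ> (mobius a b c e \<circ> mobius 0 1 1 (- r))"
    unfolding cp1_map_cubic_map[OF FG] cp1_map_model by (rule ext) (simp add: inv *(3))
  ultimately show ?thesis unfolding mobius_equivalent_model_def by blast
qed


section \<open>Branch points\<close>

text \<open>The cubic in the parameter of \<open>chart_inv p\<close>, so that \<open>p\<close>
  becomes 0: coefficients are reversed at infinity and translated elsewhere. This makes local
  arguments at infinity and at finite points the same.\<close>

definition localize :: "riemann_sphere \<Rightarrow> complex poly \<Rightarrow> complex poly" where
  "localize p F = (case p of None \<Rightarrow> cubic_pullback 0 1 1 0 F | Some a \<Rightarrow> cubic_pullback 1 a 0 1 F)"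

lemma degree_localize: "degree (localize p F) \<le> 3"
  by (cases p) (simp_all add: localize_def cubic_pullback_def Let_def)

lemma coeff_localize:
  "coeff (localize None F) 0 = coeff F 3" "coeff (localize None F) 1 = coeff F 2"
  "coeff (localize None F) 2 = coeff F 1" "coeff (localize None F) 3 = coeff F 0"
  "coeff (localize (Some a) F) 0 = coeff F 0 + coeff F 1 * a + coeff F 2 * a\<^sup>2 + coeff F 3 * a ^ 3"
  "coeff (localize (Some a) F) 1 = coeff F 1 + 2 * coeff F 2 * a + 3 * coeff F 3 * a\<^sup>2"
  "coeff (localize (Some a) F) 2 = coeff F 2 + 3 * coeff F 3 * a"
  "coeff (localize (Some a) F) 3 = coeff F 3"
  unfolding localize_def option.case cubic_pullback_def Let_def coeff_list4
  by (simp_all add: algebra_simps)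

lemma cubic_form_localize: "poly (localize p F) w = cubic_form (localize p F) w 1"
  using poly_cubic[OF degree_localize, of p F w] by (simp add: cubic_form_def)

lemma nonvanishing_localize:
  "nonvanishing F G \<Longrightarrow> nonvanishing (localize p F) (localize p G)"
  by (cases p) (auto simp: localize_def intro!: nonvanishing_pullback)

lemma omega_localize: "omega F G = 0 \<Longrightarrow> omega (localize p F) (localize p G) = 0"
  by (cases p) (auto simp: localize_def omega_pullback)

lemma cubic_map_chart_inv:
  "cubic_map F G (chart_inv p w) = cp1_point (poly (localize p F) w) (poly (localize p G) w)"
proof (cases p)
  case None
  have *: "mobius 0 1 1 0 (Some w) = chart_inv None w"
    by (simp add: mobius_def hom_coords_def chart_inv_def cp1_point_def)
  show ?thesis
    unfolding None cubic_form_localize *[symmetric]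
    by (subst cubic_map_mobius) (simp_all add: cubic_map_def hom_coords_def localize_def)
next
  case (Some a)
  have *: "mobius 1 a 0 1 (Some w) = chart_inv (Some a) w"
    by (simp add: mobius_def hom_coords_def chart_inv_def cp1_point_def)
  show ?thesis
    unfolding Some cubic_form_localize *[symmetric]
    by (subst cubic_map_mobius) (simp_all add: cubic_map_def hom_coords_def localize_def)
qed

text \<open>If all coefficients vanish, the Pluecker relation gives p30 p21 = 0, and with 3 p30 +
  p21 = 0 all Pluecker coordinates vanish; the forms would be proportional.\<close>

lemma wronskian_nonzero:
  assumes "nonvanishing F G" "degree F \<le> 3" "degree G \<le> 3"
  shows "wronskian F G \<noteq> 0"
proof
  assume "wronskian F G = 0"
  then have "coeff (wronskian F G) k = 0" for k by simp
  from this[of 0] this[of 1] this[of 2] this[of 3] this[of 4]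
  have p: "plucker F G 1 0 = 0" "plucker F G 2 0 = 0" "3 * plucker F G 3 0 + plucker F G 2 1 = 0"
    "plucker F G 3 1 = 0" "plucker F G 3 2 = 0"
    unfolding coeff_wronskian[OF assms(2,3)] by simp_all
  have "plucker F G 3 0 * plucker F G 2 1 = 0" using p(1,2,4,5) by algebra
  then have q: "plucker F G 3 0 = 0" "plucker F G 2 1 = 0" using p(3) by auto
  obtain i where i: "i \<le> 3" "coeff F i \<noteq> 0"
    using nonvanishing_not_proportional[OF assms(1), of 1 0] by auto
  obtain j where j: "j \<le> 3" "coeff G i * coeff F j + (- coeff F i) * coeff G j \<noteq> 0"
    using nonvanishing_not_proportional[OF assms(1), of "coeff G i" "- coeff F i"] i by auto
  have "i = 0 \<or> i = 1 \<or> i = 2 \<or> i = 3" "j = 0 \<or> j = 1 \<or> j = 2 \<or> j = 3" using i j by auto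
  then show False using j(2) p q by (elim disjE) (simp_all add: algebra_simps)
qed

text \<open>The derivative of A/B is the Wronskian over B^2; where the value is infinite the chart
  uses B/A, with minus the Wronskian over A^2. The factor is holomorphic and without zeros, so
  branching is read off the Wronskian.\<close>

lemma local_rep_deriv:
  assumes nz: "poly A 0 \<noteq> 0 \<or> poly B 0 \<noteq> 0"
    and f: "\<And>w. f (chart_inv p w) = cp1_point (poly A w) (poly B w)"
  obtains S u where "open S" "0 \<in> S" "u holomorphic_on S" "\<And>w. w \<in> S \<Longrightarrow> u w \<noteq> 0"
    "\<And>w. w \<in> S \<Longrightarrow> deriv (local_rep f p) w = u w * poly (wronskian A B) w"
proof (cases "poly B 0 = 0")
  case False
  define S where "S = {w. poly B w \<noteq> 0}"
  have S: "open S" unfolding S_def by (intro open_Collect_neq continuous_intros)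
  have "chart_inv p 0 = p" by (cases p) (simp_all add: chart_inv_def)
  then have fp: "f p = Some (poly A 0 / poly B 0)" using f[of 0] False by (simp add: cp1_point_def)
  have lr: "local_rep f p w = poly A w / poly B w - poly A 0 / poly B 0" if "w \<in> S" for w
    using that by (simp add: local_rep_def f fp chart_def cp1_point_def S_def)
  have "deriv (local_rep f p) w = (1 / (poly B w)\<^sup>2) * poly (wronskian A B) w" if w: "w \<in> S" for w
  proof -
    have "((\<lambda>w. poly A w / poly B w - poly A 0 / poly B 0) has_field_derivative (1 / (poly B w)\<^sup>2) * poly (wronskian A B) w) (at w)"
      using w by (auto intro!: derivative_eq_intros simp: S_def wronskian_def power2_eq_square field_simps)
    then have "(local_rep f p has_field_derivative (1 / (poly B w)\<^sup>2) * poly (wronskian A B) w) (at w)"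
      by (rule has_field_derivative_transform_within_open[OF _ S w]) (simp add: lr)
    then show ?thesis by (rule DERIV_imp_deriv)
  qed
  moreover have "(\<lambda>w. 1 / (poly B w)\<^sup>2) holomorphic_on S"
    by (intro holomorphic_intros) (auto simp: S_def)
  ultimately show ?thesis using that[of S "\<lambda>w. 1 / (poly B w)\<^sup>2"] S False by (auto simp: S_def)
next
  case True
  define S where "S = {w. poly A w \<noteq> 0}"
  have S: "open S" unfolding S_def by (intro open_Collect_neq continuous_intros)
  have "chart_inv p 0 = p" by (cases p) (simp_all add: chart_inv_def)
  then have fp: "f p = None" using f[of 0] True by (simp add: cp1_point_def)
  have lr: "local_rep f p w = poly B w / poly A w" if "w \<in> S" for w
    using that by (simp add: local_rep_def f fp chart_def cp1_point_def S_def)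
  have "deriv (local_rep f p) w = (- 1 / (poly A w)\<^sup>2) * poly (wronskian A B) w" if w: "w \<in> S" for w
  proof -
    have "((\<lambda>w. poly B w / poly A w) has_field_derivative (- 1 / (poly A w)\<^sup>2) * poly (wronskian A B) w) (at w)"
      using w by (auto intro!: derivative_eq_intros simp: S_def wronskian_def power2_eq_square field_simps)
    then have "(local_rep f p has_field_derivative (- 1 / (poly A w)\<^sup>2) * poly (wronskian A B) w) (at w)"
      by (rule has_field_derivative_transform_within_open[OF _ S w]) (simp add: lr)
    then show ?thesis by (rule DERIV_imp_deriv)
  qed
  moreover have "(\<lambda>w. - 1 / (poly A w)\<^sup>2) holomorphic_on S"
    by (intro holomorphic_intros) (auto simp: S_def)
  ultimately show ?thesis using that[of S "\<lambda>w. - 1 / (poly A w)\<^sup>2"] S True nz by (auto simp: S_def)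
qed

lemma zorder_eq_1_iff:
  assumes S: "open S" "0 \<in> S" "u holomorphic_on S" "\<And>w. w \<in> S \<Longrightarrow> u w \<noteq> 0"
    and g: "\<And>w. w \<in> S \<Longrightarrow> g w = u w * poly W w" and W: "W \<noteq> 0"
  shows "zorder g 0 = 1 \<longleftrightarrow> poly W 0 = 0 \<and> poly (pderiv W) 0 \<noteq> 0"
proof -
  obtain R where R: "W = [:- 0, 1:] ^ order 0 W * R" "\<not> [:- 0, 1:] dvd R"
    using order_decomp[OF W] by blast
  define n where "n = order 0 W"
  have R0: "poly R 0 \<noteq> 0" using R(2) by (simp add: poly_eq_0_iff_dvd)
  have Wn: "W = [:0, 1:] ^ n * R" using R(1) by (simp add: n_def)
  have "zorder g 0 = int n"
  proof (rule zorder_eqI[OF S(1,2)])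
    show "(\<lambda>w. u w * poly R w) holomorphic_on S" using S(3) by (intro holomorphic_intros)
    show "u 0 * poly R 0 \<noteq> 0" using R0 S by simp
    fix w :: complex assume "w \<in> S" "w \<noteq> 0"
    then show "g w = u w * poly R w * (w - 0) powi int n"
      by (simp add: g Wn)
  qed
  moreover have "n = 1 \<longleftrightarrow> poly W 0 = 0 \<and> poly (pderiv W) 0 \<noteq> 0"
  proof -
    consider "n = 0" | "n = 1" | k where "n = Suc (Suc k)" by (metis One_nat_def old.nat.exhaust)
    then show ?thesis
    proof cases
      case 1 then show ?thesis using R0 by (simp add: Wn)
    next
      case 2 then show ?thesis using R0 by (simp add: Wn pderiv_mult pderiv_pCons)
    next
      case 3 then show ?thesis by (simp add: Wn pderiv_mult pderiv_pCons)
    qed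
  qed
  ultimately show ?thesis by simp
qed

lemma branch_points_cubic_map:
  assumes nv: "nonvanishing F G"
  defines "W \<equiv> \<lambda>p. wronskian (localize p F) (localize p G)"
  shows "branch_point (cubic_map F G) p \<longleftrightarrow> poly (W p) 0 = 0"
    and "simple_branch_point (cubic_map F G) p \<longleftrightarrow> poly (W p) 0 = 0 \<and> poly (pderiv (W p)) 0 \<noteq> 0"
proof -
  have nvl: "nonvanishing (localize p F) (localize p G)" by (rule nonvanishing_localize[OF nv])
  then have "poly (localize p F) 0 \<noteq> 0 \<or> poly (localize p G) 0 \<noteq> 0"
    unfolding cubic_form_localize by (auto simp: nonvanishing_def)
  then obtain S u where S: "open S" "0 \<in> S" "u holomorphic_on S" "\<And>w. w \<in> S \<Longrightarrow> u w \<noteq> 0"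
    and d: "\<And>w. w \<in> S \<Longrightarrow> deriv (local_rep (cubic_map F G) p) w = u w * poly (W p) w"
    using local_rep_deriv[where f="cubic_map F G" and p=p, OF _ cubic_map_chart_inv] unfolding W_def by metis
  have W: "W p \<noteq> 0" unfolding W_def by (intro wronskian_nonzero nvl degree_localize)
  show b: "branch_point (cubic_map F G) p \<longleftrightarrow> poly (W p) 0 = 0"
    using d[OF S(2)] S(2,4) by (simp add: branch_point_def)
  show "simple_branch_point (cubic_map F G) p \<longleftrightarrow> poly (W p) 0 = 0 \<and> poly (pderiv (W p)) 0 \<noteq> 0"
    unfolding simple_branch_point_def b using zorder_eq_1_iff[OF S d W] by auto
qed

lemma poly_0_coeff: "poly W 0 = coeff W 0" "coeff (pderiv W) 0 = coeff W 1"
  by (simp_all add: poly_0_coeff_0 coeff_pderiv)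

text \<open>Put the branch point at 0. At a multiple root the quartic invariant reduces to w2^2, so
  \<open>omega = 0\<close> forces w2 = 0 too. As w2 and \<open>omega\<close> are independent
  combinations of p30 and p21, this gives p10 = p20 = p30 = 0, which makes the two cubics
  proportional.\<close>

lemma omega_imp_simple:
  assumes nv: "nonvanishing F G" and om: "omega F G = 0" and b: "branch_point (cubic_map F G) p"
  shows "simple_branch_point (cubic_map F G) p"
proof -
  let ?A = "localize p F" let ?B = "localize p G"
  have nvl: "nonvanishing ?A ?B" by (rule nonvanishing_localize[OF nv])
  have om: "omega ?A ?B = 0" by (rule omega_localize[OF om])
  note cw = coeff_wronskian[OF degree_localize degree_localize, of p F p G]
  have w0: "plucker ?A ?B 1 0 = 0"
    using b by (simp add: branch_points_cubic_map[OF nv] poly_0_coeff cw)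
  have "plucker ?A ?B 2 0 \<noteq> 0"
  proof
    assume w1: "plucker ?A ?B 2 0 = 0"
    have "(3 * plucker ?A ?B 3 0 + plucker ?A ?B 2 1)\<^sup>2 = 0"
      using quartic_invariant[OF degree_localize degree_localize, of p F p G] om w0 w1 unfolding cw by algebra
    then have "3 * plucker ?A ?B 3 0 + plucker ?A ?B 2 1 = 0" by simp
    moreover have "- 3 * plucker ?A ?B 3 0 + plucker ?A ?B 2 1 = 0" using om unfolding omega_def by algebra
    ultimately have w2: "plucker ?A ?B 3 0 = 0" by algebra
    \<comment> \<open>The combination of the pencil that vanishes at 0; its coefficients are not
      both 0 because 0 is not a common zero.\<close>
    have "(coeff ?B 0, - coeff ?A 0) \<noteq> (0, 0)"
      using nvl[unfolded nonvanishing_def, rule_format, of 0 1] by (auto simp: cubic_form_def)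
    then obtain i where i: "i \<le> 3" "coeff ?B 0 * coeff ?A i + (- coeff ?A 0) * coeff ?B i \<noteq> 0"
      using nonvanishing_not_proportional[OF nvl] by blast
    have "i = 0 \<or> i = 1 \<or> i = 2 \<or> i = 3" using i by auto
    then show False using i(2) w0 w1 w2 by (elim disjE) (simp_all add: algebra_simps)
  qed
  then show ?thesis unfolding branch_points_cubic_map[OF nv] poly_0_coeff cw using w0 by simp
qed

lemma branch_point_hom_eval:
  assumes nv: "nonvanishing F G" and deg: "degree F \<le> 3" "degree G \<le> 3"
  shows "branch_point (cubic_map F G) p \<longleftrightarrow> hom_eval 4 (wronskian F G) p = 0"
proof (cases p)
  case None
  then show ?thesis
    by (simp add: branch_points_cubic_map[OF nv] poly_0_coeff coeff_wronskian degree_localize deg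
        coeff_localize[unfolded One_nat_def] hom_eval_def) (rule eq_commute)
next
  case (Some a)
  have "poly (wronskian F G) a = plucker (localize p F) (localize p G) 1 0"
    unfolding Some coeff_localize wronskian_cubic[OF deg] poly_pCons poly_0 by algebra
  then show ?thesis
    unfolding branch_points_cubic_map[OF nv] poly_0_coeff coeff_wronskian[OF degree_localize degree_localize]
    by (simp add: hom_eval_def Some)
qed

lemma card_roots_rsquarefree:
  fixes p :: "complex poly"
  assumes "rsquarefree p"
  shows "card {z. poly p z = 0} = degree p"
proof -
  have p0: "p \<noteq> 0" using assms by (simp add: rsquarefree_def)
  have "degree p = degree (smult (lead_coeff p) (\<Prod>z|poly p z = 0. [:- z, 1:]))"
    by (simp only: complex_poly_decompose_rsquarefree[OF assms])
  also have "\<dots> = (\<Sum>z|poly p z = 0. 1)"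
    using p0 by (simp add: degree_prod_eq_sum_degree)
  finally show ?thesis by simp
qed

text \<open>Simplicity makes \<open>W\<close> squarefree as a form of degree 4. If infinity is a
  root, it is a simple one, so the degree drops exactly to 3 and the count is 3 + 1.\<close>

lemma card_branch_points:
  assumes nv: "nonvanishing F G" and deg: "degree F \<le> 3" "degree G \<le> 3"
    and simple: "\<And>p. branch_point (cubic_map F G) p \<Longrightarrow> simple_branch_point (cubic_map F G) p"
  shows "card {p. branch_point (cubic_map F G) p} = 4"
proof -
  let ?W = "wronskian F G"
  define R where "R = {z. poly ?W z = 0}"
  have W0: "?W \<noteq> 0" by (rule wronskian_nonzero[OF nv deg])
  have fin: "finite R" unfolding R_def by (rule poly_roots_finite[OF W0])
  have "rsquarefree ?W"
    unfolding rsquarefree_roots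
  proof (intro allI notI)
    fix a assume a: "poly ?W a = 0 \<and> poly (pderiv ?W) a = 0"
    then have "branch_point (cubic_map F G) (Some a)"
      by (simp add: branch_point_hom_eval[OF nv deg] hom_eval_def)
    from simple[OF this] have "plucker (localize (Some a) F) (localize (Some a) G) 2 0 \<noteq> 0"
      unfolding branch_points_cubic_map[OF nv] poly_0_coeff coeff_wronskian[OF degree_localize degree_localize] by simp
    moreover have "poly (pderiv ?W) a = 2 * plucker (localize (Some a) F) (localize (Some a) G) 2 0"
    proof -
      have pd: "poly (pderiv [:w0, w1, w2, w3, w4:]) a = w1 + 2 * w2 * a + 3 * w3 * a\<^sup>2 + 4 * w4 * a ^ 3" for w0 w1 w2 w3 w4
        by (simp add: pderiv_pCons algebra_simps power2_eq_square power3_eq_cube)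
      show ?thesis unfolding coeff_localize wronskian_cubic[OF deg] pd by algebra
    qed
    ultimately show False using a by simp
  qed
  then have cR: "card R = degree ?W"
    unfolding R_def by (rule card_roots_rsquarefree)
  have set: "{p. branch_point (cubic_map F G) p} = Some ` R \<union> (if coeff ?W 4 = 0 then {None} else {})"
  proof (rule set_eqI)
    fix p show "p \<in> {p. branch_point (cubic_map F G) p} \<longleftrightarrow> p \<in> Some ` R \<union> (if coeff ?W 4 = 0 then {None} else {})"
      by (cases p) (auto simp: branch_point_hom_eval[OF nv deg] hom_eval_def R_def)
  qed
  have c1: "card (Some ` R) = card R" by (rule card_image) simp
  show ?thesis
  proof (cases "coeff ?W 4 = 0")
    case False
    then have "degree ?W = 4" using coeff_wronskian(6)[OF deg] le_degree by (metis le_antisym)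
    then show ?thesis using set cR c1 False by simp
  next
    case True
    then have "branch_point (cubic_map F G) None"
      by (simp add: branch_point_hom_eval[OF nv deg] hom_eval_def)
    from simple[OF this] have "plucker (localize None F) (localize None G) 2 0 \<noteq> 0"
      unfolding branch_points_cubic_map[OF nv] poly_0_coeff coeff_wronskian[OF degree_localize degree_localize] by simp
    then have w3: "coeff ?W 3 \<noteq> 0" unfolding coeff_localize coeff_wronskian[OF deg] by (simp add: algebra_simps)
    have "degree ?W \<noteq> 4" using True W0 by (metis leading_coeff_0_iff)
    then have "degree ?W = 3" using coeff_wronskian(6)[OF deg] le_degree[OF w3] by simp
    then show ?thesis using set cR c1 True fin by (simp add: card_insert_if)
  qed
qed

section \<open>Equianharmonic quadruplets\<close>

lemma hom_det_nonzero: "p \<noteq> q \<Longrightarrow> hom_det p q \<noteq> 0"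
  by (cases p; cases q) (auto simp: hom_det_def)

lemma hom_det_swap: "hom_det q p = - hom_det p q"
  by (cases p; cases q) (auto simp: hom_det_def)

lemma hom_det_plucker:
  "hom_det a b * hom_det c d - hom_det a c * hom_det b d + hom_det a d * hom_det b c = 0"
  by (cases a; cases b; cases c; cases d) (auto simp: hom_det_def algebra_simps)

lemma quartic_with_roots:
  fixes W :: "complex poly"
  assumes deg: "degree W \<le> 4" and dist: "distinct [a, b, c, d]"
    and roots: "poly W a = 0" "poly W b = 0" "poly W c = 0" "poly W d = 0"
  shows "W = smult (coeff W 4) ([:- a, 1:] * [:- b, 1:] * [:- c, 1:] * [:- d, 1:])" (is "_ = ?R")
proof (rule ccontr)
  assume ne: "W \<noteq> ?R"
  let ?D = "W - ?R"
  have D0: "?D \<noteq> 0" using ne by simp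
  have "degree ?R \<le> 4" by (rule order_trans[OF degree_smult_le]) simp
  then have "degree ?D \<le> 4" using deg by (simp add: degree_diff_le)
  moreover have "coeff ?D 4 = 0" by (simp add: numeral_eq_Suc)
  then have "degree ?D \<noteq> 4" using D0 by (metis leading_coeff_0_iff)
  ultimately have d3: "degree ?D \<le> 3" by simp
  have lin: "poly [:- u, 1:] z = z - u" for u z :: complex by simp
  have D: "poly ?D z = poly W z - coeff W 4 * ((z - a) * (z - b) * (z - c) * (z - d))" for z
    by (simp only: poly_diff poly_smult poly_mult lin)
  have "card {a, b, c, d} \<le> card {x. poly ?D x = 0}"
    unfolding D using roots poly_roots_finite[OF D0, unfolded D] by (intro card_mono) auto
  then have "4 \<le> degree ?D" using card_poly_roots_bound[OF D0] dist by (simp add: card_insert_if)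
  then show False using d3 by simp
qed

lemma cubic_with_roots:
  fixes W :: "complex poly"
  assumes deg: "degree W \<le> 4" and w4: "coeff W 4 = 0" and dist: "distinct [a, b, c]"
    and roots: "poly W a = 0" "poly W b = 0" "poly W c = 0"
  shows "W = smult (coeff W 3) ([:- a, 1:] * [:- b, 1:] * [:- c, 1:])" (is "_ = ?R")
proof (rule ccontr)
  assume ne: "W \<noteq> ?R"
  let ?D = "W - ?R"
  have D0: "?D \<noteq> 0" using ne by simp
  have "degree W \<noteq> 4" using w4 by (metis leading_coeff_0_iff degree_0 zero_neq_numeral)
  moreover have "degree ?R \<le> 3" by (rule order_trans[OF degree_smult_le]) simp
  ultimately have "degree ?D \<le> 3" using deg by (simp add: degree_diff_le)
  moreover have "coeff ?D 3 = 0" by (simp add: numeral_eq_Suc)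
  then have "degree ?D \<noteq> 3" using D0 by (metis leading_coeff_0_iff)
  ultimately have d3: "degree ?D \<le> 2" by simp
  have lin: "poly [:- u, 1:] z = z - u" for u z :: complex by simp
  have D: "poly ?D z = poly W z - coeff W 3 * ((z - a) * (z - b) * (z - c))" for z
    by (simp only: poly_diff poly_smult poly_mult lin)
  have "card {a, b, c} \<le> card {x. poly ?D x = 0}"
    unfolding D using roots poly_roots_finite[OF D0, unfolded D] by (intro card_mono) auto
  then have "3 \<le> degree ?D" using card_poly_roots_bound[OF D0] dist by (simp add: card_insert_if)
  then show False using d3 by simp
qed

text \<open>With \<open>X\<close> and \<open>Y\<close> the numerator and denominator of the cross
  ratio, the invariant is a nonzero square times X^2 - X Y + Y^2; division by Y^2 gives the
  condition on the cross ratio.\<close>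

lemma quartic_invariant_cross_ratio:
  fixes W :: "complex poly"
  assumes deg: "degree W \<le> 4" and W0: "W \<noteq> 0" and dist: "distinct [a, b, c, d]"
    and roots: "hom_eval 4 W a = 0" "hom_eval 4 W b = 0" "hom_eval 4 W c = 0" "hom_eval 4 W d = 0"
  shows "12 * coeff W 4 * coeff W 0 - 3 * coeff W 3 * coeff W 1 + (coeff W 2)\<^sup>2 = 0 \<longleftrightarrow>
    (cross_ratio a b c d)\<^sup>2 - cross_ratio a b c d + 1 = 0"
proof -
  define X where "X = hom_det a c * hom_det b d"
  define Y where "Y = hom_det a d * hom_det b c"
  have Y: "Y \<noteq> 0" using dist by (simp add: Y_def hom_det_nonzero)
  \<comment> \<open>With one root at infinity the expression is symmetric in the three finite roots,
    so one formula serves all four positions of infinity.\<close>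
  have three: "\<exists>k\<noteq>0. 12 * coeff W 4 * coeff W 0 - 3 * coeff W 3 * coeff W 1 + (coeff W 2)\<^sup>2 =
      k\<^sup>2 * (x\<^sup>2 + y\<^sup>2 + z\<^sup>2 - x * y - y * z - x * z)"
    if w4: "coeff W 4 = 0" and r: "distinct [x, y, z]" "poly W x = 0" "poly W y = 0" "poly W z = 0" for x y z
  proof -
    define k where "k = coeff W 3"
    have eq: "W = smult k ([:- x, 1:] * [:- y, 1:] * [:- z, 1:])"
      unfolding k_def by (rule cubic_with_roots[OF deg w4 r])
    then have "k \<noteq> 0" using W0 by auto
    moreover have "coeff W 0 = - k * x * y * z" "coeff W 1 = k * (x * y + y * z + x * z)" "coeff W 2 = - k * (x + y + z)"
      by (subst eq, simp add: algebra_simps numeral_eq_Suc)+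
    then have "12 * coeff W 4 * coeff W 0 - 3 * coeff W 3 * coeff W 1 + (coeff W 2)\<^sup>2 =
      k\<^sup>2 * (x\<^sup>2 + y\<^sup>2 + z\<^sup>2 - x * y - y * z - x * z)"
      unfolding w4 k_def[symmetric] by algebra
    ultimately show ?thesis by blast
  qed
  have "\<exists>k\<noteq>0. 12 * coeff W 4 * coeff W 0 - 3 * coeff W 3 * coeff W 1 + (coeff W 2)\<^sup>2 = k\<^sup>2 * (X\<^sup>2 - X * Y + Y\<^sup>2)"
  proof (cases "a = None \<or> b = None \<or> c = None \<or> d = None")
    case False
    then obtain x y z t where s: "a = Some x" "b = Some y" "c = Some z" "d = Some t" by auto
    define k where "k = coeff W 4"
    have eq: "W = smult k ([:- x, 1:] * [:- y, 1:] * [:- z, 1:] * [:- t, 1:])"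
      unfolding k_def using deg dist roots by (intro quartic_with_roots) (auto simp: s hom_eval_def)
    then have "k \<noteq> 0" using W0 by auto
    moreover have cs: "coeff W 0 = k * (x * y * z * t)" "coeff W 1 = - k * (x * y * z + x * y * t + x * z * t + y * z * t)"
      "coeff W 2 = k * (x * y + x * z + x * t + y * z + y * t + z * t)" "coeff W 3 = - k * (x + y + z + t)"
      by (subst eq, simp add: algebra_simps numeral_eq_Suc)+
    have "12 * coeff W 4 * coeff W 0 - 3 * coeff W 3 * coeff W 1 + (coeff W 2)\<^sup>2 = k\<^sup>2 * (X\<^sup>2 - X * Y + Y\<^sup>2)"
      unfolding k_def[symmetric] cs X_def Y_def s hom_det_def prod.case option.case by algebra
    ultimately show ?thesis by blast
  next
    case True
    then have w4: "coeff W 4 = 0" using roots by (auto simp: hom_eval_def)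
    from True consider "a = None" | "b = None" | "c = None" | "d = None" by blast
    then show ?thesis
    proof cases
      case 1
      then obtain x y z where s: "b = Some x" "c = Some y" "d = Some z"
        using dist 1 by (cases b; cases c; cases d) auto
      have "X\<^sup>2 - X * Y + Y\<^sup>2 = x\<^sup>2 + y\<^sup>2 + z\<^sup>2 - x * y - y * z - x * z"
        by (simp add: X_def Y_def 1 s hom_det_def power2_eq_square algebra_simps)
      then show ?thesis using three[OF w4, of x y z] roots dist by (simp add: s hom_eval_def)
    next
      case 2
      then obtain x y z where s: "a = Some x" "c = Some y" "d = Some z"
        using dist 2 by (cases a; cases c; cases d) auto
      have "X\<^sup>2 - X * Y + Y\<^sup>2 = x\<^sup>2 + y\<^sup>2 + z\<^sup>2 - x * y - y * z - x * z"
        by (simp add: X_def Y_def 2 s hom_det_def power2_eq_square algebra_simps)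
      then show ?thesis using three[OF w4, of x y z] roots dist by (simp add: s hom_eval_def)
    next
      case 3
      then obtain x y z where s: "a = Some x" "b = Some y" "d = Some z"
        using dist 3 by (cases a; cases b; cases d) auto
      have "X\<^sup>2 - X * Y + Y\<^sup>2 = x\<^sup>2 + y\<^sup>2 + z\<^sup>2 - x * y - y * z - x * z"
        by (simp add: X_def Y_def 3 s hom_det_def power2_eq_square algebra_simps)
      then show ?thesis using three[OF w4, of x y z] roots dist by (simp add: s hom_eval_def)
    next
      case 4
      then obtain x y z where s: "a = Some x" "b = Some y" "c = Some z"
        using dist 4 by (cases a; cases b; cases c) auto
      have "X\<^sup>2 - X * Y + Y\<^sup>2 = x\<^sup>2 + y\<^sup>2 + z\<^sup>2 - x * y - y * z - x * z"
        by (simp add: X_def Y_def 4 s hom_det_def power2_eq_square algebra_simps)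
      then show ?thesis using three[OF w4, of x y z] roots dist by (simp add: s hom_eval_def)
    qed
  qed
  moreover have "X\<^sup>2 - X * Y + Y\<^sup>2 = Y\<^sup>2 * ((cross_ratio a b c d)\<^sup>2 - cross_ratio a b c d + 1)"
    using Y by (simp add: cross_ratio_def X_def[symmetric] Y_def[symmetric] field_simps power2_eq_square)
  ultimately show ?thesis using Y by auto
qed

text \<open>The set of cross ratios is closed under x -> 1/x and x -> 1 - x. A root of x^2 - x + 1
  has the two-element orbit {x, 1 - x}, and by \<open>inv\<close> every other value is a root as
  well. Conversely, for any other x the orbit contains at least three values, the harmonic orbit
  {-1, 1/2, 2} being the delicate case.\<close>

lemma equianharmonic_iff:
  assumes card: "card Q = 4"
    and inv: "\<And>a b c d. Q = {a, b, c, d} \<Longrightarrow> E \<longleftrightarrow> (cross_ratio a b c d)\<^sup>2 - cross_ratio a b c d + 1 = 0"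
  shows "equianharmonic Q \<longleftrightarrow> E"
proof -
  define S where "S = {cross_ratio a b c d | a b c d. Q = {a, b, c, d}}"
  have dist: "distinct [a, b, c, d]" if "Q = {a, b, c, d}" for a b c d
    using card that by (simp add: card_insert_if split: if_splits)
  have nz: "x \<noteq> 0" if x: "x \<in> S" for x
  proof -
    from x obtain a b c d where "Q = {a, b, c, d}" "x = cross_ratio a b c d" unfolding S_def by blast
    then show ?thesis using dist[of a b c d] by (simp add: cross_ratio_def hom_det_nonzero)
  qed
  have inverse: "1 / x \<in> S" if x: "x \<in> S" for x
  proof -
    from x obtain a b c d where Q: "Q = {a, b, c, d}" "x = cross_ratio a b c d" unfolding S_def by blast
    then have "Q = {b, a, c, d}" "1 / x = cross_ratio b a c d" by (auto simp: cross_ratio_def mult.commute)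
    then show ?thesis unfolding S_def by blast
  qed
  have compl: "1 - x \<in> S" if x: "x \<in> S" for x
  proof -
    from x obtain a b c d where Q: "Q = {a, b, c, d}" "x = cross_ratio a b c d" unfolding S_def by blast
    have n: "hom_det a d \<noteq> 0" "hom_det b c \<noteq> 0" using dist[OF Q(1)] by (simp_all add: hom_det_nonzero)
    have "cross_ratio a c b d = 1 - x"
      using n hom_det_plucker[of a b c d] hom_det_swap[of c b]
      unfolding cross_ratio_def Q(2) by (simp add: divide_simps) algebra
    moreover have "Q = {a, c, b, d}" using Q by auto
    ultimately show ?thesis unfolding S_def by (metis (mono_tags, lifting) mem_Collect_eq)
  qed
  obtain x where x: "x \<in> S"
  proof -
    obtain a b c d where "Q = {a, b, c, d}" using card by (auto simp: card_Suc_eq numeral_eq_Suc)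
    then show ?thesis using that unfolding S_def by blast
  qed
  have E: "E \<longleftrightarrow> y\<^sup>2 - y + 1 = 0" if y: "y \<in> S" for y
    using y inv unfolding S_def by auto
  have "card S = 2 \<longleftrightarrow> E"
  proof
    assume E1: E
    have xx: "x\<^sup>2 - x + 1 = 0" using E[OF x] E1 by simp
    have "S = {x, 1 - x}"
    proof
      show "{x, 1 - x} \<subseteq> S" using x compl by auto
      show "S \<subseteq> {x, 1 - x}"
      proof
        fix y assume "y \<in> S"
        then have "y\<^sup>2 - y + 1 = 0" using E E1 by simp
        then have "(y - x) * (y - (1 - x)) = 0" using xx by algebra
        then show "y \<in> {x, 1 - x}" by simp
      qed
    qed
    moreover have "x \<noteq> 1 - x"
    proof
      assume "x = 1 - x"
      then have "2 * x = 1" by (simp add: algebra_simps)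
      then have "(3 :: complex) = 0" using xx by algebra
      then show False by simp
    qed
    ultimately show "card S = 2" by simp
  next
    assume c2: "card S = 2"
    then have fin: "finite S" by (metis card.infinite zero_neq_numeral)
    have three: False if "u \<in> S" "v \<in> S" "w \<in> S" "u \<noteq> v" "u \<noteq> w" "v \<noteq> w" for u v w
    proof -
      have "card {u, v, w} \<le> card S" using that fin by (intro card_mono) auto
      then show False using that c2 by simp
    qed
    show E
    proof (rule ccontr)
      assume "\<not> E"
      then have no: "x\<^sup>2 - x + 1 \<noteq> 0" using E[OF x] by simp
      have x0: "x \<noteq> 0" "1 - x \<noteq> 0" using nz[OF x] nz[OF compl[OF x]] by simp_all
      have a: "1 / x \<noteq> 1 - x" 
      proof
        assume "1 / x = 1 - x"
        then have "x * (1 - x) = 1" using x0(1) by (metis nonzero_mult_div_cancel_left times_divide_eq_right mult.right_neutral)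
        then have "x\<^sup>2 - x + 1 = 0" by algebra
        then show False using no by simp
      qed
      \<comment> \<open>Two of x, 1/x and 1 - x must agree, and 1/x = 1 - x is the excluded
        equation. Both remaining cases lead into the harmonic orbit.\<close>
      have "x = 1 / x \<or> x = 1 - x" using three[OF x inverse[OF x] compl[OF x]] a by blast
      then show False
      proof
        assume "x = 1 / x"
        then have "x * x = 1" using x0 by (simp add: field_simps)
        then have "(x - 1) * (x + 1) = 0" by (simp add: algebra_simps)
        then have "x = - 1" using x0 by (simp add: eq_neg_iff_add_eq_0)
        then have "2 \<in> S" using compl[OF x] by simp
        then show False using three[OF x _ inverse, of 2 2] \<open>x = - 1\<close> by simp
      next
        assume "x = 1 - x"
        then have x2: "x = 1 / 2" by (simp add: field_simps)
        have "1 / x = 2" unfolding x2 by simp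
        then have two: "2 \<in> S" using inverse[OF x] by simp
        have m1: "- 1 \<in> S" using compl[OF two] by simp
        show False using three[OF x two m1] unfolding x2 by simp
      qed
    qed
  qed
  then show ?thesis using card by (simp add: equianharmonic_def S_def)
qed

text \<open>The criterion by cross ratios presupposes four branch points. One direction has this
  count inside \<open>equianharmonic\<close>; in the other it follows from simplicity, itself a
  consequence of \<open>omega = 0\<close>.\<close>

lemma omega_iff_equianharmonic:
  assumes FG: "cubic_pair F G"
  defines "f \<equiv> cp1_map F G"
  shows "omega F G = 0 \<longleftrightarrow> (\<forall>p. branch_point f p \<longrightarrow> simple_branch_point f p) \<and>
     equianharmonic {p. branch_point f p}"
proof -
  note D = cubic_pairD[OF FG]
  let ?W = "wronskian F G"
  have nv: "nonvanishing F G" by (rule nonvanishing_cubic_pair[OF FG])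
  have f: "f = cubic_map F G" unfolding f_def by (rule cp1_map_cubic_map[OF FG])
  have W0: "?W \<noteq> 0" by (rule wronskian_nonzero[OF nv D(2,3)])
  have "equianharmonic {p. branch_point f p} \<longleftrightarrow> omega F G = 0" if card: "card {p. branch_point f p} = 4"
  proof (rule equianharmonic_iff[OF card])
    fix a b c d assume Q: "{p. branch_point f p} = {a, b, c, d}"
    have "distinct [a, b, c, d]" using card unfolding Q by (simp add: card_insert_if split: if_splits)
    moreover have "hom_eval 4 ?W p = 0" if "p \<in> {a, b, c, d}" for p
      using that unfolding Q[symmetric] by (simp add: f branch_point_hom_eval[OF nv D(2,3)])
    ultimately show "omega F G = 0 \<longleftrightarrow> (cross_ratio a b c d)\<^sup>2 - cross_ratio a b c d + 1 = 0"
      using quartic_invariant_cross_ratio[of ?W a b c d] W0 coeff_wronskian(6)[OF D(2,3)]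
      unfolding quartic_invariant[OF D(2,3)] by simp
  qed
  moreover have "equianharmonic {p. branch_point f p} \<Longrightarrow> card {p. branch_point f p} = 4"
    by (simp add: equianharmonic_def)
  moreover have "simple_branch_point f p" if "omega F G = 0" "branch_point f p" for p
    using omega_imp_simple[OF nv] that unfolding f by blast
  moreover have "card {p. branch_point f p} = 4" if "\<And>p. branch_point f p \<Longrightarrow> simple_branch_point f p"
    using card_branch_points[OF nv D(2,3)] that unfolding f by blast
  ultimately show ?thesis by blast
qed


section \<open>Horizontal maps\<close>

lemma horizontal_wronskian: "horizontal F0 F1 F2 F3 \<longleftrightarrow> wronskian F0 F1 + wronskian F2 F3 = 0"
  by (simp add: horizontal_def wronskian_def algebra_simps)

lemma horizontal_coeffs:
  assumes "degree F0 \<le> 3" "degree F1 \<le> 3" "degree F2 \<le> 3" "degree F3 \<le> 3"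
  shows "horizontal F0 F1 F2 F3 \<longleftrightarrow>
     plucker F0 F1 1 0 + plucker F2 F3 1 0 = 0 \<and> plucker F0 F1 2 0 + plucker F2 F3 2 0 = 0 \<and>
     3 * (plucker F0 F1 3 0 + plucker F2 F3 3 0) + (plucker F0 F1 2 1 + plucker F2 F3 2 1) = 0 \<and>
     plucker F0 F1 3 1 + plucker F2 F3 3 1 = 0 \<and> plucker F0 F1 3 2 + plucker F2 F3 3 2 = 0"
proof -
  have two: "2 * a + 2 * b = 0 \<longleftrightarrow> a + b = 0" for a b :: complex
    by (metis distrib_left mult_eq_0_iff zero_neq_numeral)
  have three: "(3 * a + b) + (3 * c + d) = 3 * (a + c) + (b + d)" for a b c d :: complex
    by (simp add: algebra_simps)
  show ?thesis
    unfolding horizontal_wronskian wronskian_cubic[OF assms(1,2)] wronskian_cubic[OF assms(3,4)]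
    by (simp only: add_pCons two three pCons_eq_0_iff add_0 simp_thms)
qed

lemma nat_le_3: "i \<le> 3 \<longleftrightarrow> i = 0 \<or> i = 1 \<or> i = 2 \<or> i = (3::nat)"
  by auto

text \<open>Horizontality says that \<open>F0 \<and> F1 + F2 \<and> F3\<close> is a multiple of the invariant bivector; contracting
  it with \<open>omega _ F2\<close> gives the following relation.\<close>

lemma horizontal_relation:
  assumes deg: "degree F0 \<le> 3" "degree F1 \<le> 3" "degree F2 \<le> 3" "degree F3 \<le> 3"
    and h: "horizontal F0 F1 F2 F3"
  shows "\<exists>c. smult (omega F0 F2) F1 = smult (omega F1 F2) F0 + smult c F2"
proof -
  \<comment> \<open>The multiple in question: the bivector has p30 = t and p21 = -3t, and its other
    Pluecker coordinates vanish.\<close>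
  define t where "t = plucker F0 F1 3 0 + plucker F2 F3 3 0"
  have P: "plucker F0 F1 1 0 + plucker F2 F3 1 0 = 0" "plucker F0 F1 2 0 + plucker F2 F3 2 0 = 0"
     "3 * (plucker F0 F1 3 0 + plucker F2 F3 3 0) + (plucker F0 F1 2 1 + plucker F2 F3 2 1) = 0"
     "plucker F0 F1 3 1 + plucker F2 F3 3 1 = 0" "plucker F0 F1 3 2 + plucker F2 F3 3 2 = 0"
    using h unfolding horizontal_coeffs[OF deg] by blast+
  have "smult (omega F0 F2) F1 = smult (omega F1 F2) F0 + smult (omega F3 F2 - 3 * t) F2"
  proof (rule poly_eqI)
    fix n
    have *: "omega F0 F2 * coeff F1 i = omega F1 F2 * coeff F0 i + (omega F3 F2 - 3 * t) * coeff F2 i"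
      if "i = 0 \<or> i = 1 \<or> i = 2 \<or> i = 3" for i
      using that
    proof (elim disjE)
      assume i: "i = 0"
      show ?thesis unfolding i omega_def t_def using P by algebra
    next
      assume i: "i = 1"
      show ?thesis unfolding i omega_def t_def using P by algebra
    next
      assume i: "i = 2"
      show ?thesis unfolding i omega_def t_def using P by algebra
    next
      assume i: "i = 3"
      show ?thesis unfolding i omega_def t_def using P by algebra
    qed
    show "coeff (smult (omega F0 F2) F1) n = coeff (smult (omega F1 F2) F0 + smult (omega F3 F2 - 3 * t) F2) n"
    proof (cases "n \<le> 3")
      case True
      then show ?thesis using *[of n] by (simp add: nat_le_3)
    next
      case False then show ?thesis using deg by (simp add: coeff_eq_0)
    qed
  qed
  then show ?thesis by blast
qed

section \<open>Symplectic linear algebra of cubics\<close>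

lemma omega_skew: "omega G F = - omega F G"
  by (simp add: omega_def algebra_simps)

lemma omega_self: "omega F F = 0"
  by (simp add: omega_def algebra_simps)

lemma omega_linear:
  "omega F (G + H) = omega F G + omega F H" "omega F (smult k G) = k * omega F G" "omega F 0 = 0"
  by (simp_all add: omega_def algebra_simps)

lemma omega_monom:
  assumes "i \<le> 3"
  shows "omega F (monom a (3 - i)) = (if i = 0 then 3 else if i = 1 then - 1 else if i = 2 then 1 else - 3) * coeff F i * a"
  using assms unfolding nat_le_3 by (elim disjE) (simp_all add: omega_def coeff_monom)

text \<open>Nondegeneracy of \<open>omega\<close> on a pencil. Coefficient \<open>i\<close> is
  paired with coefficient \<open>3 - i\<close> by a nonzero weight, so two monomials suffice, with
  coefficients given by Cramer's rule.\<close>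

lemma omega_surj:
  assumes "i \<le> 3" "j \<le> 3" "plucker F G i j \<noteq> 0"
  shows "\<exists>X. degree X \<le> 3 \<and> omega F X = r \<and> omega G X = s"
proof -
  define k where "k i = (if i = 0 then 3 else if i = 1 then - 1 else if i = 2 then 1 else - 3 :: complex)" for i :: nat
  have k0: "k i \<noteq> 0" for i by (simp add: k_def)
  define p where "p = plucker F G i j"
  have p: "p \<noteq> 0" using assms by (simp add: p_def)
  define X where "X = monom ((r * coeff G j - s * coeff F j) / p / k i) (3 - i) +
     monom ((s * coeff F i - r * coeff G i) / p / k j) (3 - j)"
  have "degree X \<le> 3" unfolding X_def by (intro degree_add_le order_trans[OF degree_monom_le]) auto
  moreover have om: "omega H X = coeff H i * ((r * coeff G j - s * coeff F j) / p) + coeff H j * ((s * coeff F i - r * coeff G i) / p)" for H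
    unfolding X_def omega_linear omega_monom[OF assms(1)] omega_monom[OF assms(2)] k_def[symmetric]
    using k0 by simp
  have "omega F X = r * plucker F G i j / p" "omega G X = s * plucker F G i j / p"
    unfolding om using p by (simp_all add: field_simps)
  then have "omega F X = r" "omega G X = s" using p by (simp_all add: p_def)
  ultimately show ?thesis by blast
qed

lemma vector_4 [simp]:
  fixes a b c d :: "'a :: zero"
  shows "(vector [a, b, c, d] :: 'a ^ 4) $ 1 = a" "(vector [a, b, c, d] :: 'a ^ 4) $ 2 = b"
    "(vector [a, b, c, d] :: 'a ^ 4) $ 3 = c" "(vector [a, b, c, d] :: 'a ^ 4) $ 4 = d"
  unfolding vector_def by simp_all

definition coeff_vec :: "complex poly \<Rightarrow> complex ^ 4" where
  "coeff_vec F = vector [coeff F 0, coeff F 1, coeff F 2, coeff F 3]"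

text \<open>The relations say that \<open>B\<close> is a left inverse of the coefficient matrix
  \<open>A\<close>. As a right inverse, the same matrix expresses that the bivector of the basis is
  dual to \<open>omega\<close>, and that is horizontality.\<close>

lemma horizontal_symplectic_basis:
  assumes deg: "degree F0 \<le> 3" "degree F1 \<le> 3" "degree F2 \<le> 3" "degree F3 \<le> 3"
    and om: "omega F0 F1 = 1" "omega F2 F3 = 1" "omega F0 F2 = 0" "omega F0 F3 = 0" "omega F1 F2 = 0"
      "omega F1 F3 = 0"
  shows "horizontal F0 F1 F2 F3"
proof -
  define A :: "complex ^ 4 ^ 4" where
    "A = transpose (vector [coeff_vec F0, coeff_vec F1, coeff_vec F2, coeff_vec F3])"
  define dual :: "complex poly \<Rightarrow> complex ^ 4" where
    "dual F = vector [- 3 * coeff F 3, coeff F 2, - coeff F 1, 3 * coeff F 0]" for F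
  define B :: "complex ^ 4 ^ 4" where
    "B = vector [- dual F1, dual F0, - dual F3, dual F2]"
  have d: "(\<Sum>i\<in>UNIV. dual F $ i * coeff_vec G $ i) = omega F G" for F G
    by (simp add: sum_4 dual_def coeff_vec_def omega_def)
  have "B ** A = mat 1"
  proof -
    have skew: "omega F1 F0 = - 1" "omega F3 F2 = - 1" "omega F2 F0 = 0" "omega F3 F0 = 0" "omega F2 F1 = 0"
      "omega F3 F1 = 0" unfolding omega_skew[of F1 F0] omega_skew[of F3 F2] omega_skew[of F2 F0] omega_skew[of F3 F0]
        omega_skew[of F2 F1] omega_skew[of F3 F1] using om by simp_all
    have e: "(B ** A) $ i $ j = (\<Sum>k\<in>UNIV. B $ i $ k * (vector [coeff_vec F0, coeff_vec F1, coeff_vec F2, coeff_vec F3] :: complex ^ 4 ^ 4) $ j $ k)" for i j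
      by (simp add: matrix_matrix_mult_def A_def transpose_def)
    show ?thesis
      unfolding vec_eq_iff forall_4 e
      by (simp add: B_def sum_negf d skew om omega_self mat_def)
  qed
  then have AB: "A ** B = mat 1" by (simp add: matrix_left_right_inverse)
  have entries: "(A ** B) $ i $ j = (mat 1 :: complex ^ 4 ^ 4) $ i $ j" for i j by (simp add: AB)
  note e = entries[unfolded matrix_matrix_mult_def sum_4 A_def B_def transpose_def]
  \<comment> \<open>The entries for p30 and p21 are not 0 but -1/3 and 1; they cancel in the
    combination 3 p30 + p21 that horizontality asks for.\<close>
  have P: "3 * (plucker F0 F1 1 0 + plucker F2 F3 1 0) = 0" "3 * (plucker F0 F1 2 0 + plucker F2 F3 2 0) = 0"
    "3 * (plucker F0 F1 3 0 + plucker F2 F3 3 0) = - 1" "plucker F0 F1 2 1 + plucker F2 F3 2 1 = 1"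
     "plucker F0 F1 3 1 + plucker F2 F3 3 1 = 0" "plucker F0 F1 3 2 + plucker F2 F3 3 2 = 0"
    using e[of 2 4] e[of 3 4] e[of 4 4] e[of 3 3] e[of 4 2] e[of 4 3]
    by (simp_all add: dual_def coeff_vec_def mat_def algebra_simps)
  have "plucker F0 F1 1 0 + plucker F2 F3 1 0 = 0" "plucker F0 F1 2 0 + plucker F2 F3 2 0 = 0"
    using P(1,2) unfolding mult_eq_0_iff by (metis zero_neq_numeral)+
  then show ?thesis unfolding horizontal_coeffs[OF deg] P(3-6) by (simp only:) simp
qed

definition lin_indep4 :: "complex poly \<Rightarrow> complex poly \<Rightarrow> complex poly \<Rightarrow> complex poly \<Rightarrow> bool" where
  "lin_indep4 F0 F1 F2 F3 \<longleftrightarrow> (\<forall>a b c d. smult a F0 + smult b F1 + smult c F2 + smult d F3 = 0 \<longrightarrow>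
     a = 0 \<and> b = 0 \<and> c = 0 \<and> d = 0)"

text \<open>An isotropic pair is completed to a symplectic basis. The basis property also yields
  linear independence: pairing a relation with each basis element isolates one coefficient.\<close>

lemma omega_imp_horizontal:
  assumes FG: "cubic_pair F0 F2" and om: "omega F0 F2 = 0"
  shows "\<exists>F1 F3. degree F1 \<le> 3 \<and> degree F3 \<le> 3 \<and> horizontal F0 F1 F2 F3 \<and> lin_indep4 F0 F1 F2 F3"
proof -
  note D = cubic_pairD[OF FG]
  obtain i j where ij: "i \<le> 3" "j \<le> 3" "plucker F0 F2 i j \<noteq> 0" using plucker_nonzero[OF FG] by blast
  obtain F1 where F1: "degree F1 \<le> 3" "omega F0 F1 = 1" "omega F2 F1 = 0"
    using omega_surj[OF ij, of 1 0] by blast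
  obtain X where X: "degree X \<le> 3" "omega F0 X = 0" "omega F2 X = 1"
    using omega_surj[OF ij, of 0 1] by blast
  \<comment> \<open>Adding a multiple of \<open>F0\<close> leaves the pairings with
    \<open>F0\<close> and \<open>F2\<close> unchanged and, since \<open>omega F1 F0 = - 1\<close>,
    cancels the pairing with \<open>F1\<close>.\<close>
  define F3 where "F3 = X + smult (omega F1 X) F0"
  have F3: "degree F3 \<le> 3"
    unfolding F3_def using X D by (intro degree_add_le order_trans[OF degree_smult_le]) auto
  have om3: "omega F0 F3 = 0" "omega F2 F3 = 1" "omega F1 F3 = 0"
    unfolding F3_def omega_linear using X F1 om omega_skew[of F2 F0] omega_skew[of F1 F0]
    by (simp_all add: omega_self)
  have om12: "omega F1 F2 = 0" using F1 omega_skew[of F2 F1] by simp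
  have h: "horizontal F0 F1 F2 F3"
    using horizontal_symplectic_basis D(2) F1 D(3) F3 om om3 om12 by blast
  have "lin_indep4 F0 F1 F2 F3"
    unfolding lin_indep4_def
  proof (intro allI impI)
    fix a b c d assume 0: "smult a F0 + smult b F1 + smult c F2 + smult d F3 = 0"
    have z: "a * omega H F0 + b * omega H F1 + c * omega H F2 + d * omega H F3 = 0" for H
      using arg_cong[OF 0, of "omega H"] unfolding omega_linear .
    show "a = 0 \<and> b = 0 \<and> c = 0 \<and> d = 0"
      using z[of F0] z[of F1] z[of F2] z[of F3] F1 om om3 om12 omega_skew[of F1 F0] omega_skew[of F3 F2]
        omega_skew[of F2 F0] omega_skew[of F3 F0] omega_skew[of F3 F1]
      by (simp add: omega_self)
  qed
  then show ?thesis using F1(1) F3 h by blast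
qed

section \<open>Hyperplanes of complex 4-space and fullness\<close>

lemma vec_subspace_real: "vec.subspace H \<Longrightarrow> subspace (H :: (complex ^ 'n) set)"
proof -
  assume H: "vec.subspace H"
  have "c *\<^sub>R x = of_real c *s x" for c and x :: "complex ^ 'n"
    by (simp add: vec_eq_iff scaleR_conv_of_real[where 'a=complex])
  then show "subspace H"
    using H unfolding subspace_def vec.subspace_def by metis
qed

text \<open>A real normal vector gives a complex functional whose real part vanishes on
  \<open>H\<close>; stability of \<open>H\<close> under multiplication by \<open>\<i>\<close> kills
  the imaginary part as well.\<close>

lemma vec_subspace_annihilator:
  fixes H :: "(complex ^ 'n) set"
  assumes H: "vec.subspace H" and ne: "H \<noteq> UNIV"
  shows "\<exists>a. a \<noteq> 0 \<and> (\<forall>x\<in>H. (\<Sum>i\<in>UNIV. a $ i * x $ i) = 0)"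
proof -
  have sp: "span H = H" using vec_subspace_real[OF H] span_eq_iff by blast
  obtain a where a: "a \<noteq> 0" "\<And>x. x \<in> H \<Longrightarrow> a \<bullet> x = 0"
    using span_not_UNIV_orthogonal[of H] ne unfolding sp by blast
  define b :: "complex ^ 'n" where "b = (\<chi> i. cnj (a $ i))"
  have re: "a \<bullet> x = Re (\<Sum>i\<in>UNIV. b $ i * x $ i)" for x
    by (simp add: inner_vec_def b_def inner_complex_def)
  have "(\<Sum>i\<in>UNIV. b $ i * x $ i) = 0" if x: "x \<in> H" for x
  proof (rule complex_eqI)
    show "Re (\<Sum>i\<in>UNIV. b $ i * x $ i) = Re 0" using a(2)[OF x] re by simp
    have "\<i> *s x \<in> H" using H x by (simp add: vec.subspace_def)
    then have "Re (\<Sum>i\<in>UNIV. b $ i * (\<i> *s x) $ i) = 0" using a(2) re by metis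
    also have "(\<Sum>i\<in>UNIV. b $ i * (\<i> *s x) $ i) = \<i> * (\<Sum>i\<in>UNIV. b $ i * x $ i)"
      by (simp add: sum_distrib_left algebra_simps)
    finally show "Im (\<Sum>i\<in>UNIV. b $ i * x $ i) = Im 0" by simp
  qed
  moreover have "b \<noteq> 0" using a(1) by (auto simp: b_def vec_eq_iff)
  ultimately show ?thesis by blast
qed

lemma full_cp3_map:
  assumes li: "lin_indep4 F0 F1 F2 F3"
  shows "full (cp3_map F0 F1 F2 F3)"
  unfolding full_def
proof
  assume "\<exists>H. vec.subspace H \<and> vec.dim H = 3 \<and> (\<forall>p. cp3_map F0 F1 F2 F3 p \<subseteq> H)"
  then obtain H where H: "vec.subspace H" "vec.dim H = 3" "\<And>p. cp3_map F0 F1 F2 F3 p \<subseteq> H" by blast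
  have "H \<noteq> UNIV" using H(2) vec_dim_card[where 'a=complex and 'n=4] by auto
  from vec_subspace_annihilator[OF H(1) this] obtain a
    where a: "a \<noteq> 0" "\<And>x. x \<in> H \<Longrightarrow> (\<Sum>i\<in>UNIV. a $ i * x $ i) = 0" by blast
  have "poly (smult (a $ 1) F0 + smult (a $ 2) F1 + smult (a $ 3) F2 + smult (a $ 4) F3) z = 0" for z
  proof -
    have "vector [poly F0 z, poly F1 z, poly F2 z, poly F3 z] \<in> H"
      using H(3)[of "Some z"] unfolding cp3_map_def Let_def proj_point_def hom_eval_def option.case
      by (meson insertI1 subset_eq vec.span_base)
    from a(2)[OF this] show ?thesis by (simp add: sum_4)
  qed
  then have "smult (a $ 1) F0 + smult (a $ 2) F1 + smult (a $ 3) F2 + smult (a $ 4) F3 = 0"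
    using poly_all_0_iff_0 by blast
  then have "a = 0" using li unfolding lin_indep4_def vec_eq_iff forall_4 by simp
  then show False using a by simp
qed

text \<open>The relation would confine the image to the hyperplane \<open>H\<close>. Its dimension
  is found by adjoining one vector \<open>e\<close> outside it, after which the whole space is
  spanned.\<close>

lemma full_not_in_span:
  assumes full: "full (cp3_map F0 F1 F2 F3)"
  shows "F1 \<noteq> smult a F0 + smult b F2"
proof
  assume F1: "F1 = smult a F0 + smult b F2"
  define H :: "(complex ^ 4) set" where "H = {v. v $ 2 = a * v $ 1 + b * v $ 3}"
  define e :: "complex ^ 4" where "e = axis 2 1"
  have sub: "vec.subspace H"
    by (auto simp: H_def vec.subspace_def algebra_simps)
  have "e \<notin> H" by (simp add: H_def e_def axis_def)
  moreover have "vec.span H = H" using sub vec.span_eq_iff by blast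
  ultimately have d: "vec.dim (insert e H) = vec.dim H + 1" by (simp only: vec.dim_insert if_False)
  have "vec.span (insert e H) = UNIV"
  proof -
    have "v \<in> vec.span (insert e H)" for v
    proof -
      define r where "r = v $ 2 - a * v $ 1 - b * v $ 3"
      have "v - r *s e \<in> H" by (simp add: H_def e_def axis_def r_def)
      then have "v - r *s e \<in> vec.span (insert e H)" by (intro vec.span_base) simp
      then have "v - r *s e + r *s e \<in> vec.span (insert e H)"
        by (intro vec.span_add vec.span_scale) (simp_all add: vec.span_base)
      then show ?thesis by simp
    qed
    then show ?thesis by blast
  qed
  then have "vec.dim (insert e H) = CARD(4)" by (metis vec.dim_span vec_dim_card)
  then have "vec.dim H = 3" using d by simp
  moreover have "cp3_map F0 F1 F2 F3 p \<subseteq> H" for p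
  proof -
    have "hom_eval n F1 p = a * hom_eval n F0 p + b * hom_eval n F2 p" for n
      by (cases p) (simp_all add: hom_eval_def F1)
    then show ?thesis
      unfolding cp3_map_def Let_def proj_point_def by (intro vec.span_minimal sub) (simp add: H_def)
  qed
  ultimately show False using full sub unfolding full_def by blast
qed


section \<open>Collapse points\<close>

text \<open>The point is that \<open>k\<close> is the same for all cubics, so that projective points
  do not notice it; at infinity it is the cube of 1/w.\<close>

lemma hom_eval_chart_inv:
  obtains k where "k \<noteq> 0" "\<And>F. degree F \<le> 3 \<Longrightarrow> hom_eval 3 F (chart_inv p w) = k * poly (localize p F) w"
proof (cases p)
  case None
  show ?thesis
  proof (cases "w = 0")
    case True
    show ?thesis
    proof (rule that[of 1])
      show "hom_eval 3 F (chart_inv p w) = 1 * poly (localize p F) w" for F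
        unfolding None True chart_inv_def hom_eval_def poly_0_coeff coeff_localize by simp
    qed simp
  next
    case False
    show ?thesis
    proof (rule that[of "(1 / w) ^ 3"])
      fix F :: "complex poly" assume d: "degree F \<le> 3"
      have alg: "c0 + c1 * u + c2 * u\<^sup>2 + c3 * u ^ 3 = u ^ 3 * (c3 + c2 * w + c1 * w\<^sup>2 + c0 * w ^ 3)"
        if "w * u = 1" for c0 c1 c2 c3 u :: complex
        using that by algebra
      show "hom_eval 3 F (chart_inv p w) = (1 / w) ^ 3 * poly (localize p F) w"
        unfolding None chart_inv_def option.case if_not_P[OF False] hom_eval_def poly_cubic[OF d]
          poly_cubic[OF degree_localize] coeff_localize
        by (rule alg) (use False in simp)
    qed (use False in simp)
  qed
next
  case (Some a)
  show ?thesis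
  proof (rule that[of 1])
    fix F :: "complex poly" assume d: "degree F \<le> 3"
    show "hom_eval 3 F (chart_inv p w) = 1 * poly (localize p F) w"
      unfolding Some chart_inv_def hom_eval_def option.case poly_cubic[OF d] poly_cubic[OF degree_localize] coeff_localize
      by algebra
  qed simp
qed

lemma proj_point_scale: "k \<noteq> 0 \<Longrightarrow> proj_point (k *s v) = proj_point v"
  unfolding proj_point_def vec.span_singleton
proof (intro set_eqI iffI)
  fix x assume k: "k \<noteq> 0"
  { assume "x \<in> range (\<lambda>c. c *s (k *s v))" then show "x \<in> range (\<lambda>c. c *s v)" by auto }
  { assume "x \<in> range (\<lambda>c. c *s v)"
    then obtain c where "x = c *s v" by auto
    then have "x = (c / k) *s (k *s v)" using k by simp
    then show "x \<in> range (\<lambda>c. c *s (k *s v))" by blast }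
qed

lemma proj_point_eqD:
  assumes "proj_point v = proj_point w" "w \<noteq> 0"
  obtains k where "k \<noteq> 0" "w = k *s v"
proof -
  have "w \<in> proj_point v" unfolding assms(1) by (simp add: proj_point_def vec.span_base)
  then obtain k where "w = k *s v" by (auto simp: proj_point_def vec.span_singleton)
  then show ?thesis using that[of k] assms(2) by fastforce
qed

lemma openin_chart:
  assumes "r > 0"
  shows "openin riemann_sphere_topology (chart_inv p ` ball 0 r)" "p \<in> chart_inv p ` ball 0 r"
proof -
  show "p \<in> chart_inv p ` ball 0 r"
    using assms by (cases p) (auto simp: chart_inv_def intro!: image_eqI[of _ _ 0])
  show "openin riemann_sphere_topology (chart_inv p ` ball 0 r)"
  proof (cases p)
    case None
    have "chart_inv None ` ball 0 r = insert None (Some ` (UNIV - cball 0 (1 / r)))"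
    proof (intro set_eqI iffI)
      fix q assume "q \<in> chart_inv None ` ball 0 r"
      then obtain w where w: "q = chart_inv None w" "norm w < r" by auto
      show "q \<in> insert None (Some ` (UNIV - cball 0 (1 / r)))"
        using w assms by (auto simp: chart_inv_def norm_divide field_simps)
    next
      fix q :: riemann_sphere assume "q \<in> insert None (Some ` (UNIV - cball 0 (1 / r)))"
      then consider "q = None" | z where "q = Some z" "norm z > 1 / r" by auto
      then show "q \<in> chart_inv None ` ball 0 r"
      proof cases
        case 1
        then show ?thesis using assms by (auto simp: chart_inv_def intro!: image_eqI[of _ _ 0])
      next
        case 2
        then have "norm z > 0" using assms by (smt (verit) divide_pos_pos)
        then have "1 / z \<in> ball 0 r" "q = chart_inv None (1 / z)"
          using 2 assms by (auto simp: chart_inv_def norm_divide field_simps)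
        then show ?thesis by blast
      qed
    qed
    then show ?thesis
      unfolding None riemann_sphere_topology_def openin_Alexandroff_compactification
      by (metis compact_cball compactin_euclidean_iff closed_cball closed_closedin topspace_euclidean)
  next
    case (Some a)
    have "chart_inv (Some a) ` ball 0 r = Some ` ball a r"
    proof -
      have "(+) a ` ball 0 r = ball a r" by (simp add: ball_translation)
      then show ?thesis unfolding chart_inv_def option.case by (metis (no_types, lifting) image_cong image_image)
    qed
    then show ?thesis unfolding Some riemann_sphere_topology_def by simp
  qed
qed

lemma topspace_riemann_sphere: "topspace riemann_sphere_topology = UNIV"
  by (auto simp: riemann_sphere_topology_def) (metis option.exhaust rangeI)

lemma max_degree4_bounds:
  assumes "max_degree4 F0 F1 F2 F3 = d"
  shows "degree F0 \<le> d" "degree F1 \<le> d" "degree F2 \<le> d" "degree F3 \<le> d"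
  using assms by (auto simp: max_degree4_def)

text \<open>Since horizontality is linear in \<open>(F1, F3)\<close>, the path \<open>t \<mapsto> [F0, t F1, F2, t F3]\<close> consists of
  horizontal maps.\<close>

locale collapsing_path =
  fixes F0 F1 F2 F3 :: "complex poly"
  assumes pair: "cubic_pair F0 F2" and deg: "degree F1 \<le> 3" "degree F3 \<le> 3"
begin

definition path :: "complex \<Rightarrow> riemann_sphere \<Rightarrow> cp3" where
  "path t = cp3_map F0 (smult t F1) F2 (smult t F3)"

lemma max_degree_path: "max_degree4 F0 (smult t F1) F2 (smult t F3) = 3"
proof -
  have "degree (smult t F1) \<le> 3" "degree (smult t F3) \<le> 3" using deg by (auto intro: order_trans[OF degree_smult_le])
  then show ?thesis using cubic_pairD(2-4)[OF pair]
    by (auto simp: max_degree4_def max_def)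
qed

text \<open>A nowhere zero lift of the path to complex 4-space near \<open>p\<close>, polynomial
  jointly in \<open>t\<close> and the chart parameter.\<close>

definition lift :: "riemann_sphere \<Rightarrow> complex \<Rightarrow> complex \<Rightarrow> complex ^ 4" where
  "lift p t w = vector [poly (localize p F0) w, t * poly (localize p F1) w, poly (localize p F2) w,
     t * poly (localize p F3) w]"

lemma path_lift: "path t (chart_inv p w) = proj_point (lift p t w)"
proof -
  obtain k where k: "k \<noteq> 0" "\<And>F. degree F \<le> 3 \<Longrightarrow> hom_eval 3 F (chart_inv p w) = k * poly (localize p F) w"
    using hom_eval_chart_inv by blast
  have sm: "hom_eval 3 (smult t F) q = t * hom_eval 3 F q" for F q
    by (cases q) (simp_all add: hom_eval_def)
  have "vector [hom_eval 3 F0 (chart_inv p w), hom_eval 3 (smult t F1) (chart_inv p w),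
      hom_eval 3 F2 (chart_inv p w), hom_eval 3 (smult t F3) (chart_inv p w)] = k *s lift p t w"
    unfolding sm k(2)[OF cubic_pairD(2)[OF pair]] k(2)[OF cubic_pairD(3)[OF pair]] k(2)[OF deg(1)] k(2)[OF deg(2)]
    by (simp add: vec_eq_iff forall_4 lift_def)
  then show ?thesis
    unfolding path_def cp3_map_def max_degree_path Let_def by (simp add: proj_point_scale k(1))
qed

lemma lift_nonzero: "lift p t w \<noteq> 0"
proof -
  have "nonvanishing (localize p F0) (localize p F2)"
    by (rule nonvanishing_localize[OF nonvanishing_cubic_pair[OF pair]])
  then have "poly (localize p F0) w \<noteq> 0 \<or> poly (localize p F2) w \<noteq> 0"
    unfolding cubic_form_localize by (auto simp: nonvanishing_def)
  then show ?thesis by (auto simp: lift_def vec_eq_iff forall_4)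
qed

lemma continuous_lift: "continuous_on UNIV (\<lambda>x. lift p (fst x) (snd x))"
proof (rule continuous_on_vec_lambda[of UNIV "\<lambda>i x. lift p (fst x) (snd x) $ i", simplified])
  have "\<forall>i. continuous_on UNIV (\<lambda>x. lift p (fst x) (snd x) $ i)"
    unfolding forall_4 lift_def vector_4 by (intro conjI continuous_intros)
  then show "continuous_on UNIV (\<lambda>x. lift p (fst x) (snd x) $ i)" for i by blast
qed

text \<open>Joint continuity of the lift gives a product neighbourhood, hence a range of parameters
  that serves all points near \<open>p\<close> at once. The covering argument in
  \<open>path_compact_open\<close> needs exactly this uniformity.\<close>

lemma path_local:
  assumes U: "openin proj_topology U" and p: "path t0 p \<in> U"
  shows "\<exists>V. openin riemann_sphere_topology V \<and> p \<in> V \<and> (\<forall>\<^sub>F t in nhds t0. \<forall>q\<in>V. path t q \<in> U)"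
proof -
  define Z where "Z = {v. v \<noteq> 0 \<and> proj_point v \<in> U}"
  have "open Z" using U by (simp add: openin_proj_topology Z_def)
  then have O: "open ((\<lambda>x. lift p (fst x) (snd x)) -` Z)"
    using continuous_lift by (simp add: continuous_on_open_vimage[OF open_UNIV])
  have cp: "chart_inv p 0 = p" by (cases p) (simp_all add: chart_inv_def)
  have "(t0, 0) \<in> (\<lambda>x. lift p (fst x) (snd x)) -` Z"
    using p path_lift[of t0 p 0] by (simp add: Z_def lift_nonzero cp)
  then obtain A B where "open A" "open B" "(t0, 0) \<in> A \<times> B" "A \<times> B \<subseteq> (\<lambda>x. lift p (fst x) (snd x)) -` Z"
    by (rule open_prod_elim[OF O])
  then have AB: "open A" "open B" "t0 \<in> A" "0 \<in> B" "A \<times> B \<subseteq> (\<lambda>x. lift p (fst x) (snd x)) -` Z"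
    by simp_all
  obtain r where r: "r > 0" "ball 0 r \<subseteq> B" using AB openE by blast
  have "\<forall>\<^sub>F t in nhds t0. \<forall>q\<in>chart_inv p ` ball 0 r. path t q \<in> U"
    unfolding eventually_nhds
  proof (intro exI conjI ballI)
    fix t q assume "t \<in> A" "q \<in> chart_inv p ` ball 0 r"
    then obtain w where "q = chart_inv p w" "(t, w) \<in> A \<times> B" using r by auto
    then show "path t q \<in> U" using AB(5) by (auto simp: Z_def path_lift)
  qed (use AB in auto)
  then show ?thesis using openin_chart[OF r(1), of p] by blast
qed

lemma continuous_map_path: "continuous_map riemann_sphere_topology proj_topology (path t)"
  unfolding continuous_map_def topspace_riemann_sphere topspace_proj_topology
proof (intro conjI allI impI)
  show "path t \<in> UNIV \<rightarrow> proj_space"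
  proof
    fix p
    have "chart_inv p 0 = p" by (cases p) (simp_all add: chart_inv_def)
    then have "path t p = proj_point (lift p t 0)" using path_lift[of t p 0] by simp
    then show "path t p \<in> proj_space" using lift_nonzero by (auto simp: proj_space_def)
  qed
  fix U assume U: "openin proj_topology (U :: cp3 set)"
  show "openin riemann_sphere_topology {x \<in> UNIV. path t x \<in> U}"
  proof (subst openin_subopen, intro ballI)
    fix p assume "p \<in> {x \<in> UNIV. path t x \<in> U}"
    then obtain V where "openin riemann_sphere_topology V" "p \<in> V" "\<forall>\<^sub>F t' in nhds t. \<forall>q\<in>V. path t' q \<in> U"
      using path_local[OF U] by blast
    then show "\<exists>T. openin riemann_sphere_topology T \<and> p \<in> T \<and> T \<subseteq> {x \<in> UNIV. path t x \<in> U}"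
      by (auto dest!: eventually_nhds_x_imp_x)
  qed
qed

text \<open>Continuity of \<open>path\<close> as a curve of maps. For a subbasic set the
  neighbourhoods from \<open>path_local\<close> cover the compact set, and a finite subcover leaves
  a common range of parameters; the rest is induction over the generation of the topology.\<close>

lemma path_compact_open:
  assumes "openin (compact_open_topology riemann_sphere_topology proj_topology) T" "path t0 \<in> T"
  shows "\<forall>\<^sub>F t in nhds t0. path t \<in> T"
proof -
  have "generate_topology_on {{f. continuous_map riemann_sphere_topology proj_topology f \<and> f ` K \<subseteq> U} | K U.
      compactin riemann_sphere_topology K \<and> openin proj_topology U} T"
    using assms(1) unfolding compact_open_topology_def by (rule openin_topology_generated_by)
  then show ?thesis using assms(2)
  proof (induction rule: generate_topology_on.induct)
    case Empty then show ?case by simp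
  next
    case (Int a b) then show ?case by (simp add: eventually_conj)
  next
    case (UN K)
    then obtain k where "k \<in> K" "path t0 \<in> k" by blast
    then have "\<forall>\<^sub>F t in nhds t0. path t \<in> k" using UN by blast
    then show ?case by eventually_elim (use \<open>k \<in> K\<close> in blast)
  next
    case (Basis s)
    then obtain K U where s: "s = {f. continuous_map riemann_sphere_topology proj_topology f \<and> f ` K \<subseteq> U}"
      and K: "compactin riemann_sphere_topology K" and U: "openin proj_topology U" by blast
    define \<V> where "\<V> = {V. openin riemann_sphere_topology V \<and> (\<forall>\<^sub>F t in nhds t0. \<forall>q\<in>V. path t q \<in> U)}"
    have "path t0 p \<in> U" if "p \<in> K" for p using Basis(2) that by (auto simp: s)
    then have "K \<subseteq> \<Union>\<V>" using path_local[OF U] unfolding \<V>_def by blast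
    moreover have "\<forall>V\<in>\<V>. openin riemann_sphere_topology V" by (simp add: \<V>_def)
    ultimately obtain \<F> where F: "finite \<F>" "\<F> \<subseteq> \<V>" "K \<subseteq> \<Union>\<F>"
      using K unfolding compactin_def by meson
    have "\<forall>\<^sub>F t in nhds t0. \<forall>V\<in>\<F>. \<forall>q\<in>V. path t q \<in> U"
      using F(2) by (intro eventually_ball_finite[OF F(1)]) (auto simp: \<V>_def)
    then show ?case
      unfolding s by eventually_elim (use F(3) continuous_map_path in blast)
  qed
qed

lemma path_zero_collapse:
  assumes h: "horizontal F0 F1 F2 F3" and li: "lin_indep4 F0 F1 F2 F3"
  shows "path 0 \<in> subtopology (compact_open_topology riemann_sphere_topology proj_topology) (HHol 3)
            closure_of {g \<in> HHol 3. full g}"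
  unfolding in_closure_of
proof (intro conjI allI impI)
  have HHol: "path t \<in> HHol 3" for t
  proof -
    have "coprime4 F0 (smult t F1) F2 (smult t F3)"
      using cubic_pairD(1)[OF pair] unfolding coprime4_def by (meson coprime_common_divisor)
    moreover have "horizontal F0 (smult t F1) F2 (smult t F3)"
    proof -
      have "wronskian F0 (smult t F1) + wronskian F2 (smult t F3) = smult t (wronskian F0 F1 + wronskian F2 F3)"
        by (simp add: wronskian_def pderiv_smult smult_add_right smult_diff_right)
      then show ?thesis using h by (simp add: horizontal_wronskian)
    qed
    ultimately show ?thesis unfolding HHol_def path_def using max_degree_path by blast
  qed
  \<comment> \<open>The subbasic set belonging to the empty compact set contains all continuous maps
    and so places \<open>path 0\<close> in the underlying space.\<close>
  have "path 0 \<in> {f. continuous_map riemann_sphere_topology proj_topology f \<and> f ` {} \<subseteq> topspace proj_topology}"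
    using continuous_map_path by simp
  then have top: "path 0 \<in> topspace (compact_open_topology riemann_sphere_topology proj_topology)"
    unfolding compact_open_topology_def topology_generated_by_topspace
    by (rule UnionI[rotated]) (auto intro!: exI[of _ "{}"] exI[of _ "topspace proj_topology"])
  then show "path 0 \<in> topspace (subtopology (compact_open_topology riemann_sphere_topology proj_topology) (HHol 3))"
    using HHol by (simp add: topspace_subtopology)
  fix T assume T: "path 0 \<in> T \<and> openin (subtopology (compact_open_topology riemann_sphere_topology proj_topology) (HHol 3)) T"
  then obtain T' where T': "openin (compact_open_topology riemann_sphere_topology proj_topology) T'" "T = T' \<inter> HHol 3"
    by (auto simp: openin_subtopology)
  have "\<forall>\<^sub>F t in nhds 0. path t \<in> T'" using path_compact_open[OF T'(1)] T T'(2) by blast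
  then obtain S where S: "open S" "0 \<in> S" "\<And>t. t \<in> S \<Longrightarrow> path t \<in> T'" unfolding eventually_nhds by blast
  obtain e where e: "e > 0" "ball 0 e \<subseteq> S" using S openE by blast
  define t where "t = complex_of_real (e / 2)"
  have t: "t \<noteq> 0" "t \<in> S" using e by (auto simp: t_def)
  have "lin_indep4 F0 (smult t F1) F2 (smult t F3)"
    unfolding lin_indep4_def
  proof (intro allI impI)
    fix a b c d assume "smult a F0 + smult b (smult t F1) + smult c F2 + smult d (smult t F3) = 0"
    then have "smult a F0 + smult (b * t) F1 + smult c F2 + smult (d * t) F3 = 0" by simp
    then have "a = 0 \<and> b * t = 0 \<and> c = 0 \<and> d * t = 0" using li unfolding lin_indep4_def by blast
    then show "a = 0 \<and> b = 0 \<and> c = 0 \<and> d = 0" using t by simp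
  qed
  then have "full (path t)" unfolding path_def by (rule full_cp3_map)
  then show "\<exists>y. y \<in> {g \<in> HHol 3. full g} \<and> y \<in> T"
    using HHol S(3)[OF t(2)] T'(2) by blast
qed

end

lemma omega_imp_collapse:
  assumes FG: "cubic_pair F G" and om: "omega F G = 0"
  shows "collapse_point 3 (cp1_map F G)"
proof -
  obtain F1 F3 where 1: "degree F1 \<le> 3" "degree F3 \<le> 3" "horizontal F F1 G F3" "lin_indep4 F F1 G F3"
    using omega_imp_horizontal[OF FG om] by blast
  interpret collapsing_path F F1 G F3 using FG 1 by unfold_locales
  show ?thesis
    unfolding collapse_point_def using FG path_zero_collapse[OF 1(3,4)]
    by (intro exI[of _ F] exI[of _ G]) (simp add: path_def cubic_pair_def)
qed


section \<open>Limits of full horizontal maps\<close>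

definition norm1 :: "complex ^ 4 \<Rightarrow> real" where
  "norm1 v = cmod (v $ 1) + cmod (v $ 2) + cmod (v $ 3) + cmod (v $ 4)"

lemma norm1_scale: "norm1 (k *s v) = cmod k * norm1 v"
  by (simp add: norm1_def norm_mult algebra_simps)

lemma norm1_pos: "v \<noteq> 0 \<Longrightarrow> norm1 v > 0"
  by (auto simp: norm1_def vec_eq_iff forall_4) (smt (verit) norm_ge_zero zero_less_norm_iff)+

definition poly_of_vec :: "complex ^ 4 \<Rightarrow> complex poly" where
  "poly_of_vec v = [:v $ 1, v $ 2, v $ 3, v $ 4:]"

lemma poly_of_coeff_vec: "degree F \<le> 3 \<Longrightarrow> poly_of_vec (coeff_vec F) = F"
  using cubic_coeffs[of F] by (simp add: poly_of_vec_def coeff_vec_def)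

lemma poly_poly_of_vec: "poly (poly_of_vec v) z = v $ 1 + z * v $ 2 + z\<^sup>2 * v $ 3 + z ^ 3 * v $ 4"
  by (simp add: poly_of_vec_def algebra_simps power2_eq_square power3_eq_cube)

text \<open>Homogeneous conditions saying that \<open>[v]\<close> is \<open>\<epsilon>\<close>-close to \<open>[a, 0, b, 0]\<close>.\<close>

definition near :: "real \<Rightarrow> complex \<Rightarrow> complex \<Rightarrow> complex ^ 4 \<Rightarrow> bool" where
  "near \<epsilon> a b v \<longleftrightarrow> cmod (v $ 2) < \<epsilon> * norm1 v \<and> cmod (v $ 4) < \<epsilon> * norm1 v \<and>
     cmod (v $ 1 * b - v $ 3 * a) < \<epsilon> * norm1 v"

lemma near_scale:
  assumes "k \<noteq> 0" shows "near \<epsilon> a b (k *s v) \<longleftrightarrow> near \<epsilon> a b v"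
proof -
  have *: "cmod (k * c) < \<epsilon> * (cmod k * n) \<longleftrightarrow> cmod c < \<epsilon> * n" for c n
    using assms by (simp add: norm_mult mult.left_commute)
  have **: "k * v $ 1 * b - k * v $ 3 * a = k * (v $ 1 * b - v $ 3 * a)" by (simp add: algebra_simps)
  show ?thesis unfolding near_def norm1_scale vector_smult_component ** * ..
qed

definition near_set :: "real \<Rightarrow> complex \<Rightarrow> complex \<Rightarrow> cp3 set" where
  "near_set \<epsilon> a b = {proj_point v | v. v \<noteq> 0 \<and> near \<epsilon> a b v}"

lemma near_set_iff: "v \<noteq> 0 \<Longrightarrow> proj_point v \<in> near_set \<epsilon> a b \<longleftrightarrow> near \<epsilon> a b v"
  unfolding near_set_def
proof safe
  fix w assume "v \<noteq> 0" "proj_point v = proj_point w" "w \<noteq> 0" "near \<epsilon> a b w"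
  then show "near \<epsilon> a b v" by (metis near_scale proj_point_eqD)
qed blast

lemma near_set_proj_point: "proj_point v \<in> near_set \<epsilon> a b \<Longrightarrow> near \<epsilon> a b v"
proof -
  assume *: "proj_point v \<in> near_set \<epsilon> a b"
  then obtain w where "proj_point v = proj_point w" "w \<noteq> 0" unfolding near_set_def by blast
  then obtain k where "w = k *s v" using proj_point_eqD by blast
  then have "v \<noteq> 0" using \<open>w \<noteq> 0\<close> by auto
  then show ?thesis using * near_set_iff by blast
qed

lemma openin_near_set: "openin proj_topology (near_set \<epsilon> a b)"
  unfolding openin_proj_topology
proof
  show "near_set \<epsilon> a b \<subseteq> proj_space" by (auto simp: near_set_def proj_space_def)
  have "{v. v \<noteq> 0 \<and> proj_point v \<in> near_set \<epsilon> a b} = {v. v \<noteq> 0 \<and> near \<epsilon> a b v}"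
    using near_set_iff by blast
  also have "\<dots> = - {0} \<inter> ({v. cmod (v $ 2) < \<epsilon> * norm1 v} \<inter> ({v. cmod (v $ 4) < \<epsilon> * norm1 v} \<inter>
      {v. cmod (v $ 1 * b - v $ 3 * a) < \<epsilon> * norm1 v}))"
    by (auto simp: near_def)
  also have "open \<dots>"
    unfolding norm1_def
    by (intro open_Int open_Collect_less continuous_intros)
  finally show "open {v. v \<noteq> 0 \<and> proj_point v \<in> near_set \<epsilon> a b}" .
qed

text \<open>Full maps approaching [F, 0, G, 0] satisfy \<open>omega G0 G2 = 0\<close>. Their
  normalized coefficient matrices have a convergent subsequence. Closeness at seven points forces
  the second and fourth limit polynomials to vanish and the other two to be proportional to
  \<open>F\<close> and \<open>G\<close>; the equation passes to the limit by continuity.\<close>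

lemma collapse_closure_imp_omega:
  assumes FG: "cubic_pair F G"
    and cl: "cp3_map F 0 G 0 \<in> subtopology (compact_open_topology riemann_sphere_topology proj_topology) (HHol 3)
            closure_of {g \<in> HHol 3. full g}"
  shows "omega F G = 0"
proof -
  note D = cubic_pairD[OF FG]
  let ?T = "compact_open_topology riemann_sphere_topology proj_topology"
  define a where "a i = poly F (of_nat i)" for i :: nat
  define b where "b i = poly G (of_nat i)" for i :: nat
  define q :: "nat \<Rightarrow> riemann_sphere" where "q i = Some (of_nat i)" for i
  \<comment> \<open>Seven points, because \<open>H 1 * G - H 3 * F\<close> in the limit has degree
    at most 6.\<close>
  define near_rows where "near_rows \<epsilon> C \<longleftrightarrow> (\<forall>i<7. near \<epsilon> (a i) (b i)
     (vector [poly (poly_of_vec (C $ 1)) (of_nat i), poly (poly_of_vec (C $ 2)) (of_nat i),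
       poly (poly_of_vec (C $ 3)) (of_nat i), poly (poly_of_vec (C $ 4)) (of_nat i)]))"
    for \<epsilon> and C :: "complex ^ 4 ^ 4"
  interpret collapsing_path F 0 G 0 using FG by unfold_locales simp_all
  have f: "cp3_map F 0 G 0 = path 0" by (simp add: path_def)
  have ex: "\<exists>C :: complex ^ 4 ^ 4. norm C = 1 \<and> omega (poly_of_vec (C $ 1)) (poly_of_vec (C $ 3)) = 0 \<and>
      near_rows \<epsilon> C" if e: "\<epsilon> > 0" for \<epsilon>
  proof -
    define S where "S i = {g. continuous_map riemann_sphere_topology proj_topology g \<and> g ` {q i} \<subseteq> near_set \<epsilon> (a i) (b i)}" for i
    have openS: "openin ?T (S i)" for i
      unfolding compact_open_topology_def S_def
      by (rule topology_generated_by_Basis)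
         (auto intro!: exI[of _ "{q i}"] exI[of _ "near_set \<epsilon> (a i) (b i)"] openin_near_set
           simp: topspace_riemann_sphere)
    have inS: "path 0 \<in> S i" for i
    proof -
      have nz: "a i \<noteq> 0 \<or> b i \<noteq> 0"
        using cubic_pair_hom_eval_nonzero[OF FG, of "q i"] by (simp add: a_def b_def q_def hom_eval_def)
      have "path 0 (q i) = proj_point (vector [a i, 0, b i, 0])"
        by (simp add: path_def cp3_map_def hom_eval_def q_def a_def b_def)
      moreover have "vector [a i, 0, b i, 0] \<noteq> (0 :: complex ^ 4)" using nz by (auto simp: vec_eq_iff forall_4)
      moreover have "near \<epsilon> (a i) (b i) (vector [a i, 0, b i, 0])"
        using norm1_pos[OF calculation(2)] e by (simp add: near_def mult.commute)
      ultimately have "path 0 (q i) \<in> near_set \<epsilon> (a i) (b i)" by (simp add: near_set_iff)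
      then show ?thesis using continuous_map_path by (simp add: S_def)
    qed
    define T where "T = (\<Inter>i\<in>{..<7::nat}. S i)"
    have "openin ?T T" unfolding T_def by (intro openin_INT2) (use openS in \<open>auto simp: lessThan_empty_iff\<close>)
    then have "openin (subtopology ?T (HHol 3)) (T \<inter> HHol 3)" by (auto simp: openin_subtopology)
    moreover have "path 0 \<in> HHol 3" "path 0 \<in> T"
      using cl inS unfolding f in_closure_of T_def by (auto simp: topspace_subtopology)
    ultimately obtain g where g: "g \<in> HHol 3" "full g" "g \<in> T"
      using cl unfolding f in_closure_of by (metis (mono_tags, lifting) IntD1 IntI mem_Collect_eq)
    obtain G0 G1 G2 G3 where gG: "g = cp3_map G0 G1 G2 G3" and md: "max_degree4 G0 G1 G2 G3 = 3"
      and h: "horizontal G0 G1 G2 G3"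
      using g(1) unfolding HHol_def by auto
    note deg = max_degree4_bounds[OF md]
    have om: "omega G0 G2 = 0"
    \<comment> \<open>If \<open>omega G0 G2\<close> were nonzero, the horizontal relation could be
      solved for \<open>G1\<close>, contradicting fullness.\<close>
    proof (rule ccontr)
      assume nz: "omega G0 G2 \<noteq> 0"
      obtain c where c: "smult (omega G0 G2) G1 = smult (omega G1 G2) G0 + smult c G2"
        using horizontal_relation[OF deg h] by blast
      have "G1 = smult (inverse (omega G0 G2)) (smult (omega G0 G2) G1)" using nz by simp
      also have "\<dots> = smult (inverse (omega G0 G2) * omega G1 G2) G0 + smult (inverse (omega G0 G2) * c) G2"
        unfolding c by (simp add: smult_add_right)
      finally show False using full_not_in_span g(2) unfolding gG by blast
    qed
    define C :: "complex ^ 4 ^ 4" where "C = vector [coeff_vec G0, coeff_vec G1, coeff_vec G2, coeff_vec G3]"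
    have rows: "poly_of_vec (C $ 1) = G0" "poly_of_vec (C $ 2) = G1" "poly_of_vec (C $ 3) = G2" "poly_of_vec (C $ 4) = G3"
      using deg by (simp_all add: C_def poly_of_coeff_vec)
    have C0: "C \<noteq> 0"
    proof
      assume "C = 0"
      then have "G0 = 0" "G1 = 0" "G2 = 0" "G3 = 0" using rows by (simp_all add: poly_of_vec_def)
      then show False using md by (simp add: max_degree4_def)
    qed
    have nearC: "near_rows \<epsilon> C"
      unfolding near_rows_def rows
    proof (intro allI impI)
      fix i :: nat assume "i < 7"
      then have "g (q i) \<in> near_set \<epsilon> (a i) (b i)" using g(3) by (auto simp: T_def S_def)
      then show "near \<epsilon> (a i) (b i) (vector [poly G0 (of_nat i), poly G1 (of_nat i), poly G2 (of_nat i), poly G3 (of_nat i)])"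
        by (intro near_set_proj_point) (simp add: gG cp3_map_def hom_eval_def q_def)
    qed
    \<comment> \<open>Scaling to norm 1 changes neither the projective points nor
      \<open>near_rows\<close>, and it keeps the limit matrix away from 0.\<close>
    define s where "s = inverse (norm C)"
    have s: "s > 0" using C0 by (simp add: s_def)
    have sc: "poly_of_vec ((s *\<^sub>R C) $ j) = smult (of_real s) (poly_of_vec (C $ j))" for j
      by (simp add: poly_of_vec_def scaleR_conv_of_real[where 'a=complex])
    have "norm (s *\<^sub>R C) = 1" using C0 by (simp add: s_def)
    moreover have "omega (poly_of_vec ((s *\<^sub>R C) $ 1)) (poly_of_vec ((s *\<^sub>R C) $ 3)) = 0"
      unfolding sc omega_smult rows om by simp
    moreover have "near_rows \<epsilon> (s *\<^sub>R C)"
    proof -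
      have v: "vector [of_real s * w, of_real s * x, of_real s * y, of_real s * z] = (of_real s *s vector [w, x, y, z] :: complex ^ 4)" for w x y z
        by (simp add: vec_eq_iff forall_4)
      show ?thesis unfolding near_rows_def sc poly_smult v
        using nearC s near_scale[of "of_real s"] unfolding near_rows_def by simp
    qed
    ultimately show ?thesis by blast
  qed
  have "\<forall>n. \<exists>C :: complex ^ 4 ^ 4. norm C = 1 \<and> omega (poly_of_vec (C $ 1)) (poly_of_vec (C $ 3)) = 0 \<and>
      near_rows (1 / real (Suc n)) C" using ex by simp
  then obtain C :: "nat \<Rightarrow> complex ^ 4 ^ 4" where C: "\<And>n. norm (C n) = 1"
    "\<And>n. omega (poly_of_vec (C n $ 1)) (poly_of_vec (C n $ 3)) = 0" "\<And>n. near_rows (1 / real (Suc n)) (C n)" by metis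
  have "compact (sphere (0 :: complex ^ 4 ^ 4) 1)" by simp
  moreover have "\<forall>n. C n \<in> sphere 0 1" using C(1) by simp
  ultimately obtain L r where L: "L \<in> sphere 0 1" "strict_mono r" "(C \<circ> r) \<longlonglongrightarrow> L"
    unfolding compact_def by metis
  have lim: "(\<lambda>n. C (r n) $ j $ k) \<longlonglongrightarrow> L $ j $ k" for j k
    using L(3) by (intro tendsto_vec_nth) (simp add: comp_def)
  have limp: "(\<lambda>n. poly (poly_of_vec (C (r n) $ j)) z) \<longlonglongrightarrow> poly (poly_of_vec (L $ j)) z" for j z
    unfolding poly_poly_of_vec by (intro tendsto_intros lim)
  define H where "H j = poly_of_vec (L $ j)" for j
  have degH: "degree (H j) \<le> 3" for j by (simp add: H_def poly_of_vec_def)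
  have eps: "(\<lambda>n. 1 / real (Suc (r n))) \<longlonglongrightarrow> 0"
    using LIMSEQ_subseq_LIMSEQ[OF lim_1_over_n[THEN LIMSEQ_Suc] L(2)] by (simp add: comp_def)
  have vals: "poly (H 2) (of_nat i) = 0 \<and> poly (H 4) (of_nat i) = 0 \<and>
     poly (H 1 * G - H 3 * F) (of_nat i) = 0" if i: "i < 7" for i :: nat
  proof -
    define v where "v n = (vector [poly (poly_of_vec (C (r n) $ 1)) (of_nat i), poly (poly_of_vec (C (r n) $ 2)) (of_nat i),
       poly (poly_of_vec (C (r n) $ 3)) (of_nat i), poly (poly_of_vec (C (r n) $ 4)) (of_nat i)] :: complex ^ 4)" for n
    have near: "near (1 / real (Suc (r n))) (a i) (b i) (v n)" for n
      using C(3)[of "r n"] i unfolding near_rows_def v_def by blast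
    have v: "(\<lambda>n. v n $ 1) \<longlonglongrightarrow> poly (H 1) (of_nat i)" "(\<lambda>n. v n $ 2) \<longlonglongrightarrow> poly (H 2) (of_nat i)"
      "(\<lambda>n. v n $ 3) \<longlonglongrightarrow> poly (H 3) (of_nat i)" "(\<lambda>n. v n $ 4) \<longlonglongrightarrow> poly (H 4) (of_nat i)"
      unfolding v_def vector_4 H_def by (rule limp)+
    have rhs: "(\<lambda>n. 1 / real (Suc (r n)) * norm1 (v n)) \<longlonglongrightarrow> 0"
    proof -
      have "(\<lambda>n. 1 / real (Suc (r n)) * norm1 (v n)) \<longlonglongrightarrow> 0 * (cmod (poly (H 1) (of_nat i)) +
         cmod (poly (H 2) (of_nat i)) + cmod (poly (H 3) (of_nat i)) + cmod (poly (H 4) (of_nat i)))"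
        unfolding norm1_def by (intro tendsto_intros eps v)
      then show ?thesis by simp
    qed
    have zero: "l = 0" if "(\<lambda>n. u n) \<longlonglongrightarrow> l" "\<And>n. cmod (u n) < 1 / real (Suc (r n)) * norm1 (v n)" for u and l :: complex
    proof -
      have "u \<longlonglongrightarrow> 0"
        by (rule Lim_null_comparison[OF always_eventually rhs]) (use that(2) less_imp_le in blast)
      then show "l = 0" using that(1) LIMSEQ_unique by blast
    qed
    have "poly (H 2) (of_nat i) = 0" by (rule zero[OF v(2)]) (use near in \<open>simp add: near_def\<close>)
    moreover have "poly (H 4) (of_nat i) = 0" by (rule zero[OF v(4)]) (use near in \<open>simp add: near_def\<close>)
    moreover have "poly (H 1) (of_nat i) * b i - poly (H 3) (of_nat i) * a i = 0"
    proof (rule zero)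
      show "(\<lambda>n. v n $ 1 * b i - v n $ 3 * a i) \<longlonglongrightarrow> poly (H 1) (of_nat i) * b i - poly (H 3) (of_nat i) * a i"
        by (intro tendsto_intros v)
      show "cmod (v n $ 1 * b i - v n $ 3 * a i) < 1 / real (Suc (r n)) * norm1 (v n)" for n
        using near[of n] by (simp add: near_def)
    qed
    ultimately show ?thesis by (simp add: a_def b_def)
  qed
  have H2: "H 2 = 0" "H 4 = 0"
    using vals degH[of 2] degH[of 4] by (auto intro!: poly_eqI_nat[of _ 7])
  have "degree (H 1 * G) \<le> 6" "degree (H 3 * F) \<le> 6"
    using degree_mult_le[of "H 1" G] degree_mult_le[of "H 3" F] degH[of 1] degH[of 3] D(2,3) by linarith+
  then have "H 1 * G - H 3 * F = 0"
    using vals degree_diff_le_max[of "H 1 * G" "H 3 * F"] by (intro poly_eqI_nat[of _ 7]) auto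
  then have "F * H 3 = G * H 1" by (simp add: algebra_simps)
  then obtain k where k: "H 1 = smult k F" "H 3 = smult k G"
    using cubic_pair_proportional[OF FG _ degH[of 1] degH[of 3]] by blast
  have "k \<noteq> 0"
  proof
    assume "k = 0"
    then have "H j = 0" for j :: 4 using k H2 exhaust_4[of j] by auto
    then have "L $ j $ m = 0" for j m
      unfolding H_def poly_of_vec_def using exhaust_4[of m] by auto
    then have "L = 0" by (simp add: vec_eq_iff)
    then show False using L(1) by simp
  qed
  moreover have "omega (H 1) (H 3) = 0"
  proof -
    have om: "omega (poly_of_vec u) (poly_of_vec w) = 3 * u $ 1 * w $ 4 - u $ 2 * w $ 3 + u $ 3 * w $ 2 - 3 * u $ 4 * w $ 1" for u w
      unfolding omega_def poly_of_vec_def coeff_list4 ..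
    have "(\<lambda>n. omega (poly_of_vec (C (r n) $ 1)) (poly_of_vec (C (r n) $ 3))) \<longlonglongrightarrow> omega (H 1) (H 3)"
      unfolding om H_def by (intro tendsto_intros lim)
    then have "(\<lambda>n::nat. 0) \<longlonglongrightarrow> omega (H 1) (H 3)" unfolding C(2) .
    then show ?thesis by (simp add: LIMSEQ_const_iff)
  qed
  ultimately show ?thesis using k by (simp add: omega_smult)
qed

text \<open>The definition of a collapse point speaks of some pair representing the map, which may
  differ from \<open>F\<close>, \<open>G\<close> by a common factor.\<close>

lemma collapse_imp_omega:
  assumes FG: "cubic_pair F G" and cp: "collapse_point 3 (cp1_map F G)"
  shows "omega F G = 0"
proof -
  obtain F' G' where 1: "cubic_pair F' G'" "cp1_map F G = cp1_map F' G'"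
    "cp3_map F' 0 G' 0 \<in> subtopology (compact_open_topology riemann_sphere_topology proj_topology) (HHol 3)
            closure_of {g \<in> HHol 3. full g}"
    using cp unfolding collapse_point_def cubic_pair_def by blast
  have "cp1_map F' G' (Some z) = cp1_point (poly F z) (poly G z)" for z
    unfolding 1(2)[symmetric] cp1_map_cubic[OF FG] by (simp add: hom_eval_def)
  then obtain k where k: "F = smult k F'" "G = smult k G'"
    using cp1_map_eq_imp[OF 1(1) cubic_pairD(2,3)[OF FG]] by blast
  then show ?thesis using collapse_closure_imp_omega[OF 1(1,3)] by (simp add: omega_smult)
qed


section \<open>Calculus on the unit sphere\<close>

text \<open>On the sphere y equals ((3 - |y|^2) / 2) y, and the differential of the latter is the
  orthogonal projection to the tangent plane. Composing with it normalizes any derivative within the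
  sphere to one that annihilates the normal.\<close>

lemma tangential_identity:
  fixes x :: "real ^ 3"
  assumes x: "x \<in> unit_sphere"
  shows "((\<lambda>y. y) has_derivative (\<lambda>h. h - (x \<bullet> h) *\<^sub>R x)) (at x within unit_sphere)"
proof -
  have xx: "x \<bullet> x = 1" using x by (simp add: dot_square_norm)
  have "((\<lambda>y. ((3 - y \<bullet> y) / 2) *\<^sub>R y) has_derivative (\<lambda>h. h - (x \<bullet> h) *\<^sub>R x)) (at x within unit_sphere)"
    by (auto intro!: derivative_eq_intros simp: xx inner_commute algebra_simps)
  then show ?thesis
    by (rule has_derivative_transform[OF x, rotated]) (simp add: dot_square_norm)
qed

text \<open>Great circles through \<open>x\<close> determine the derivative in all tangent
  directions; the normal direction is fixed by the condition at \<open>x\<close>.\<close>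

lemma sphere_deriv_unique:
  fixes X :: "real ^ 3 \<Rightarrow> 'b::real_normed_vector"
  assumes x: "x \<in> unit_sphere"
    and D: "(X has_derivative D) (at x within unit_sphere)" "D x = 0"
    and D': "(X has_derivative D') (at x within unit_sphere)" "D' x = 0"
  shows "D = D'"
proof
  fix h
  interpret D: bounded_linear D using D(1) by (rule has_derivative_bounded_linear)
  interpret D': bounded_linear D' using D'(1) by (rule has_derivative_bounded_linear)
  have xx: "x \<bullet> x = 1" using x by (simp add: dot_square_norm)
  have tang: "D e = D' e" if e: "e \<bullet> e = 1" "x \<bullet> e = 0" for e
  proof -
    define \<gamma> where "\<gamma> t = cos t *\<^sub>R x + sin t *\<^sub>R e" for t :: real
    have "\<gamma> t \<bullet> \<gamma> t = (cos t)\<^sup>2 + (sin t)\<^sup>2" for t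
      using e xx by (simp add: \<gamma>_def inner_add_left inner_add_right inner_commute power2_eq_square)
    then have on: "\<gamma> ` UNIV \<subseteq> unit_sphere" by (auto simp: norm_eq_sqrt_inner)
    have \<gamma>0: "\<gamma> 0 = x" by (simp add: \<gamma>_def)
    have d\<gamma>: "(\<gamma> has_derivative (\<lambda>t. t *\<^sub>R e)) (at 0)"
      unfolding \<gamma>_def by (auto intro!: derivative_eq_intros)
    have "((\<lambda>t. X (\<gamma> t)) has_derivative (\<lambda>t. E (t *\<^sub>R e))) (at 0)"
      if "(X has_derivative E) (at x within unit_sphere)" for E
      by (rule has_derivative_in_compose[OF d\<gamma>]) (use has_derivative_subset[OF that on] \<gamma>0 in simp)
    from this[OF D(1)] this[OF D'(1)] have "(\<lambda>t. D (t *\<^sub>R e)) = (\<lambda>t. D' (t *\<^sub>R e))"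
      by (rule has_derivative_unique)
    from fun_cong[OF this, of 1] show ?thesis by simp
  qed
  define h' where "h' = h - (x \<bullet> h) *\<^sub>R x"
  have perp: "x \<bullet> h' = 0" by (simp add: h'_def inner_diff_right xx)
  have "D h' = D' h'"
  proof (cases "h' = 0")
    case True then show ?thesis by (simp add: D.zero D'.zero)
  next
    case False
    then have "norm h' *\<^sub>R (h' /\<^sub>R norm h') = h'" by simp
    moreover have "D (h' /\<^sub>R norm h') = D' (h' /\<^sub>R norm h')"
      using False perp by (intro tang) (simp_all add: dot_square_norm power2_eq_square field_simps)
    ultimately show ?thesis by (metis D.scaleR D'.scaleR)
  qed
  moreover have "h = h' + (x \<bullet> h) *\<^sub>R x" by (simp add: h'_def)
  ultimately show "D h = D' h" using D(2) D'(2) by (metis D.add D.scaleR D'.add D'.scaleR)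
qed

lemma sphere_deriv_eqI:
  assumes "x \<in> unit_sphere" "(X has_derivative D) (at x within unit_sphere)" "D x = 0"
  shows "sphere_deriv X x = D"
  unfolding sphere_deriv_def using assms sphere_deriv_unique[OF assms(1)] by (intro the_equality) blast+

lemma sphere_deriv_works:
  assumes x: "x \<in> unit_sphere" and X: "X differentiable (at x within unit_sphere)"
  shows "(X has_derivative sphere_deriv X x) (at x within unit_sphere)" "sphere_deriv X x x = 0"
proof -
  obtain D where D: "(X has_derivative D) (at x within unit_sphere)" using X by (auto simp: differentiable_def)
  interpret D: bounded_linear D using D by (rule has_derivative_bounded_linear)
  have xx: "x \<bullet> x = 1" using x by (simp add: dot_square_norm)
  have 1: "(X has_derivative (\<lambda>h. D (h - (x \<bullet> h) *\<^sub>R x))) (at x within unit_sphere)"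
    by (rule has_derivative_in_compose[OF tangential_identity[OF x], of X D, simplified]) (rule D)
  have 2: "D (x - (x \<bullet> x) *\<^sub>R x) = 0" by (simp add: xx D.zero)
  have "sphere_deriv X x = (\<lambda>h. D (h - (x \<bullet> h) *\<^sub>R x))" by (rule sphere_deriv_eqI[OF x 1 2])
  then show "(X has_derivative sphere_deriv X x) (at x within unit_sphere)" "sphere_deriv X x x = 0"
    using 1 2 by simp_all
qed

lemma sphere_grad_works:
  assumes x: "x \<in> unit_sphere" and v: "v differentiable (at x within unit_sphere)"
  shows "sphere_deriv v x = (\<lambda>h. sphere_grad v x \<bullet> h)"
    "(v has_derivative (\<lambda>h. sphere_grad v x \<bullet> h)) (at x within unit_sphere)"
    "sphere_grad v x \<bullet> x = 0" "x \<bullet> sphere_grad v x = 0"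
proof -
  note D = sphere_deriv_works[OF x v]
  show *: "sphere_deriv v x = (\<lambda>h. sphere_grad v x \<bullet> h)"
  proof
    fix h
    interpret D: bounded_linear "sphere_deriv v x" using D(1) by (rule has_derivative_bounded_linear)
    have "sphere_deriv v x h = sphere_deriv v x (\<Sum>b\<in>Basis. (h \<bullet> b) *\<^sub>R b)" by (simp add: euclidean_representation)
    also have "\<dots> = (\<Sum>b\<in>Basis. (h \<bullet> b) * sphere_deriv v x b)" by (simp add: D.sum D.scaleR)
    also have "\<dots> = sphere_grad v x \<bullet> h"
      unfolding sphere_grad_def inner_sum_left by (simp add: inner_commute mult.commute)
    finally show "sphere_deriv v x h = sphere_grad v x \<bullet> h" .
  qed
  show "(v has_derivative (\<lambda>h. sphere_grad v x \<bullet> h)) (at x within unit_sphere)" "sphere_grad v x \<bullet> x = 0"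
    "x \<bullet> sphere_grad v x = 0"
    using D inner_commute[of x] unfolding * by simp_all
qed

lemma sphere_grad_eqI:
  assumes x: "x \<in> unit_sphere" and v: "(v has_derivative (\<lambda>h. g \<bullet> h)) (at x within unit_sphere)"
  shows "sphere_grad v x = g - (x \<bullet> g) *\<^sub>R x"
proof -
  have xx: "x \<bullet> x = 1" using x by (simp add: dot_square_norm)
  have "(v has_derivative (\<lambda>h. g \<bullet> (h - (x \<bullet> h) *\<^sub>R x))) (at x within unit_sphere)"
    by (rule has_derivative_in_compose[OF tangential_identity[OF x], of v "\<lambda>h. g \<bullet> h", simplified]) (rule v)
  then have "sphere_deriv v x = (\<lambda>h. g \<bullet> (h - (x \<bullet> h) *\<^sub>R x))"
    by (rule sphere_deriv_eqI[OF x]) (simp add: xx)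
  also have "\<dots> = (\<lambda>h. (g - (x \<bullet> g) *\<^sub>R x) \<bullet> h)"
    by (auto simp: inner_diff_left inner_diff_right inner_commute)
  finally show ?thesis
    unfolding sphere_grad_def by (simp add: euclidean_representation)
qed

lemma sphere_deriv_cong:
  assumes "\<And>x. x \<in> unit_sphere \<Longrightarrow> u x = v x" "x \<in> unit_sphere"
  shows "sphere_deriv u x = sphere_deriv v x"
proof -
  have "(u has_derivative D) (at x within unit_sphere) \<longleftrightarrow> (v has_derivative D) (at x within unit_sphere)" for D
    using assms by (auto intro: has_derivative_transform[OF assms(2), rotated])
  then show ?thesis unfolding sphere_deriv_def by simp
qed

lemma sphere_grad_cong:
  "(\<And>x. x \<in> unit_sphere \<Longrightarrow> u x = v x) \<Longrightarrow> x \<in> unit_sphere \<Longrightarrow> sphere_grad u x = sphere_grad v x"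
  unfolding sphere_grad_def using sphere_deriv_cong[of u v x] by simp

section \<open>Closure properties of the differentiability classes on the sphere\<close>

lemma sphere_Ck_cong:
  assumes "\<And>x. x \<in> unit_sphere \<Longrightarrow> u x = v x" "sphere_Ck k u"
  shows "sphere_Ck k v"
  using assms
proof (induction k arbitrary: u v)
  case 0
  then show ?case using continuous_on_cong[of unit_sphere unit_sphere u v] by simp
next
  case (Suc k)
  have "v differentiable_on unit_sphere"
    unfolding differentiable_on_def differentiable_def
  proof
    fix x assume x: "x \<in> unit_sphere"
    then obtain D where "(u has_derivative D) (at x within unit_sphere)"
      using Suc.prems(2) unfolding sphere_Ck.simps differentiable_on_def differentiable_def by blast
    then have "(v has_derivative D) (at x within unit_sphere)"
      by (rule has_derivative_transform[OF x, rotated]) (simp add: Suc.prems(1))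
    then show "\<exists>D. (v has_derivative D) (at x within unit_sphere)" by blast
  qed
  moreover have "sphere_Ck k (\<lambda>x. sphere_grad v x $ i)" for i
    by (rule Suc.IH[of "\<lambda>x. sphere_grad u x $ i"]) (use Suc.prems sphere_grad_cong[of u v] in auto)
  ultimately show ?case by simp
qed

lemma sphere_Ck_mono: "sphere_Ck (Suc k) v \<Longrightarrow> sphere_Ck k v"
proof (induction k arbitrary: v)
  case 0 then show ?case by (simp add: differentiable_imp_continuous_on)
next
  case (Suc k)
  then show ?case by (metis sphere_Ck.simps(2))
qed

text \<open>Any ambient gradient \<open>g\<close> will do; its tangential part is the gradient on
  the sphere. This is the form in which product and quotient rules enter the inductions
  below.\<close>

lemma sphere_Ck_SucI:
  assumes "\<And>x. x \<in> unit_sphere \<Longrightarrow> (v has_derivative (\<lambda>h. g x \<bullet> h)) (at x within unit_sphere)"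
    and "\<And>i. sphere_Ck k (\<lambda>x. (g x - (x \<bullet> g x) *\<^sub>R x) $ i)"
  shows "sphere_Ck (Suc k) v"
proof -
  have "v differentiable_on unit_sphere" using assms(1) unfolding differentiable_on_def differentiable_def by blast
  moreover have "sphere_Ck k (\<lambda>x. sphere_grad v x $ i)" for i
    by (rule sphere_Ck_cong[OF _ assms(2)[of i]]) (simp add: sphere_grad_eqI[OF _ assms(1)])
  ultimately show ?thesis by simp
qed

lemma sphere_Ck_const: "sphere_Ck k (\<lambda>x. c)"
proof (induction k arbitrary: c)
  case (Suc k)
  have "sphere_Ck k (\<lambda>x. 0 :: real)" by (rule Suc)
  then show ?case by (intro sphere_Ck_SucI[where g="\<lambda>x. 0"]) (auto intro: sphere_Ck_cong[OF _ \<open>sphere_Ck k (\<lambda>x. 0)\<close>])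
qed simp

lemma sphere_Ck_differentiable:
  "sphere_Ck (Suc k) v \<Longrightarrow> x \<in> unit_sphere \<Longrightarrow> v differentiable (at x within unit_sphere)"
  by (simp add: differentiable_on_def)

lemma sphere_Ck_add: "sphere_Ck k u \<Longrightarrow> sphere_Ck k v \<Longrightarrow> sphere_Ck k (\<lambda>x. u x + v x)"
proof (induction k arbitrary: u v)
  case 0 then show ?case by (simp add: continuous_on_add)
next
  case (Suc k)
  note du = sphere_grad_works[OF _ sphere_Ck_differentiable[OF Suc.prems(1)]]
  note dv = sphere_grad_works[OF _ sphere_Ck_differentiable[OF Suc.prems(2)]]
  show ?case
  proof (rule sphere_Ck_SucI[where g="\<lambda>x. sphere_grad u x + sphere_grad v x"])
    fix x assume x: "x \<in> unit_sphere"
    show "((\<lambda>x. u x + v x) has_derivative (\<lambda>h. (sphere_grad u x + sphere_grad v x) \<bullet> h)) (at x within unit_sphere)"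
      unfolding inner_add_left by (intro has_derivative_add du(2) dv(2) x)
  next
    fix i
    have "sphere_Ck k (\<lambda>x. sphere_grad u x $ i + sphere_grad v x $ i)" by (rule Suc.IH) (use Suc.prems in auto)
    then show "sphere_Ck k (\<lambda>x. (sphere_grad u x + sphere_grad v x - (x \<bullet> (sphere_grad u x + sphere_grad v x)) *\<^sub>R x) $ i)"
      by (rule sphere_Ck_cong[rotated]) (simp add: inner_add_right du(4) dv(4))
  qed
qed

lemma sphere_Ck_mult: "sphere_Ck k u \<Longrightarrow> sphere_Ck k v \<Longrightarrow> sphere_Ck k (\<lambda>x. u x * v x)"
proof (induction k arbitrary: u v)
  case 0 then show ?case by (simp add: continuous_on_mult)
next
  case (Suc k)
  note du = sphere_grad_works[OF _ sphere_Ck_differentiable[OF Suc.prems(1)]]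
  note dv = sphere_grad_works[OF _ sphere_Ck_differentiable[OF Suc.prems(2)]]
  let ?g = "\<lambda>x. u x *\<^sub>R sphere_grad v x + v x *\<^sub>R sphere_grad u x"
  show ?case
  proof (rule sphere_Ck_SucI[where g="?g"])
    fix x assume x: "x \<in> unit_sphere"
    show "((\<lambda>x. u x * v x) has_derivative (\<lambda>h. ?g x \<bullet> h)) (at x within unit_sphere)"
      by (rule has_derivative_eq_rhs[OF has_derivative_mult[OF du(2)[OF x x] dv(2)[OF x x]]])
         (auto simp: inner_add_left algebra_simps)
  next
    fix i
    have "sphere_Ck k u" "sphere_Ck k v" using Suc.prems by (auto intro: sphere_Ck_mono simp del: sphere_Ck.simps)
    then have "sphere_Ck k (\<lambda>x. u x * (sphere_grad v x $ i) + v x * (sphere_grad u x $ i))"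
      by (intro sphere_Ck_add Suc.IH) (use Suc.prems in auto)
    then show "sphere_Ck k (\<lambda>x. (?g x - (x \<bullet> ?g x) *\<^sub>R x) $ i)"
      by (rule sphere_Ck_cong[rotated]) (simp add: inner_add_right du(4) dv(4))
  qed
qed

lemma sphere_Ck_inverse:
  "sphere_Ck k u \<Longrightarrow> (\<And>x. x \<in> unit_sphere \<Longrightarrow> u x \<noteq> 0) \<Longrightarrow> sphere_Ck k (\<lambda>x. inverse (u x))"
proof (induction k arbitrary: u)
  case 0 then show ?case by (simp add: continuous_on_inverse)
next
  case (Suc k)
  note du = sphere_grad_works[OF _ sphere_Ck_differentiable[OF Suc.prems(1)]]
  let ?g = "\<lambda>x. - (inverse (u x) * inverse (u x)) *\<^sub>R sphere_grad u x"
  show ?case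
  proof (rule sphere_Ck_SucI[where g="?g"])
    fix x assume x: "x \<in> unit_sphere"
    show "((\<lambda>x. inverse (u x)) has_derivative (\<lambda>h. ?g x \<bullet> h)) (at x within unit_sphere)"
      by (rule has_derivative_eq_rhs[OF Deriv.has_derivative_inverse[OF Suc.prems(2)[OF x] du(2)[OF x x]]])
         (auto simp: algebra_simps)
  next
    fix i
    have inv: "sphere_Ck k (\<lambda>x. inverse (u x))" by (rule Suc.IH[OF sphere_Ck_mono[OF Suc.prems(1)] Suc.prems(2)])
    have "sphere_Ck k (\<lambda>x. (- 1) * (inverse (u x) * inverse (u x)) * sphere_grad u x $ i)"
      by (intro sphere_Ck_mult sphere_Ck_const inv) (use Suc.prems in auto)
    then show "sphere_Ck k (\<lambda>x. (?g x - (x \<bullet> ?g x) *\<^sub>R x) $ i)"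
      by (rule sphere_Ck_cong[rotated]) (simp add: du(4))
  qed
qed

lemma sphere_Ck_coord: "sphere_Ck k (\<lambda>x. x $ i)"
proof (induction k arbitrary: i)
  case 0 show ?case by (simp add: continuous_on_component)
next
  case (Suc k)
  show ?case
  proof (rule sphere_Ck_SucI[where g="\<lambda>x. axis i 1"])
    show "((\<lambda>x. x $ i) has_derivative (\<lambda>h. axis i 1 \<bullet> h)) (at x within unit_sphere)" for x :: "real ^ 3"
      unfolding inner_axis' using bounded_linear_imp_has_derivative[OF bounded_linear_vec_nth] by simp
    fix j
    have "sphere_Ck k (\<lambda>x. (axis i 1 :: real ^ 3) $ j + (- 1) * (x $ i * x $ j))"
      by (intro sphere_Ck_add sphere_Ck_mult sphere_Ck_const Suc)
    then show "sphere_Ck k (\<lambda>x. (axis i 1 - (x \<bullet> axis i 1) *\<^sub>R x) $ j)"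
      by (rule sphere_Ck_cong[rotated]) (simp add: inner_axis)
  qed
qed

lemma sphere_smooth_intros:
  "sphere_smooth (\<lambda>x. c)" "sphere_smooth (\<lambda>x. x $ i)"
  "sphere_smooth u \<Longrightarrow> sphere_smooth v \<Longrightarrow> sphere_smooth (\<lambda>x. u x + v x)"
  "sphere_smooth u \<Longrightarrow> sphere_smooth v \<Longrightarrow> sphere_smooth (\<lambda>x. u x * v x)"
  "sphere_smooth u \<Longrightarrow> (\<And>x. x \<in> unit_sphere \<Longrightarrow> u x \<noteq> 0) \<Longrightarrow> sphere_smooth (\<lambda>x. inverse (u x))"
  by (simp_all add: sphere_smooth_def sphere_Ck_const sphere_Ck_coord sphere_Ck_add sphere_Ck_mult)
    (metis sphere_Ck_inverse mem_sphere_0)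

lemma sphere_smooth_cong:
  "sphere_smooth u \<Longrightarrow> (\<And>x. x \<in> unit_sphere \<Longrightarrow> u x = v x) \<Longrightarrow> sphere_smooth v"
  unfolding sphere_smooth_def using sphere_Ck_cong by blast

lemma Basis_real3: "(Basis :: (real ^ 3) set) = {axis 1 1, axis 2 1, axis 3 1}"
  by (auto simp: Basis_vec_def) (metis exhaust_3)

lemma sum_Basis_real3: "(\<Sum>b\<in>(Basis :: (real ^ 3) set). f b) = f (axis 1 1) + f (axis 2 1) + f (axis 3 1)"
  unfolding Basis_real3 by (simp add: axis_eq_axis add.assoc)

lemma has_derivative_vec3:
  fixes X :: "'a::real_normed_vector \<Rightarrow> real ^ 3"
  shows "(X has_derivative D) (at x within S) \<longleftrightarrow>
     (\<forall>i. ((\<lambda>y. X y $ i) has_derivative (\<lambda>h. D h $ i)) (at x within S))"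
  unfolding has_derivative_componentwise_within[of X] Basis_real3 forall_3
  by (simp add: inner_axis)

lemma sphere_deriv_components:
  fixes X :: "real ^ 3 \<Rightarrow> real ^ 3"
  assumes x: "x \<in> unit_sphere" and X: "\<And>i. (\<lambda>y. X y $ i) differentiable (at x within unit_sphere)"
  shows "sphere_deriv X x h $ i = sphere_grad (\<lambda>y. X y $ i) x \<bullet> h"
proof -
  have "sphere_deriv X x = (\<lambda>h. \<chi> i. sphere_grad (\<lambda>y. X y $ i) x \<bullet> h)"
    by (rule sphere_deriv_eqI[OF x])
       (use sphere_grad_works[OF x X] in \<open>auto simp: has_derivative_vec3 vec_eq_iff\<close>)
  then show ?thesis by simp
qed

lemma sphere_laplacian_trace:
  assumes x: "x \<in> unit_sphere" and v: "sphere_Ck 2 v"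
  shows "sphere_laplacian v x = - (\<Sum>i\<in>UNIV. sphere_grad (\<lambda>y. sphere_grad v y $ i) x $ i)"
proof -
  have d: "(\<lambda>y. sphere_grad v y $ i) differentiable (at x within unit_sphere)" for i
    using v x by (simp add: numeral_2_eq_2 differentiable_on_def)
  show ?thesis
    unfolding sphere_laplacian_def sphere_div_def sum_Basis_real3 inner_axis
    by (simp add: sphere_deriv_components[OF x d] inner_axis sum_3)
qed

lemma energy_density_grad:
  fixes \<Phi> :: "real ^ 3 \<Rightarrow> real ^ 3"
  assumes x: "x \<in> unit_sphere" and \<Phi>: "\<And>i. (\<lambda>y. \<Phi> y $ i) differentiable (at x within unit_sphere)"
  shows "energy_density \<Phi> x = (\<Sum>i\<in>UNIV. sphere_grad (\<lambda>y. \<Phi> y $ i) x \<bullet> sphere_grad (\<lambda>y. \<Phi> y $ i) x)"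
proof -
  have n: "(norm y)\<^sup>2 = y $ 1 * y $ 1 + y $ 2 * y $ 2 + y $ 3 * y $ 3" for y :: "real ^ 3"
    by (simp add: power2_norm_eq_inner inner_vec_def sum_3)
  have e: "sphere_deriv \<Phi> x (axis j 1) $ i = sphere_grad (\<lambda>y. \<Phi> y $ i) x $ j" for i j
    by (simp add: sphere_deriv_components[OF x \<Phi>] inner_axis)
  show ?thesis
    unfolding energy_density_def sum_Basis_real3 n e sum_3 inner_vec_def by simp
qed


subsection \<open>The stereographic parametrization\<close>

definition stereo :: "complex \<Rightarrow> real ^ 3" where
  "stereo z = to_unit_sphere (Some z)"

definition dstereo :: "complex \<Rightarrow> complex ^ 3" where
  "dstereo z = vector [(1 - (cnj z)\<^sup>2) / (1 + z * cnj z)\<^sup>2, - \<i> * (1 + (cnj z)\<^sup>2) / (1 + z * cnj z)\<^sup>2,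
     2 * cnj z / (1 + z * cnj z)\<^sup>2]"

lemma one_plus_norm: "1 + z * cnj z = of_real (1 + (cmod z)\<^sup>2)"
  unfolding of_real_add of_real_1 complex_norm_square ..

lemma one_plus_nonzero [simp]: "1 + z * cnj z \<noteq> 0"
  unfolding one_plus_norm of_real_eq_0_iff by (smt (verit) zero_le_power2)

lemma stereo_components:
  "stereo z $ 1 = 2 * Re z / (1 + (cmod z)\<^sup>2)" "stereo z $ 2 = 2 * Im z / (1 + (cmod z)\<^sup>2)"
  "stereo z $ 3 = ((cmod z)\<^sup>2 - 1) / (1 + (cmod z)\<^sup>2)"
  by (simp_all add: stereo_def to_unit_sphere_def add.commute)

lemma of_real_stereo:
  "complex_of_real (stereo z $ 1) = (z + cnj z) / (1 + z * cnj z)"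
  "complex_of_real (stereo z $ 2) = - \<i> * (z - cnj z) / (1 + z * cnj z)"
  "complex_of_real (stereo z $ 3) = (z * cnj z - 1) / (1 + z * cnj z)"
proof -
  have "- \<i> * (z - cnj z) = of_real (2 * Im z)" by (simp add: complex_eq_iff)
  then show "complex_of_real (stereo z $ 2) = - \<i> * (z - cnj z) / (1 + z * cnj z)"
    unfolding one_plus_norm stereo_components by simp
  show "complex_of_real (stereo z $ 1) = (z + cnj z) / (1 + z * cnj z)"
    unfolding one_plus_norm stereo_components complex_add_cnj by simp
  have "z * cnj z - 1 = of_real ((cmod z)\<^sup>2 - 1)" unfolding of_real_diff of_real_1 complex_norm_square ..
  then show "complex_of_real (stereo z $ 3) = (z * cnj z - 1) / (1 + z * cnj z)"
    unfolding one_plus_norm stereo_components by simp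
qed

lemma one_plus_pos: "1 + (cmod z)\<^sup>2 > 0"
  by (smt (verit) zero_le_power2)

lemma stereo_in_sphere: "stereo z \<in> unit_sphere"
proof -
  have c: "(cmod z)\<^sup>2 = (Re z)\<^sup>2 + (Im z)\<^sup>2" by (simp add: cmod_power2)
  have "(stereo z $ 1)\<^sup>2 + (stereo z $ 2)\<^sup>2 + (stereo z $ 3)\<^sup>2 =
     ((2 * Re z)\<^sup>2 + (2 * Im z)\<^sup>2 + ((cmod z)\<^sup>2 - 1)\<^sup>2) / (1 + (cmod z)\<^sup>2)\<^sup>2"
    unfolding stereo_components by (simp add: power_divide add_divide_distrib)
  also have "(2 * Re z)\<^sup>2 + (2 * Im z)\<^sup>2 + ((cmod z)\<^sup>2 - 1)\<^sup>2 = (1 + (cmod z)\<^sup>2)\<^sup>2"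
    unfolding c by algebra
  finally have "stereo z \<bullet> stereo z = 1"
    using one_plus_pos[of z] by (simp add: inner_vec_def sum_3 power2_eq_square)
  then show ?thesis by (simp add: norm_eq_sqrt_inner)
qed

lemma of_unit_sphere_stereo: "of_unit_sphere (stereo z) = Some z"
proof -
  have 1: "1 - stereo z $ 3 = 2 / (1 + (cmod z)\<^sup>2)"
    unfolding stereo_components using one_plus_pos[of z] by (simp add: field_simps)
  then have "stereo z $ 3 \<noteq> 1" using one_plus_pos[of z] by (smt (verit) divide_pos_pos)
  moreover have "stereo z $ 1 / (1 - stereo z $ 3) = Re z" "stereo z $ 2 / (1 - stereo z $ 3) = Im z"
    unfolding 1 unfolding stereo_components using one_plus_pos[of z] by (simp_all add: field_simps)
  ultimately show ?thesis by (simp add: of_unit_sphere_def)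
qed

definition north :: "real ^ 3" where "north = vector [0, 0, 1]"

lemma north_in_sphere: "north \<in> unit_sphere"
  by (simp add: north_def norm_eq_sqrt_inner inner_vec_def sum_3)

lemma sphere_cases:
  assumes "x \<in> unit_sphere"
  obtains "x = north" | z where "x = stereo z"
proof (cases "x $ 3 = 1")
  case True
  have "x $ 1 * x $ 1 + x $ 2 * x $ 2 + x $ 3 * x $ 3 = 1"
    using assms by (simp add: norm_eq_sqrt_inner inner_vec_def sum_3)
  then have "x $ 1 * x $ 1 + x $ 2 * x $ 2 = 0" using True by simp
  then have "x $ 1 = 0" "x $ 2 = 0" by (simp_all add: sum_squares_eq_zero_iff)
  then have "x = north" using True by (simp add: north_def vec_eq_iff forall_3)
  then show ?thesis by (rule that(1))
next
  case False
  have s: "(x $ 1)\<^sup>2 + (x $ 2)\<^sup>2 + (x $ 3)\<^sup>2 = 1"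
    using assms by (simp add: norm_eq_sqrt_inner inner_vec_def sum_3 power2_eq_square)
  define d where "d = 1 - x $ 3"
  have d: "d \<noteq> 0" using False by (simp add: d_def)
  define z where "z = Complex (x $ 1 / d) (x $ 2 / d)"
  have "d\<^sup>2 * (cmod z)\<^sup>2 = (x $ 1)\<^sup>2 + (x $ 2)\<^sup>2"
    using d by (simp add: z_def cmod_power2 power_divide field_simps)
  also have "\<dots> = d * (2 - d)" using s unfolding d_def by algebra
  finally have "d * (cmod z)\<^sup>2 = 2 - d" using d by (simp add: power2_eq_square)
  then have n: "1 + (cmod z)\<^sup>2 = 2 / d" "(cmod z)\<^sup>2 - 1 = 2 * x $ 3 / d"
    using d by (simp_all add: field_simps d_def)
  have "x = stereo z"
    unfolding vec_eq_iff forall_3 stereo_components n using d by (simp add: z_def)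
  then show ?thesis by (rule that(2))
qed

lemma sphere_map_stereo: "sphere_map f (stereo z) = to_unit_sphere (f (Some z))"
  by (simp add: sphere_map_def of_unit_sphere_stereo)

lemma sphere_map_north: "sphere_map f north = to_unit_sphere (f None)"
  by (simp add: sphere_map_def of_unit_sphere_def north_def)

lemma stereo_tendsto_north: "(\<lambda>n. stereo (of_nat n)) \<longlonglongrightarrow> north"
proof (rule vec_tendstoI)
  have 0: "(\<lambda>n. inverse (1 + (real n)\<^sup>2)) \<longlonglongrightarrow> 0"
    by (intro tendsto_inverse_0_at_top filterlim_tendsto_add_at_top[OF tendsto_const]
        filterlim_pow_at_top filterlim_real_sequentially) simp
  have 1: "(\<lambda>n. 2 * real n / (1 + (real n)\<^sup>2)) \<longlonglongrightarrow> 0"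
  proof (rule Lim_null_comparison)
    show "\<forall>\<^sub>F n in sequentially. norm (2 * real n / (1 + (real n)\<^sup>2)) \<le> 2 * inverse (real n)"
    proof (rule eventually_sequentiallyI[of 1])
      fix n :: nat assume n: "1 \<le> n"
      have "0 < 1 + (real n)\<^sup>2" by (smt (verit) zero_le_power2)
      then show "norm (2 * real n / (1 + (real n)\<^sup>2)) \<le> 2 * inverse (real n)"
        using n by (simp add: divide_simps power2_eq_square)
    qed
    show "(\<lambda>n. 2 * inverse (real n)) \<longlonglongrightarrow> 0"
      by (rule tendsto_mult_right_zero[OF lim_inverse_n])
  qed
  have 3: "(\<lambda>n. 1 - 2 * inverse (1 + (real n)\<^sup>2)) \<longlonglongrightarrow> 1"
    using tendsto_diff[OF tendsto_const tendsto_mult_left[OF 0, of 2], of 1] by simp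
  have e3: "stereo (of_nat n) $ 3 = 1 - 2 * inverse (1 + (real n)\<^sup>2)" for n
  proof -
    have "1 + (real n)\<^sup>2 \<noteq> 0" by (smt (verit) zero_le_power2)
    then show ?thesis unfolding stereo_components by (simp add: field_simps)
  qed
  fix i :: 3
  have "i = 1 \<or> i = 2 \<or> i = 3" by (rule exhaust_3)
  then show "(\<lambda>n. stereo (of_nat n) $ i) \<longlonglongrightarrow> north $ i"
    using 1 3 by (elim disjE) (simp_all add: north_def e3, simp_all add: stereo_components)
qed

text \<open>The parametrization misses only the north pole, which is a limit of its values.\<close>

lemma continuous_on_sphere_eq:
  fixes u v :: "real ^ 3 \<Rightarrow> 'b::t2_space"
  assumes u: "continuous_on unit_sphere u" and v: "continuous_on unit_sphere v"
    and eq: "\<And>z. u (stereo z) = v (stereo z)" and x: "x \<in> unit_sphere"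
  shows "u x = v x"
  using x
proof (cases rule: sphere_cases)
  case 1
  have "(\<lambda>n. u (stereo (of_nat n))) \<longlonglongrightarrow> u north"
    by (rule continuous_on_tendsto_compose[OF u stereo_tendsto_north north_in_sphere])
      (rule always_eventually, rule allI, rule stereo_in_sphere)
  moreover have "(\<lambda>n. v (stereo (of_nat n))) \<longlonglongrightarrow> v north"
    by (rule continuous_on_tendsto_compose[OF v stereo_tendsto_north north_in_sphere])
      (rule always_eventually, rule allI, rule stereo_in_sphere)
  ultimately show ?thesis unfolding 1 eq by (rule LIMSEQ_unique)
qed (simp add: eq)

lemmas wirtinger_intros = wirtinger_const wirtinger_id wirtinger_add wirtinger_diff wirtinger_mult
  wirtinger_cnj wirtinger_divide

lemma wirtinger_stereo: "wirtinger (\<lambda>z. complex_of_real (stereo z $ k)) z (dstereo z $ k) (cnj (dstereo z $ k))"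
proof -
  have "wirtinger (\<lambda>z. (z + cnj z) / (1 + z * cnj z)) z (dstereo z $ 1) (cnj (dstereo z $ 1))"
    by (rule wirtinger_cong, (rule wirtinger_intros one_plus_nonzero)+)
       (simp_all add: dstereo_def divide_simps power2_eq_square algebra_simps)
  moreover have "wirtinger (\<lambda>z. - \<i> * (z - cnj z) / (1 + z * cnj z)) z (dstereo z $ 2) (cnj (dstereo z $ 2))"
    by (rule wirtinger_cong, (rule wirtinger_intros one_plus_nonzero)+)
       (simp_all add: dstereo_def divide_simps power2_eq_square algebra_simps)
  moreover have "wirtinger (\<lambda>z. (z * cnj z - 1) / (1 + z * cnj z)) z (dstereo z $ 3) (cnj (dstereo z $ 3))"
    by (rule wirtinger_cong, (rule wirtinger_intros one_plus_nonzero)+)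
       (simp_all add: dstereo_def divide_simps power2_eq_square algebra_simps)
  moreover have "k = 1 \<or> k = 2 \<or> k = 3" by (rule exhaust_3)
  ultimately show ?thesis by (elim disjE) (simp_all add: of_real_stereo)
qed

text \<open>The factor in the z-derivative is the Christoffel symbol of the round metric. The mixed
  derivative is a multiple of \<open>stereo z\<close>, hence normal to the sphere, and disappears
  against tangent gradients in \<open>wirtinger_pull_d\<close>.\<close>

lemma wirtinger_dstereo:
  "wirtinger (\<lambda>z. dstereo z $ k) z (- 2 * cnj z / (1 + z * cnj z) * dstereo z $ k)
     (- 2 * of_real (stereo z $ k) / (1 + z * cnj z)\<^sup>2)"
proof -
  have nz: "(1 + z * cnj z)\<^sup>2 \<noteq> 0" by simp
  have alg: "(a * d\<^sup>2 - u * (2 * d * e)) / (d\<^sup>2)\<^sup>2 = (a * d - 2 * u * e) / d ^ 3" if "d \<noteq> 0" for a d u e :: complex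
    using that by (simp add: divide_simps power2_eq_square power3_eq_cube algebra_simps)
  have w: "wirtinger (\<lambda>z. u z / (1 + z * cnj z)\<^sup>2) z ((a * (1 + z * cnj z) - 2 * u z * cnj z) / (1 + z * cnj z) ^ 3)
      ((b * (1 + z * cnj z) - 2 * u z * z) / (1 + z * cnj z) ^ 3)" if "wirtinger u z a b" for u a b
  proof -
    have d: "wirtinger (\<lambda>z. (1 + z * cnj z)\<^sup>2) z (2 * (1 + z * cnj z) * cnj z) (2 * (1 + z * cnj z) * z)"
      unfolding power2_eq_square
      by (rule wirtinger_cong, (rule wirtinger_intros)+) (simp_all add: algebra_simps)
    show ?thesis
      by (rule wirtinger_cong[OF wirtinger_divide[OF that d nz]]) (simp_all only: alg[OF one_plus_nonzero])
  qed
  have p: "wirtinger (\<lambda>z. 1 - (cnj z)\<^sup>2) z 0 (- 2 * cnj z)" "wirtinger (\<lambda>z. - \<i> * (1 + (cnj z)\<^sup>2)) z 0 (- 2 * \<i> * cnj z)"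
    "wirtinger (\<lambda>z. 2 * cnj z) z 0 2"
    unfolding power2_eq_square
    by (rule wirtinger_cong, (rule wirtinger_intros)+; simp)+
  have frac: "x / d ^ 3 = y / d * (v / d\<^sup>2)" if "x = y * v" "d \<noteq> 0" for x y v d :: complex
    using that by (simp add: power2_eq_square power3_eq_cube)
  have frac': "x / d ^ 3 = - 2 * (v / d) / d\<^sup>2" if "x = - 2 * v" "d \<noteq> 0" for x v d :: complex
    using that by (simp add: power2_eq_square power3_eq_cube)
  have "k = 1 \<or> k = 2 \<or> k = 3" by (rule exhaust_3)
  then show ?thesis
  proof (elim disjE)
    assume k: "k = 1"
    show ?thesis unfolding k of_real_stereo unfolding dstereo_def vector_3
      by (rule wirtinger_cong[OF w[OF p(1)]], rule frac[OF _ one_plus_nonzero], algebra, rule frac'[OF _ one_plus_nonzero], algebra)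
  next
    assume k: "k = 2"
    show ?thesis unfolding k of_real_stereo unfolding dstereo_def vector_3
      by (rule wirtinger_cong[OF w[OF p(2)]], rule frac[OF _ one_plus_nonzero], algebra, rule frac'[OF _ one_plus_nonzero], algebra)
  next
    assume k: "k = 3"
    show ?thesis unfolding k of_real_stereo unfolding dstereo_def vector_3
      by (rule wirtinger_cong[OF w[OF p(3)]], rule frac[OF _ one_plus_nonzero], algebra, rule frac'[OF _ one_plus_nonzero], algebra)
  qed
qed

text \<open>Conformality: up to scale, the right-hand side is the matrix of the projection to the
  tangent plane. It converts sums over the ambient basis into Wirtinger expressions.\<close>

lemma dstereo_conformal:
  "dstereo z $ j * cnj (dstereo z $ k) + dstereo z $ k * cnj (dstereo z $ j) =
     2 * ((if j = k then 1 else 0) - of_real (stereo z $ j) * of_real (stereo z $ k)) / (1 + z * cnj z)\<^sup>2"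
proof -
  define w where "w = cnj z"
  define m where "m = 1 / (1 + z * w)"
  have m: "m * (1 + z * w) = 1" using one_plus_nonzero[of z] by (simp add: m_def w_def)
  have cm: "cnj m = m" by (simp add: m_def w_def mult.commute)
  have d: "dstereo z $ 1 = (1 - w\<^sup>2) * m\<^sup>2" "dstereo z $ 2 = - \<i> * (1 + w\<^sup>2) * m\<^sup>2" "dstereo z $ 3 = 2 * w * m\<^sup>2"
    by (simp_all add: dstereo_def w_def m_def power_divide)
  have dc: "cnj (dstereo z $ 1) = (1 - z\<^sup>2) * m\<^sup>2" "cnj (dstereo z $ 2) = \<i> * (1 + z\<^sup>2) * m\<^sup>2"
    "cnj (dstereo z $ 3) = 2 * z * m\<^sup>2"
    unfolding d by (simp_all add: cm) (simp_all add: w_def)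
  have s: "complex_of_real (stereo z $ 1) = (z + w) * m" "complex_of_real (stereo z $ 2) = - \<i> * (z - w) * m"
    "complex_of_real (stereo z $ 3) = (z * w - 1) * m"
    unfolding of_real_stereo by (simp_all add: w_def m_def)
  have M: "X / (1 + z * cnj z)\<^sup>2 = X * m\<^sup>2" for X by (simp add: m_def w_def power_divide)
  have i: "\<i> * \<i> = - 1" by simp
  define \<delta> where "\<delta> j k = (if j = k then 1 else 0 :: complex)" for j k :: 3
  have \<delta>: "\<delta> j j = 1" "\<delta> 1 2 = 0" "\<delta> 1 3 = 0" "\<delta> 2 1 = 0" "\<delta> 2 3 = 0" "\<delta> 3 1 = 0" "\<delta> 3 2 = 0" for j
    by (simp_all add: \<delta>_def)
  define P where "P j k \<longleftrightarrow> dstereo z $ j * cnj (dstereo z $ k) + dstereo z $ k * cnj (dstereo z $ j) =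
     2 * (\<delta> j k - of_real (stereo z $ j) * of_real (stereo z $ k)) * m\<^sup>2" for j k
  have P11: "P 1 1" unfolding P_def dc unfolding d s \<delta> using m i by algebra
  have P12: "P 1 2" unfolding P_def dc unfolding d s \<delta> by (simp add: algebra_simps power2_eq_square)
  have P13: "P 1 3" unfolding P_def dc unfolding d s \<delta> by (simp add: algebra_simps power2_eq_square)
  have P21: "P 2 1" unfolding P_def dc unfolding d s \<delta> by (simp add: algebra_simps power2_eq_square)
  have P22: "P 2 2" unfolding P_def dc unfolding d s \<delta> using m i by algebra
  have P23: "P 2 3" unfolding P_def dc unfolding d s \<delta> by (simp add: algebra_simps power2_eq_square)
  have P31: "P 3 1" unfolding P_def dc unfolding d s \<delta> by (simp add: algebra_simps power2_eq_square)
  have P32: "P 3 2" unfolding P_def dc unfolding d s \<delta> by (simp add: algebra_simps power2_eq_square)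
  have P33: "P 3 3" unfolding P_def dc unfolding d s \<delta> using m i by algebra
  have "j = 1 \<or> j = 2 \<or> j = 3" "k = 1 \<or> k = 2 \<or> k = 3" by (rule exhaust_3)+
  then have "P j k" using P11 P12 P13 P21 P22 P23 P31 P32 P33 by blast
  then show ?thesis unfolding M P_def \<delta>_def .
qed

text \<open>The z-derivative of \<open>v (stereo z)\<close> by the chain rule. Expressing it through
  the gradient allows bounds from compactness of the sphere.\<close>

definition pull_d :: "(real ^ 3 \<Rightarrow> real) \<Rightarrow> complex \<Rightarrow> complex" where
  "pull_d v z = (\<Sum>k\<in>UNIV. of_real (sphere_grad v (stereo z) $ k) * dstereo z $ k)"

lemma wirtinger_pull:
  assumes v: "v differentiable (at (stereo z) within unit_sphere)"
  shows "wirtinger (\<lambda>z. complex_of_real (v (stereo z))) z (pull_d v z) (cnj (pull_d v z))"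
proof -
  note g = sphere_grad_works[OF stereo_in_sphere v]
  have st: "(stereo has_derivative (\<lambda>h. \<chi> k. 2 * Re (dstereo z $ k * h))) (at z)"
    unfolding has_derivative_vec3
  proof
    fix k :: 3
    have "((\<lambda>z. Re (complex_of_real (stereo z $ k))) has_derivative
        (\<lambda>h. Re (dstereo z $ k * h + cnj (dstereo z $ k) * cnj h))) (at z)"
      using wirtinger_stereo[of k z] unfolding wirtinger_def by (rule has_derivative_Re)
    then show "((\<lambda>y. stereo y $ k) has_derivative (\<lambda>h. (\<chi> k. 2 * Re (dstereo z $ k * h)) $ k)) (at z)"
      by (simp add: mult.commute)
  qed
  have "((\<lambda>z. v (stereo z)) has_derivative (\<lambda>h. sphere_grad v (stereo z) \<bullet> (\<chi> k. 2 * Re (dstereo z $ k * h)))) (at z)"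
    by (rule has_derivative_in_compose[OF st])
       (rule has_derivative_subset[OF g(2)], use stereo_in_sphere in blast)
  then have "((\<lambda>z. complex_of_real (v (stereo z))) has_derivative
      (\<lambda>h. of_real (sphere_grad v (stereo z) \<bullet> (\<chi> k. 2 * Re (dstereo z $ k * h))))) (at z)"
    by (rule has_derivative_of_real)
  moreover have "complex_of_real (sphere_grad v (stereo z) \<bullet> (\<chi> k. 2 * Re (dstereo z $ k * h))) =
      pull_d v z * h + cnj (pull_d v z) * cnj h" for h
    by (rule complex_eqI) (simp_all add: pull_d_def inner_vec_def sum_3 algebra_simps)
  ultimately show ?thesis by (simp add: wirtinger_def)
qed

text \<open>The z-derivative of \<open>pull_d v\<close>; the last term is the Christoffel term
  contributed by \<open>dstereo\<close>.\<close>

definition pull_dd :: "(real ^ 3 \<Rightarrow> real) \<Rightarrow> complex \<Rightarrow> complex" where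
  "pull_dd v z = (\<Sum>k\<in>UNIV. pull_d (\<lambda>x. sphere_grad v x $ k) z * dstereo z $ k)
     - 2 * cnj z / (1 + z * cnj z) * pull_d v z"

text \<open>The derivative of \<open>pull_d v\<close> in \<open>cnj z\<close>, that is, a quarter of
  the flat Laplacian of \<open>v\<close> in the chart.\<close>

definition pull_dbar :: "(real ^ 3 \<Rightarrow> real) \<Rightarrow> complex \<Rightarrow> complex" where
  "pull_dbar v z = (\<Sum>k\<in>UNIV. cnj (pull_d (\<lambda>x. sphere_grad v x $ k) z) * dstereo z $ k)"

lemma sphere_Ck_grad: "sphere_Ck (Suc k) v \<Longrightarrow> sphere_Ck k (\<lambda>x. sphere_grad v x $ i)"
  by simp

lemma wirtinger_pull_d:
  assumes v: "sphere_Ck 2 v"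
  shows "wirtinger (pull_d v) z (pull_dd v z) (pull_dbar v z)"
proof -
  have v': "sphere_Ck (Suc (Suc 0)) v" using v by (simp only: numeral_2_eq_2)
  note dv = sphere_Ck_differentiable[OF v' stereo_in_sphere[of z]]
  note dg = sphere_Ck_differentiable[OF sphere_Ck_grad[OF v'] stereo_in_sphere]
  have orth: "(\<Sum>k\<in>UNIV. complex_of_real (sphere_grad v (stereo z) $ k) * of_real (stereo z $ k)) = 0"
  proof -
    have "(\<Sum>k\<in>UNIV. sphere_grad v (stereo z) $ k * stereo z $ k) = 0"
      using sphere_grad_works(3)[OF stereo_in_sphere dv] by (simp add: inner_vec_def)
    then show ?thesis by (metis (no_types, lifting) of_real_0 of_real_mult of_real_sum sum.cong)
  qed
  show ?thesis
    unfolding pull_d_def[of v, abs_def]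
  proof (rule wirtinger_cong[OF wirtinger_sum[OF wirtinger_mult[OF wirtinger_pull[OF dg] wirtinger_dstereo]]])
    show "(\<Sum>k\<in>UNIV. pull_d (\<lambda>x. sphere_grad v x $ k) z * dstereo z $ k + complex_of_real (sphere_grad v (stereo z) $ k) *
       (- 2 * cnj z / (1 + z * cnj z) * dstereo z $ k)) = pull_dd v z"
      unfolding pull_dd_def pull_d_def[of v] by (simp add: sum_3 algebra_simps)
    have "(\<Sum>k\<in>UNIV. complex_of_real (sphere_grad v (stereo z) $ k) * (- 2 * of_real (stereo z $ k) / (1 + z * cnj z)\<^sup>2)) =
      - 2 / (1 + z * cnj z)\<^sup>2 * (\<Sum>k\<in>UNIV. complex_of_real (sphere_grad v (stereo z) $ k) * of_real (stereo z $ k))"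
      by (simp add: sum_distrib_left mult_ac)
    then show "(\<Sum>k\<in>UNIV. cnj (pull_d (\<lambda>x. sphere_grad v x $ k) z) * dstereo z $ k + complex_of_real (sphere_grad v (stereo z) $ k) *
       (- 2 * of_real (stereo z $ k) / (1 + z * cnj z)\<^sup>2)) = pull_dbar v z"
      unfolding pull_dbar_def sum.distrib orth by simp
  qed
qed

text \<open>Conformal invariance of the Laplacian in dimension two. Adding the conjugate makes the
  sum accessible to \<open>dstereo_conformal\<close>, which leaves the trace and a normal term; the
  latter vanishes because the gradients of the components are tangent. That
  \<open>pull_dbar v z\<close> is itself real is shown in
  \<open>eigenfunction_pull_dbar\<close>.\<close>

lemma Re_pull_dbar:
  assumes v: "sphere_Ck 2 v"
  shows "Re (pull_dbar v z) = - sphere_laplacian v (stereo z) / (1 + (cmod z)\<^sup>2)\<^sup>2"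
proof -
  define G where "G k j = complex_of_real (sphere_grad (\<lambda>x. sphere_grad v x $ k) (stereo z) $ j)" for k j
  define S where "S k = complex_of_real (stereo z $ k)" for k
  define s where "s k = dstereo z $ k" for k
  define M where "M = 1 / (1 + z * cnj z)\<^sup>2"
  have v': "sphere_Ck (Suc (Suc 0)) v" using v by (simp only: numeral_2_eq_2)
  note dg = sphere_Ck_differentiable[OF sphere_Ck_grad[OF v'] stereo_in_sphere]
  have orth: "G k 1 * S 1 + G k 2 * S 2 + G k 3 * S 3 = 0" for k
  proof -
    have "sphere_grad (\<lambda>x. sphere_grad v x $ k) (stereo z) \<bullet> stereo z = 0" by (rule sphere_grad_works(3)[OF stereo_in_sphere dg])
    then have "complex_of_real (sphere_grad (\<lambda>x. sphere_grad v x $ k) (stereo z) \<bullet> stereo z) = 0" by simp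
    then show ?thesis by (simp add: G_def S_def inner_vec_def sum_3)
  qed
  have conf: "s j * cnj (s k) + s k * cnj (s j) = 2 * ((if j = k then 1 else 0) - S j * S k) * M" for j k
    using dstereo_conformal[of z j k] by (simp add: s_def S_def M_def)
  have "pull_dbar v z + cnj (pull_dbar v z) = (\<Sum>k\<in>UNIV. \<Sum>j\<in>UNIV. G k j * (s j * cnj (s k) + s k * cnj (s j)))"
    unfolding pull_dbar_def pull_d_def by (simp add: sum_3 G_def s_def algebra_simps)
  also have "\<dots> = 2 * M * (G 1 1 + G 2 2 + G 3 3) - 2 * M * (S 1 * (G 1 1 * S 1 + G 1 2 * S 2 + G 1 3 * S 3)
     + S 2 * (G 2 1 * S 1 + G 2 2 * S 2 + G 2 3 * S 3) + S 3 * (G 3 1 * S 1 + G 3 2 * S 2 + G 3 3 * S 3))"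
    unfolding conf by (simp add: sum_3 algebra_simps)
  also have "\<dots> = 2 * M * (G 1 1 + G 2 2 + G 3 3)" unfolding orth by simp
  also have "\<dots> = of_real (2 * (- sphere_laplacian v (stereo z) / (1 + (cmod z)\<^sup>2)\<^sup>2))"
    unfolding sphere_laplacian_trace[OF stereo_in_sphere v] M_def one_plus_norm G_def sum_3 by simp
  finally have "of_real (2 * Re (pull_dbar v z)) = complex_of_real (2 * (- sphere_laplacian v (stereo z) / (1 + (cmod z)\<^sup>2)\<^sup>2))"
    by (simp add: complex_add_cnj)
  then show ?thesis unfolding of_real_eq_iff by linarith
qed

lemma norm_pull_d:
  assumes v: "v differentiable (at (stereo z) within unit_sphere)"
  shows "(cmod (pull_d v z))\<^sup>2 = (sphere_grad v (stereo z) \<bullet> sphere_grad v (stereo z)) / (1 + (cmod z)\<^sup>2)\<^sup>2"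
proof -
  define G where "G j = complex_of_real (sphere_grad v (stereo z) $ j)" for j
  define S where "S k = complex_of_real (stereo z $ k)" for k
  define s where "s k = dstereo z $ k" for k
  define M where "M = 1 / (1 + z * cnj z)\<^sup>2"
  have orth: "G 1 * S 1 + G 2 * S 2 + G 3 * S 3 = 0"
  proof -
    have "complex_of_real (sphere_grad v (stereo z) \<bullet> stereo z) = 0"
      using sphere_grad_works(3)[OF stereo_in_sphere v] by simp
    then show ?thesis by (simp add: G_def S_def inner_vec_def sum_3)
  qed
  have conf: "s j * cnj (s k) + s k * cnj (s j) = 2 * ((if j = k then 1 else 0) - S j * S k) * M" for j k
    using dstereo_conformal[of z j k] by (simp add: s_def S_def M_def)
  have "2 * (pull_d v z * cnj (pull_d v z)) = (\<Sum>k\<in>UNIV. \<Sum>j\<in>UNIV. G k * G j * (s j * cnj (s k) + s k * cnj (s j)))"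
    unfolding pull_d_def by (simp add: sum_3 G_def s_def algebra_simps)
  also have "\<dots> = 2 * M * (G 1 * G 1 + G 2 * G 2 + G 3 * G 3) - 2 * M * (G 1 * S 1 + G 2 * S 2 + G 3 * S 3)\<^sup>2"
    unfolding conf by (simp add: sum_3 power2_eq_square algebra_simps)
  also have "\<dots> = 2 * of_real ((sphere_grad v (stereo z) \<bullet> sphere_grad v (stereo z)) / (1 + (cmod z)\<^sup>2)\<^sup>2)"
    unfolding orth M_def one_plus_norm by (simp add: G_def inner_vec_def sum_3)
  finally have "complex_of_real ((cmod (pull_d v z))\<^sup>2) = of_real ((sphere_grad v (stereo z) \<bullet> sphere_grad v (stereo z)) / (1 + (cmod z)\<^sup>2)\<^sup>2)"
    by (simp only: complex_norm_square mult_cancel_left) simp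
  then show ?thesis unfolding of_real_eq_iff .
qed

lemma norm_dstereo: "cmod (dstereo z $ k) \<le> 1 / (1 + (cmod z)\<^sup>2)"
proof -
  have n: "cmod (u / (1 + z * cnj z)\<^sup>2) \<le> 1 / (1 + (cmod z)\<^sup>2)" if "cmod u \<le> 1 + (cmod z)\<^sup>2" for u
  proof -
    have "cmod (u / (1 + z * cnj z)\<^sup>2) = cmod u / (1 + (cmod z)\<^sup>2)\<^sup>2"
      unfolding one_plus_norm using one_plus_pos[of z] by (simp add: norm_divide norm_power del: of_real_add)
    also have "\<dots> \<le> (1 + (cmod z)\<^sup>2) / (1 + (cmod z)\<^sup>2)\<^sup>2" using that by (intro divide_right_mono) auto
    also have "\<dots> = 1 / (1 + (cmod z)\<^sup>2)" by (simp add: power2_eq_square)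
    finally show ?thesis .
  qed
  have "cmod (1 - (cnj z)\<^sup>2) \<le> 1 + (cmod z)\<^sup>2"
    using norm_triangle_ineq4[of 1 "(cnj z)\<^sup>2"] by (simp add: norm_power)
  moreover have "cmod (- \<i> * (1 + (cnj z)\<^sup>2)) \<le> 1 + (cmod z)\<^sup>2"
    using norm_triangle_ineq[of 1 "(cnj z)\<^sup>2"] by (simp add: norm_power norm_mult)
  moreover have "cmod (2 * cnj z) \<le> 1 + (cmod z)\<^sup>2"
    using zero_le_power2[of "1 - cmod z"] by (simp add: norm_mult power2_eq_square algebra_simps)
  moreover have "k = 1 \<or> k = 2 \<or> k = 3" by (rule exhaust_3)
  ultimately show ?thesis unfolding dstereo_def using n by (elim disjE) (simp_all only: vector_3)
qed

lemma sphere_continuous_bounded: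
  fixes u :: "real ^ 3 \<Rightarrow> real"
  assumes "continuous_on unit_sphere u"
  obtains B where "B > 0" "\<And>x. x \<in> unit_sphere \<Longrightarrow> \<bar>u x\<bar> \<le> B"
proof -
  have "bounded (u ` unit_sphere)" by (intro compact_imp_bounded compact_continuous_image assms) simp
  then show ?thesis using that unfolding bounded_pos by (metis image_eqI real_norm_def)
qed

text \<open>Regularity at the north pole seen from the chart: the gradient is bounded on the compact
  sphere and \<open>dstereo\<close> decays like |z|^-2.\<close>

lemma pull_d_bound:
  assumes v: "sphere_Ck 1 v"
  obtains B where "B > 0" "\<And>z. cmod (pull_d v z) \<le> B / (1 + (cmod z)\<^sup>2)"
proof -
  have "\<forall>k. \<exists>B>0. \<forall>x\<in>unit_sphere. \<bar>sphere_grad v x $ k\<bar> \<le> B"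
    using v sphere_continuous_bounded by (metis One_nat_def sphere_Ck.simps)
  then obtain B where B: "\<And>k. B k > 0" "\<And>k x. x \<in> unit_sphere \<Longrightarrow> \<bar>sphere_grad v x $ k\<bar> \<le> B k" by metis
  show ?thesis
  proof (rule that[of "\<Sum>k\<in>UNIV. B k"])
    show "(\<Sum>k\<in>UNIV. B k) > 0" by (intro sum_pos B) auto
    fix z
    have "cmod (pull_d v z) \<le> (\<Sum>k\<in>UNIV. cmod (of_real (sphere_grad v (stereo z) $ k) * dstereo z $ k))"
      unfolding pull_d_def by (rule norm_sum)
    also have "\<dots> \<le> (\<Sum>k\<in>UNIV. B k * (1 / (1 + (cmod z)\<^sup>2)))"
      unfolding norm_mult norm_of_real
      by (intro sum_mono mult_mono B(2) stereo_in_sphere norm_dstereo) (use B(1) less_imp_le in auto)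
    finally show "cmod (pull_d v z) \<le> (\<Sum>k\<in>UNIV. B k) / (1 + (cmod z)\<^sup>2)"
      by (simp add: sum_divide_distrib)
  qed
qed

text \<open>Adding back the Christoffel term leaves the covariant second derivative, which has two
  factors \<open>dstereo\<close> and so decays like |z|^-4.\<close>

lemma pull_dd_bound:
  assumes v: "sphere_Ck 2 v"
  obtains B where "B > 0" "\<And>z. cmod (pull_dd v z + 2 * cnj z / (1 + z * cnj z) * pull_d v z) \<le> B / (1 + (cmod z)\<^sup>2)\<^sup>2"
proof -
  have v': "sphere_Ck (Suc 1) v" using v by (simp only: numeral_2_eq_2 One_nat_def)
  have "\<forall>k. \<exists>B>0. \<forall>z. cmod (pull_d (\<lambda>x. sphere_grad v x $ k) z) \<le> B / (1 + (cmod z)\<^sup>2)"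
    using pull_d_bound[OF sphere_Ck_grad[OF v']] by metis
  then obtain B where B: "\<And>k. B k > 0" "\<And>k z. cmod (pull_d (\<lambda>x. sphere_grad v x $ k) z) \<le> B k / (1 + (cmod z)\<^sup>2)" by metis
  show ?thesis
  proof (rule that[of "\<Sum>k\<in>UNIV. B k"])
    show "(\<Sum>k\<in>UNIV. B k) > 0" by (intro sum_pos B) auto
    fix z
    have "cmod (pull_dd v z + 2 * cnj z / (1 + z * cnj z) * pull_d v z) \<le>
       (\<Sum>k\<in>UNIV. cmod (pull_d (\<lambda>x. sphere_grad v x $ k) z * dstereo z $ k))"
      unfolding pull_dd_def by (simp add: norm_sum)
    also have "\<dots> \<le> (\<Sum>k\<in>UNIV. B k / (1 + (cmod z)\<^sup>2) * (1 / (1 + (cmod z)\<^sup>2)))"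
      unfolding norm_mult
      by (intro sum_mono mult_mono B(2) norm_dstereo)
        (auto intro!: divide_nonneg_nonneg less_imp_le[OF B(1)] less_imp_le[OF one_plus_pos])
    also have "\<dots> = (\<Sum>k\<in>UNIV. B k) / (1 + (cmod z)\<^sup>2)\<^sup>2"
      by (simp add: sum_divide_distrib power2_eq_square)
    finally show "cmod (pull_dd v z + 2 * cnj z / (1 + z * cnj z) * pull_d v z) \<le> (\<Sum>k\<in>UNIV. B k) / (1 + (cmod z)\<^sup>2)\<^sup>2" .
  qed
qed


section \<open>The Jacobi equation\<close>

definition csmooth :: "(real ^ 3 \<Rightarrow> complex) \<Rightarrow> bool" where
  "csmooth X \<longleftrightarrow> sphere_smooth (\<lambda>x. Re (X x)) \<and> sphere_smooth (\<lambda>x. Im (X x))"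

lemma sphere_smooth_minus: "sphere_smooth u \<Longrightarrow> sphere_smooth v \<Longrightarrow> sphere_smooth (\<lambda>x. u x - v x)"
  using sphere_smooth_intros(3)[of u "\<lambda>x. (- 1) * v x"] sphere_smooth_intros(4)[OF sphere_smooth_intros(1), of v "- 1"]
  by simp

lemma csmooth_const: "csmooth (\<lambda>x. c)"
  by (simp add: csmooth_def sphere_smooth_intros)

lemma csmooth_add: "csmooth X \<Longrightarrow> csmooth Y \<Longrightarrow> csmooth (\<lambda>x. X x + Y x)"
  by (simp add: csmooth_def sphere_smooth_intros)

lemma csmooth_mult: "csmooth X \<Longrightarrow> csmooth Y \<Longrightarrow> csmooth (\<lambda>x. X x * Y x)"
  by (simp add: csmooth_def sphere_smooth_intros sphere_smooth_minus)

lemma csmooth_power: "csmooth X \<Longrightarrow> csmooth (\<lambda>x. X x ^ n)"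
  by (induction n) (simp_all add: csmooth_const csmooth_mult)

lemma csmooth_sum: "finite I \<Longrightarrow> (\<And>i. i \<in> I \<Longrightarrow> csmooth (X i)) \<Longrightarrow> csmooth (\<lambda>x. \<Sum>i\<in>I. X i x)"
  by (induction I rule: finite_induct) (simp_all add: csmooth_const csmooth_add)

text \<open>The restriction to the sphere of a polynomial in \<open>x\<close> which, in the stereographic coordinate
  \<open>z\<close>, is \<open>z\<^sup>i (cnj z)\<^sup>j / (1 + z cnj z)\<^sup>3\<close>.\<close>

definition bimonomial :: "nat \<Rightarrow> nat \<Rightarrow> real ^ 3 \<Rightarrow> complex" where
  "bimonomial i j x = Complex (x $ 1 / 2) (x $ 2 / 2) ^ (i - j) * Complex (x $ 1 / 2) (- x $ 2 / 2) ^ (j - i) *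
     of_real ((1 + x $ 3) / 2) ^ min i j * of_real ((1 - x $ 3) / 2) ^ (3 - max i j)"

text \<open>The Hermitian product of two cubics over (1 + |z|^2)^3, built from coordinates of the
  sphere so that smoothness at the north pole is automatic.\<close>

definition herm :: "complex poly \<Rightarrow> complex poly \<Rightarrow> real ^ 3 \<Rightarrow> complex" where
  "herm F G x = (\<Sum>i\<le>3. \<Sum>j\<le>3. coeff F i * cnj (coeff G j) * bimonomial i j x)"

lemma csmooth_bimonomial: "csmooth (bimonomial i j)"
proof -
  have half: "sphere_smooth (\<lambda>x. c * x $ k)" for c k by (intro sphere_smooth_intros)
  have 1: "csmooth (\<lambda>x. Complex (x $ 1 / 2) (x $ 2 / 2))" "csmooth (\<lambda>x. Complex (x $ 1 / 2) (- x $ 2 / 2))"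
    using half[of "1 / 2" 1] half[of "1 / 2" 2] half[of "- (1 / 2)" 2] by (simp_all add: csmooth_def)
  have "sphere_smooth (\<lambda>x. 1 / 2 + 1 / 2 * x $ 3)" "sphere_smooth (\<lambda>x. 1 / 2 + (- 1 / 2) * x $ 3)"
    by (intro sphere_smooth_intros)+
  then have 2: "csmooth (\<lambda>x. of_real ((1 + x $ 3) / 2))" "csmooth (\<lambda>x. of_real ((1 - x $ 3) / 2))"
    by (simp_all add: csmooth_def sphere_smooth_intros add_divide_distrib diff_divide_distrib)
  show ?thesis unfolding bimonomial_def[abs_def] by (intro csmooth_mult csmooth_power 1 2)
qed

lemma csmooth_herm: "csmooth (herm F G)"
  unfolding herm_def[abs_def] by (intro csmooth_sum csmooth_mult csmooth_const csmooth_bimonomial) simp_all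

lemma bimonomial_stereo:
  assumes "i \<le> 3" "j \<le> 3"
  shows "bimonomial i j (stereo z) = z ^ i * cnj z ^ j / (1 + z * cnj z) ^ 3"
proof -
  define m where "m = 1 / (1 + z * cnj z)"
  define r where "r = 1 + (cmod z)\<^sup>2"
  have r: "r > 0" unfolding r_def by (rule one_plus_pos)
  have mr: "m = of_real (1 / r)" unfolding m_def one_plus_norm r_def by simp
  have s1: "Complex (stereo z $ 1 / 2) (stereo z $ 2 / 2) = z * m"
    unfolding mr stereo_components r_def[symmetric] by (simp add: complex_eq_iff)
  have s2: "Complex (stereo z $ 1 / 2) (- stereo z $ 2 / 2) = cnj z * m"
    unfolding mr stereo_components r_def[symmetric] by (simp add: complex_eq_iff)
  have s3: "complex_of_real ((1 - stereo z $ 3) / 2) = m"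
  proof -
    have "(1 - stereo z $ 3) / 2 = 1 / r"
      using r unfolding stereo_components r_def[symmetric] by (simp add: field_simps r_def)
    then show ?thesis unfolding mr by simp
  qed
  have s4: "complex_of_real ((1 + stereo z $ 3) / 2) = z * cnj z * m"
  proof -
    have "(1 + stereo z $ 3) / 2 = (cmod z)\<^sup>2 / r"
      using r unfolding stereo_components r_def[symmetric] by (simp add: field_simps r_def)
    then show ?thesis unfolding mr by (simp add: complex_norm_square[symmetric])
  qed
  \<comment> \<open>The exponents of \<open>m\<close> add up to |i - j| + min i j + (3 - max i j) =
    3.\<close>
  have "bimonomial i j (stereo z) = (z * m) ^ (i - j) * (cnj z * m) ^ (j - i) * (z * cnj z * m) ^ min i j * m ^ (3 - max i j)"
    unfolding bimonomial_def s1 s2 s3 s4 ..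
  also have "\<dots> = z ^ i * cnj z ^ j * m ^ 3"
  proof (cases "j \<le> i")
    case True
    then obtain k where k: "i = j + k" by (metis le_add_diff_inverse)
    obtain l where l: "3 = i + l" using assms(1) by (metis le_add_diff_inverse)
    have mm: "min i j = j" "max i j = i" "i - j = k" "j - i = 0" "3 - i = l" using True k l by auto
    show ?thesis unfolding mm unfolding l unfolding k by (simp add: power_add power_mult_distrib algebra_simps)
  next
    case False
    then obtain k where k: "j = i + k" by (metis le_add_diff_inverse nat_le_linear)
    obtain l where l: "3 = j + l" using assms(2) by (metis le_add_diff_inverse)
    have mm: "min i j = i" "max i j = j" "i - j = 0" "j - i = k" "3 - j = l" using False k l by auto
    show ?thesis unfolding mm unfolding l unfolding k by (simp add: power_add power_mult_distrib algebra_simps)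
  qed
  finally show ?thesis by (simp add: m_def power_one_over divide_inverse power_inverse)
qed

lemma bimonomial_north:
  assumes "i \<le> 3" "j \<le> 3"
  shows "bimonomial i j north = (if i = 3 \<and> j = 3 then 1 else 0)"
proof -
  have C0: "Complex 0 0 = 0" by (simp add: complex_eq_iff)
  show ?thesis
    using assms unfolding nat_le_3 by (elim disjE) (simp_all add: bimonomial_def north_def C0)
qed

lemma poly_cubic_sum:
  fixes F :: "complex poly"
  assumes "degree F \<le> 3" shows "poly F z = (\<Sum>i\<le>3. coeff F i * z ^ i)"
  using poly_cubic[OF assms, of z] by (simp add: numeral_eq_Suc)

lemma herm_stereo:
  assumes "degree F \<le> 3" "degree G \<le> 3"
  shows "herm F G (stereo z) = poly F z * cnj (poly G z) / (1 + z * cnj z) ^ 3"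
proof -
  have "herm F G (stereo z) = (\<Sum>i\<le>3. \<Sum>j\<le>3. (coeff F i * z ^ i) * (cnj (coeff G j * z ^ j)) / (1 + z * cnj z) ^ 3)"
    unfolding herm_def by (intro sum.cong refl) (simp add: bimonomial_stereo)
  also have "\<dots> = poly F z * cnj (poly G z) / (1 + z * cnj z) ^ 3"
    unfolding poly_cubic_sum[OF assms(1)] poly_cubic_sum[OF assms(2)] cnj_sum sum_product sum_divide_distrib ..
  finally show ?thesis .
qed

lemma herm_north: "herm F G north = coeff F 3 * cnj (coeff G 3)"
proof -
  have "herm F G north = (\<Sum>i\<le>(3::nat). \<Sum>j\<le>(3::nat). if i = 3 \<and> j = 3 then coeff F 3 * cnj (coeff G 3) else 0)"
    unfolding herm_def by (intro sum.cong refl) (auto simp: bimonomial_north)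
  also have "\<dots> = coeff F 3 * cnj (coeff G 3)" by (simp add: numeral_eq_Suc)
  finally show ?thesis .
qed

lemma to_unit_sphere_cp1_point:
  assumes "u \<noteq> 0 \<or> v \<noteq> 0"
  defines "n \<equiv> (cmod u)\<^sup>2 + (cmod v)\<^sup>2"
  shows "to_unit_sphere (cp1_point u v) $ 1 = 2 * Re (u * cnj v) / n"
    "to_unit_sphere (cp1_point u v) $ 2 = 2 * Im (u * cnj v) / n"
    "to_unit_sphere (cp1_point u v) $ 3 = ((cmod u)\<^sup>2 - (cmod v)\<^sup>2) / n"
proof -
  have "to_unit_sphere (cp1_point u v) $ 1 = 2 * Re (u * cnj v) / n \<and>
    to_unit_sphere (cp1_point u v) $ 2 = 2 * Im (u * cnj v) / n \<and>
    to_unit_sphere (cp1_point u v) $ 3 = ((cmod u)\<^sup>2 - (cmod v)\<^sup>2) / n"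
  proof (cases "v = 0")
    case True
    then show ?thesis using assms(1) by (simp add: cp1_point_def to_unit_sphere_def n_def)
  next
    case False
    define r where "r = (cmod v)\<^sup>2"
    have r: "r > 0" using False by (simp add: r_def)
    have uv: "u / v = u * cnj v / of_real r"
      unfolding r_def complex_norm_square using False by simp
    have c: "(cmod (u / v))\<^sup>2 = (cmod u)\<^sup>2 / r" by (simp add: norm_divide power_divide r_def)
    have n: "n = (cmod u)\<^sup>2 + r" by (simp add: n_def r_def)
    have inv: "1 / ((cmod u)\<^sup>2 / r + 1) = r / n" using r unfolding n by (simp add: field_simps)
    have "Re (u / v) = Re (u * cnj v) / r" "Im (u / v) = Im (u * cnj v) / r"
      unfolding uv by (simp_all only: Re_divide_of_real Im_divide_of_real)
    moreover have "r * ((cmod u)\<^sup>2 / r - 1) = (cmod u)\<^sup>2 - r" using r by (simp add: field_simps)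
    ultimately show ?thesis
      unfolding cp1_point_def if_not_P[OF False] to_unit_sphere_def option.case c inv r_def[symmetric]
      using r by simp
  qed
  then show "to_unit_sphere (cp1_point u v) $ 1 = 2 * Re (u * cnj v) / n"
    "to_unit_sphere (cp1_point u v) $ 2 = 2 * Im (u * cnj v) / n"
    "to_unit_sphere (cp1_point u v) $ 3 = ((cmod u)\<^sup>2 - (cmod v)\<^sup>2) / n" by blast+
qed

section \<open>Functions on the sphere attached to a pair of cubics\<close>

locale cubic_sphere_map =
  fixes F G :: "complex poly"
  assumes pair: "cubic_pair F G"
begin

lemmas deg = cubic_pairD(2,3)[OF pair]

definition W :: "complex poly" where "W = wronskian F G"

text \<open>Real and positive, but kept complex-valued to fit the Wirtinger calculus;
  \<open>Nz\<close> is its z-derivative.\<close>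

definition N :: "complex \<Rightarrow> complex" where
  "N z = poly F z * cnj (poly F z) + poly G z * cnj (poly G z)"

definition Nz :: "complex \<Rightarrow> complex" where
  "Nz z = poly (pderiv F) z * cnj (poly F z) + poly (pderiv G) z * cnj (poly G z)"

abbreviation "\<Phi> \<equiv> sphere_map (cp1_map F G)"

lemma N_real: "N z = of_real ((cmod (poly F z))\<^sup>2 + (cmod (poly G z))\<^sup>2)"
  unfolding N_def of_real_add complex_norm_square ..

lemma N_pos: "(cmod (poly F z))\<^sup>2 + (cmod (poly G z))\<^sup>2 > 0"
proof -
  have "poly F z \<noteq> 0 \<or> poly G z \<noteq> 0"
    using cubic_pair_hom_eval_nonzero[OF pair, of "Some z"] by (simp add: hom_eval_def)
  then show ?thesis by (metis add_nonneg_pos add_pos_nonneg zero_le_power2 zero_less_norm_iff zero_less_power)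
qed

lemma N_nonzero: "N z \<noteq> 0"
  unfolding N_real of_real_eq_0_iff using N_pos[of z] by (rule less_imp_neq[symmetric])

lemma cnj_N: "cnj (N z) = N z"
  by (simp add: N_def mult.commute)

lemma wirtinger_N: "wirtinger N z (Nz z) (cnj (Nz z))"
  unfolding N_def[abs_def]
  by (rule wirtinger_cong, (rule wirtinger_intros wirtinger_poly)+) (simp_all add: Nz_def)

definition hN :: "real ^ 3 \<Rightarrow> real" where "hN x = Re (herm F F x + herm G G x)"

lemma hN_stereo: "complex_of_real (hN (stereo z)) = N z / (1 + z * cnj z) ^ 3"
proof -
  have e: "herm F F (stereo z) + herm G G (stereo z) = N z / (1 + z * cnj z) ^ 3"
    by (simp add: herm_stereo deg N_def add_divide_distrib)
  have "N z / (1 + z * cnj z) ^ 3 \<in> \<real>" unfolding N_real one_plus_norm by (simp add: Reals_divide Reals_power)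
  then show ?thesis unfolding hN_def e by (simp add: of_real_Re)
qed

lemma hN_pos: "x \<in> unit_sphere \<Longrightarrow> hN x \<noteq> 0"
proof (erule sphere_cases)
  assume x: "x = north"
  have "coeff F 3 \<noteq> 0 \<or> coeff G 3 \<noteq> 0"
    using cubic_pair_hom_eval_nonzero[OF pair, of None] by (simp add: hom_eval_def)
  moreover have "hN north = (cmod (coeff F 3))\<^sup>2 + (cmod (coeff G 3))\<^sup>2"
    unfolding hN_def herm_north complex_norm_square[symmetric] by simp
  ultimately show "hN x \<noteq> 0" unfolding x by (auto simp: sum_power2_eq_zero_iff)
next
  fix z assume x: "x = stereo z"
  have "complex_of_real (hN (stereo z)) \<noteq> 0" unfolding hN_stereo using N_nonzero by simp
  then show "hN x \<noteq> 0" unfolding x by simp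
qed

definition jacobi :: "complex poly \<Rightarrow> complex poly \<Rightarrow> real ^ 3 \<Rightarrow> real" where
  "jacobi F1 F3 x = Re (herm F1 G x - herm F3 F x) * inverse (hN x)"

lemma sphere_smooth_hN: "sphere_smooth hN"
  unfolding hN_def[abs_def] using csmooth_add[OF csmooth_herm csmooth_herm] by (simp add: csmooth_def)

lemma sphere_smooth_jacobi: "sphere_smooth (jacobi F1 F3)"
proof -
  have "csmooth (\<lambda>x. herm F1 G x + (- 1) * herm F3 F x)"
    by (intro csmooth_add csmooth_mult csmooth_const csmooth_herm)
  then have "sphere_smooth (\<lambda>x. Re (herm F1 G x - herm F3 F x))" by (simp add: csmooth_def)
  then show ?thesis
    unfolding jacobi_def[abs_def] by (intro sphere_smooth_intros sphere_smooth_hN hN_pos)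
qed

lemma jacobi_stereo:
  assumes "degree F1 \<le> 3" "degree F3 \<le> 3"
  defines "C \<equiv> \<lambda>z. poly F1 z * cnj (poly G z) - poly F3 z * cnj (poly F z)"
  shows "complex_of_real (jacobi F1 F3 (stereo z)) = (C z / N z + cnj (C z / N z)) / 2"
proof -
  define d where "d = (1 + (cmod z)\<^sup>2) ^ 3"
  have d: "d \<noteq> 0" using one_plus_pos[of z] by (simp add: d_def)
  have D: "(1 + z * cnj z) ^ 3 = of_real d" unfolding d_def one_plus_norm by simp
  have 1: "herm F1 G (stereo z) - herm F3 F (stereo z) = C z / of_real d"
    by (simp add: herm_stereo deg assms D C_def diff_divide_distrib)
  have "complex_of_real (jacobi F1 F3 (stereo z)) = of_real (Re (C z / of_real d)) * inverse (N z / of_real d)"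
    unfolding jacobi_def 1 of_real_mult of_real_inverse hN_stereo D ..
  also have "\<dots> = of_real (Re (C z)) / N z" using d by (simp add: Re_divide_of_real)
  also have "\<dots> = (C z / N z + cnj (C z / N z)) / 2"
  proof -
    have "of_real (Re (C z)) = (C z + cnj (C z)) / 2" by (simp add: complex_add_cnj)
    then show ?thesis by (simp add: cnj_N add_divide_distrib mult.commute)
  qed
  finally show ?thesis .
qed

text \<open>The pencil itself supplies the coordinates of the map. Smoothness of the map and its
  formulas in the chart then follow from those for \<open>jacobi\<close>.\<close>

lemma Phi_jacobi:
  assumes x: "x \<in> unit_sphere"
  shows "\<Phi> x $ 1 = jacobi (smult 2 F) 0 x" "\<Phi> x $ 2 = jacobi (smult (- 2 * \<i>) F) 0 x"
    "\<Phi> x $ 3 = jacobi (- G) (- F) x"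
proof -
  \<comment> \<open>One computation for both kinds of points: \<open>e\<close> is evaluation at z or
    extraction of the top coefficient, and \<open>d\<close> is the denominator of
    \<open>herm\<close>.\<close>
  have eq: "\<Phi> x $ 1 = jacobi (smult 2 F) 0 x \<and> \<Phi> x $ 2 = jacobi (smult (- 2 * \<i>) F) 0 x \<and>
    \<Phi> x $ 3 = jacobi (- G) (- F) x"
    if p: "\<Phi> x = to_unit_sphere (cp1_point (e F) (e G))" "e F \<noteq> 0 \<or> e G \<noteq> 0"
      and h: "\<And>P Q. degree P \<le> 3 \<Longrightarrow> degree Q \<le> 3 \<Longrightarrow> herm P Q x = e P * cnj (e Q) / of_real d"
      and e: "\<And>k P. e (smult k P) = k * e P" "\<And>P. e (- P) = - e P" "e 0 = 0"
      and d: "d > 0" for e :: "complex poly \<Rightarrow> complex" and d :: real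
  proof -
    define n where "n = (cmod (e F))\<^sup>2 + (cmod (e G))\<^sup>2"
    have "herm F F x + herm G G x = of_real (n / d)"
      by (simp add: h deg n_def add_divide_distrib complex_norm_square[symmetric])
    then have hn: "hN x = n / d" unfolding hN_def by simp
    have dg: "degree (smult k F) \<le> 3" "degree (- F) \<le> 3" "degree (- G) \<le> 3" for k
      using deg by (auto intro: order_trans[OF degree_smult_le])
    have "herm (- G) G x - herm (- F) F x = of_real (((cmod (e F))\<^sup>2 - (cmod (e G))\<^sup>2) / d)"
      by (simp add: h deg dg e diff_divide_distrib complex_norm_square[symmetric])
    then have 3: "jacobi (- G) (- F) x = ((cmod (e F))\<^sup>2 - (cmod (e G))\<^sup>2) / n"
      unfolding jacobi_def hn using d by simp
    have k: "jacobi (smult k F) 0 x = Re (k * (e F * cnj (e G))) / n" for k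
    proof -
      have "herm (smult k F) G x - herm 0 F x = k * (e F * cnj (e G)) / of_real d"
        by (simp add: h deg dg e)
      then show ?thesis unfolding jacobi_def hn using d by (simp add: Re_divide_of_real)
    qed
    show ?thesis
      unfolding p(1) to_unit_sphere_cp1_point[OF p(2)] n_def[symmetric] 3 k by simp
  qed
  have "\<Phi> x $ 1 = jacobi (smult 2 F) 0 x \<and> \<Phi> x $ 2 = jacobi (smult (- 2 * \<i>) F) 0 x \<and>
    \<Phi> x $ 3 = jacobi (- G) (- F) x"
    using x
  proof (cases rule: sphere_cases)
    case 1
    show ?thesis
      by (rule eq[of "\<lambda>P. coeff P 3" 1])
         (use cubic_pair_hom_eval_nonzero[OF pair, of None] in
           \<open>simp_all add: 1 sphere_map_north cp1_map_cubic[OF pair] hom_eval_def herm_north\<close>)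
  next
    case (2 z)
    show ?thesis
    proof (rule eq[of "\<lambda>P. poly P z" "(1 + (cmod z)\<^sup>2) ^ 3"])
      show "herm P Q x = poly P z * cnj (poly Q z) / complex_of_real ((1 + (cmod z)\<^sup>2) ^ 3)"
        if "degree P \<le> 3" "degree Q \<le> 3" for P Q
        unfolding 2 herm_stereo[OF that] one_plus_norm by simp
      show "(1 + (cmod z)\<^sup>2) ^ 3 > 0" using one_plus_pos by simp
    qed (use cubic_pair_hom_eval_nonzero[OF pair, of "Some z"] in
           \<open>simp_all add: 2 sphere_map_stereo cp1_map_cubic[OF pair] hom_eval_def\<close>)
  qed
  then show "\<Phi> x $ 1 = jacobi (smult 2 F) 0 x" "\<Phi> x $ 2 = jacobi (smult (- 2 * \<i>) F) 0 x"
    "\<Phi> x $ 3 = jacobi (- G) (- F) x" by blast+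
qed

end


lemma pull_d_eqI:
  assumes "sphere_smooth v" "wirtinger (\<lambda>z. complex_of_real (v (stereo z))) z a b"
  shows "pull_d v z = a"
proof -
  have "v differentiable (at (stereo z) within unit_sphere)"
    using assms(1) sphere_Ck_differentiable[OF _ stereo_in_sphere] unfolding sphere_smooth_def by blast
  from wirtinger_unique(1)[OF wirtinger_pull[OF this] assms(2)] show ?thesis .
qed

text \<open>An identity in z and \<open>cnj z\<close> holds with independent variables. Writing z =
  s + i t and w = s - i t with real s, t, one makes first s and then t complex, as a polynomial
  vanishing on the reals is 0.\<close>

lemma polarization:
  fixes A0 A1 A2 A3 B0 B1 B2 B3 :: "complex poly"
  assumes "\<And>z. poly A0 z * poly B0 (cnj z) + poly A1 z * poly B1 (cnj z) + poly A2 z * poly B2 (cnj z) +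
     poly A3 z * poly B3 (cnj z) = 0"
  shows "poly A0 z * poly B0 w + poly A1 z * poly B1 w + poly A2 z * poly B2 w + poly A3 z * poly B3 w = 0"
proof -
  define E where "E z w = poly A0 z * poly B0 w + poly A1 z * poly B1 w + poly A2 z * poly B2 w + poly A3 z * poly B3 w" for z w
  have real_zero: "p = 0" if "\<And>t :: real. poly p (of_real t) = 0" for p :: "complex poly"
  proof (rule ccontr)
    assume "p \<noteq> 0"
    then have "finite {x. poly p x = 0}" by (rule poly_roots_finite)
    moreover have "range complex_of_real \<subseteq> {x. poly p x = 0}" using that by auto
    ultimately have "finite (range complex_of_real)" by (rule rev_finite_subset)
    then have "finite (UNIV :: real set)" by (rule finite_imageD) (simp add: inj_on_def)
    then show False by (simp add: infinite_UNIV_char_0)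
  qed
  have comp: "\<exists>p. \<forall>s. poly p s = E (a * s + b) (c * s + d)" for a b c d
    by (rule exI[of _ "A0 \<circ>\<^sub>p [:b, a:] * B0 \<circ>\<^sub>p [:d, c:] + A1 \<circ>\<^sub>p [:b, a:] * B1 \<circ>\<^sub>p [:d, c:] +
        A2 \<circ>\<^sub>p [:b, a:] * B2 \<circ>\<^sub>p [:d, c:] + A3 \<circ>\<^sub>p [:b, a:] * B3 \<circ>\<^sub>p [:d, c:]"])
       (simp add: E_def poly_pcompose algebra_simps)
  have 0: "E (of_real s + \<i> * of_real t) (of_real s - \<i> * of_real t) = 0" for s t :: real
    using assms[of "of_real s + \<i> * of_real t"] by (simp add: E_def)
  have 1: "E (s + \<i> * of_real t) (s - \<i> * of_real t) = 0" for s and t :: real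
  proof -
    obtain p where p: "\<And>s. poly p s = E (1 * s + \<i> * of_real t) (1 * s + - \<i> * of_real t)" using comp by blast
    have "p = 0" by (rule real_zero) (use 0 in \<open>simp add: p\<close>)
    then show ?thesis using p[of s] by simp
  qed
  have 2: "E (s + \<i> * t) (s - \<i> * t) = 0" for s t
  proof -
    obtain p where p: "\<And>t. poly p t = E (\<i> * t + s) (- \<i> * t + s)" using comp by blast
    have "p = 0" by (rule real_zero) (use 1 in \<open>simp add: p add.commute\<close>)
    then show ?thesis using p[of t] by (simp add: add.commute)
  qed
  have zw: "z = (z + w) / 2 + \<i> * ((z - w) / (2 * \<i>))" "w = (z + w) / 2 - \<i> * ((z - w) / (2 * \<i>))"
    by (simp_all add: field_simps)
  have "E z w = 0" using 2[of "(z + w) / 2" "(z - w) / (2 * \<i>)"] zw by metis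
  then show ?thesis by (simp add: E_def)
qed

context cubic_sphere_map
begin

lemma cnj_W: "cnj (poly W z) = cnj (poly (pderiv F) z) * cnj (poly G z) - cnj (poly F z) * cnj (poly (pderiv G) z)"
  by (simp add: W_def wronskian_def)

lemma poly_W: "poly W z = poly (pderiv F) z * poly G z - poly F z * poly (pderiv G) z"
  by (simp add: W_def wronskian_def)

lemma wirtinger_ratio:
  "wirtinger (\<lambda>z. poly F z * cnj (poly G z) / N z) z (poly W z * (cnj (poly G z))\<^sup>2 / (N z)\<^sup>2)
     (- ((poly F z)\<^sup>2 * cnj (poly W z)) / (N z)\<^sup>2)"
  "wirtinger (\<lambda>z. (poly F z * cnj (poly F z) - poly G z * cnj (poly G z)) / N z) z
     (2 * poly W z * cnj (poly F z) * cnj (poly G z) / (N z)\<^sup>2)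
     (2 * cnj (poly W z) * poly F z * poly G z / (N z)\<^sup>2)"
proof -
  note defs = N_def Nz_def poly_W complex_cnj_zero complex_cnj_diff complex_cnj_add complex_cnj_mult complex_cnj_cnj
  have m: "wirtinger (\<lambda>z. poly P z * cnj (poly Q z)) z (poly (pderiv P) z * cnj (poly Q z)) (poly P z * cnj (poly (pderiv Q) z))" for P Q
    by (rule wirtinger_cong[OF wirtinger_mult[OF wirtinger_poly wirtinger_cnj[OF wirtinger_poly]]]) simp_all
  have e1: "poly (pderiv F) z * cnj (poly G z) * N z - poly F z * cnj (poly G z) * Nz z = poly W z * (cnj (poly G z))\<^sup>2"
    "poly F z * cnj (poly (pderiv G) z) * N z - poly F z * cnj (poly G z) * cnj (Nz z) = - ((poly F z)\<^sup>2 * cnj (poly W z))"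
    unfolding defs by algebra+
  show "wirtinger (\<lambda>z. poly F z * cnj (poly G z) / N z) z (poly W z * (cnj (poly G z))\<^sup>2 / (N z)\<^sup>2)
     (- ((poly F z)\<^sup>2 * cnj (poly W z)) / (N z)\<^sup>2)"
    using wirtinger_divide[OF m[of F G] wirtinger_N N_nonzero] unfolding e1 .
  have e2: "(poly (pderiv F) z * cnj (poly F z) - poly (pderiv G) z * cnj (poly G z)) * N z -
       (poly F z * cnj (poly F z) - poly G z * cnj (poly G z)) * Nz z = 2 * poly W z * cnj (poly F z) * cnj (poly G z)"
    "(poly F z * cnj (poly (pderiv F) z) - poly G z * cnj (poly (pderiv G) z)) * N z -
       (poly F z * cnj (poly F z) - poly G z * cnj (poly G z)) * cnj (Nz z) = 2 * cnj (poly W z) * poly F z * poly G z"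
    unfolding defs by algebra+
  show "wirtinger (\<lambda>z. (poly F z * cnj (poly F z) - poly G z * cnj (poly G z)) / N z) z
     (2 * poly W z * cnj (poly F z) * cnj (poly G z) / (N z)\<^sup>2)
     (2 * cnj (poly W z) * poly F z * poly G z / (N z)\<^sup>2)"
    using wirtinger_divide[OF wirtinger_diff[OF m[of F F] m[of G G]] wirtinger_N N_nonzero] unfolding e2 .
qed

lemma sphere_smooth_Phi: "sphere_smooth (\<lambda>x. \<Phi> x $ k)"
proof -
  have "k = 1 \<or> k = 2 \<or> k = 3" by (rule exhaust_3)
  then show ?thesis
    using sphere_smooth_cong[OF sphere_smooth_jacobi, of "smult 2 F" 0 "\<lambda>x. \<Phi> x $ 1"]
      sphere_smooth_cong[OF sphere_smooth_jacobi, of "smult (- 2 * \<i>) F" 0 "\<lambda>x. \<Phi> x $ 2"]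
      sphere_smooth_cong[OF sphere_smooth_jacobi, of "- G" "- F" "\<lambda>x. \<Phi> x $ 3"] Phi_jacobi
    by (elim disjE) (simp_all del: mem_sphere_0)
qed

lemma degree_trivial: "degree (smult k F) \<le> 3" "degree (- F) \<le> 3" "degree (- G) \<le> 3" "degree (0 :: complex poly) \<le> 3"
  using deg by (auto intro: order_trans[OF degree_smult_le])

lemma Phi_stereo:
  defines "q \<equiv> \<lambda>z. poly F z * cnj (poly G z) / N z"
  shows "complex_of_real (\<Phi> (stereo z) $ 1) = q z + cnj (q z)"
    "complex_of_real (\<Phi> (stereo z) $ 2) = - \<i> * (q z - cnj (q z))"
    "complex_of_real (\<Phi> (stereo z) $ 3) = (poly F z * cnj (poly F z) - poly G z * cnj (poly G z)) / N z"
  unfolding Phi_jacobi[OF stereo_in_sphere] jacobi_stereo[OF degree_trivial(1,4)]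
    jacobi_stereo[OF degree_trivial(3,2)]
  by (simp_all add: q_def cnj_N diff_divide_distrib algebra_simps)

lemma pull_d_Phi:
  "pull_d (\<lambda>x. \<Phi> x $ 1) z = poly W z * ((cnj (poly G z))\<^sup>2 - (cnj (poly F z))\<^sup>2) / (N z)\<^sup>2"
  "pull_d (\<lambda>x. \<Phi> x $ 2) z = - \<i> * poly W z * ((cnj (poly G z))\<^sup>2 + (cnj (poly F z))\<^sup>2) / (N z)\<^sup>2"
  "pull_d (\<lambda>x. \<Phi> x $ 3) z = 2 * poly W z * cnj (poly F z) * cnj (poly G z) / (N z)\<^sup>2"
proof -
  note q = wirtinger_ratio(1)[of z]
  have cq: "cnj (- ((poly F z)\<^sup>2 * cnj (poly W z)) / (N z)\<^sup>2) = - ((cnj (poly F z))\<^sup>2 * poly W z) / (N z)\<^sup>2"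
    by (simp add: cnj_N)
  show "pull_d (\<lambda>x. \<Phi> x $ 1) z = poly W z * ((cnj (poly G z))\<^sup>2 - (cnj (poly F z))\<^sup>2) / (N z)\<^sup>2"
    using pull_d_eqI[OF sphere_smooth_Phi[of 1], unfolded Phi_stereo, OF wirtinger_add[OF q wirtinger_cnj[OF q]]]
    unfolding cq by (simp add: algebra_simps diff_divide_distrib)
  show "pull_d (\<lambda>x. \<Phi> x $ 2) z = - \<i> * poly W z * ((cnj (poly G z))\<^sup>2 + (cnj (poly F z))\<^sup>2) / (N z)\<^sup>2"
  proof -
    have h: "- \<i> * (w * g / d - - (f * w) / d) = - \<i> * w * (g + f) / d" for w g f d
      by (simp add: algebra_simps add_divide_distrib diff_divide_distrib)
    show ?thesis
      using pull_d_eqI[OF sphere_smooth_Phi[of 2], unfolded Phi_stereo, OF wirtinger_cmult[OF wirtinger_diff[OF q wirtinger_cnj[OF q]]]]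
      unfolding cq h .
  qed
  show "pull_d (\<lambda>x. \<Phi> x $ 3) z = 2 * poly W z * cnj (poly F z) * cnj (poly G z) / (N z)\<^sup>2"
    by (rule pull_d_eqI[OF sphere_smooth_Phi[of 3], unfolded Phi_stereo, OF wirtinger_ratio(2)])
qed

lemma sphere_smooth_differentiable:
  "sphere_smooth v \<Longrightarrow> x \<in> unit_sphere \<Longrightarrow> v differentiable (at x within unit_sphere)"
  using sphere_Ck_differentiable unfolding sphere_smooth_def by blast

text \<open>The three squared derivatives combine to a multiple of \<open>(N z)\<^sup>2\<close>.
  What remains is the pull-back of the round metric, |W|^2 / N^2 up to scale, compared with the
  metric of the domain.\<close>

lemma energy_density_stereo:
  "energy_density \<Phi> (stereo z) = 2 * (1 + (cmod z)\<^sup>2)\<^sup>2 * (cmod (poly W z))\<^sup>2 / ((cmod (poly F z))\<^sup>2 + (cmod (poly G z))\<^sup>2)\<^sup>2"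
proof -
  define D where "D = (1 + (cmod z)\<^sup>2)\<^sup>2"
  have D: "D > 0" using one_plus_pos[of z] by (simp add: D_def)
  note d = sphere_smooth_differentiable[OF sphere_smooth_Phi stereo_in_sphere]
  have g: "sphere_grad (\<lambda>x. \<Phi> x $ k) (stereo z) \<bullet> sphere_grad (\<lambda>x. \<Phi> x $ k) (stereo z) = D * (cmod (pull_d (\<lambda>x. \<Phi> x $ k) z))\<^sup>2" for k
    using norm_pull_d[OF d, of k z] D unfolding D_def[symmetric] by (simp add: field_simps)
  have "complex_of_real ((cmod (pull_d (\<lambda>x. \<Phi> x $ 1) z))\<^sup>2 + (cmod (pull_d (\<lambda>x. \<Phi> x $ 2) z))\<^sup>2 + (cmod (pull_d (\<lambda>x. \<Phi> x $ 3) z))\<^sup>2)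
    = 2 * (poly W z * cnj (poly W z)) / (N z)\<^sup>2"
  proof -
    have "complex_of_real ((cmod (pull_d (\<lambda>x. \<Phi> x $ 1) z))\<^sup>2 + (cmod (pull_d (\<lambda>x. \<Phi> x $ 2) z))\<^sup>2 + (cmod (pull_d (\<lambda>x. \<Phi> x $ 3) z))\<^sup>2)
     = (poly W z * cnj (poly W z)) * (((cnj (poly G z))\<^sup>2 - (cnj (poly F z))\<^sup>2) * ((poly G z)\<^sup>2 - (poly F z)\<^sup>2) +
        ((cnj (poly G z))\<^sup>2 + (cnj (poly F z))\<^sup>2) * ((poly G z)\<^sup>2 + (poly F z)\<^sup>2) + 4 * (cnj (poly F z) * poly F z * cnj (poly G z) * poly G z)) / ((N z)\<^sup>2 * (N z)\<^sup>2)"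
      unfolding of_real_add complex_norm_square pull_d_Phi
      by (simp add: cnj_N add_divide_distrib[symmetric] algebra_simps)
    also have "((cnj (poly G z))\<^sup>2 - (cnj (poly F z))\<^sup>2) * ((poly G z)\<^sup>2 - (poly F z)\<^sup>2) +
        ((cnj (poly G z))\<^sup>2 + (cnj (poly F z))\<^sup>2) * ((poly G z)\<^sup>2 + (poly F z)\<^sup>2) + 4 * (cnj (poly F z) * poly F z * cnj (poly G z) * poly G z) = 2 * (N z)\<^sup>2"
      unfolding N_def by algebra
    finally have "complex_of_real ((cmod (pull_d (\<lambda>x. \<Phi> x $ 1) z))\<^sup>2 + (cmod (pull_d (\<lambda>x. \<Phi> x $ 2) z))\<^sup>2 + (cmod (pull_d (\<lambda>x. \<Phi> x $ 3) z))\<^sup>2)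
       = poly W z * cnj (poly W z) * (2 * (N z)\<^sup>2) / ((N z)\<^sup>2 * (N z)\<^sup>2)" .
    moreover have "x * (2 * d) / (d * d) = 2 * x / d" if "d \<noteq> 0" for x d :: complex using that by simp
    ultimately show ?thesis using N_nonzero[of z] by (metis power_not_zero)
  qed
  also have "\<dots> = of_real (2 * (cmod (poly W z))\<^sup>2 / ((cmod (poly F z))\<^sup>2 + (cmod (poly G z))\<^sup>2)\<^sup>2)"
    unfolding complex_norm_square[symmetric] N_real by simp
  finally have "(cmod (pull_d (\<lambda>x. \<Phi> x $ 1) z))\<^sup>2 + (cmod (pull_d (\<lambda>x. \<Phi> x $ 2) z))\<^sup>2 + (cmod (pull_d (\<lambda>x. \<Phi> x $ 3) z))\<^sup>2
     = 2 * (cmod (poly W z))\<^sup>2 / ((cmod (poly F z))\<^sup>2 + (cmod (poly G z))\<^sup>2)\<^sup>2"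
    unfolding of_real_eq_iff .
  then have "D * ((cmod (pull_d (\<lambda>x. \<Phi> x $ 1) z))\<^sup>2 + (cmod (pull_d (\<lambda>x. \<Phi> x $ 2) z))\<^sup>2 + (cmod (pull_d (\<lambda>x. \<Phi> x $ 3) z))\<^sup>2)
     = 2 * D * (cmod (poly W z))\<^sup>2 / ((cmod (poly F z))\<^sup>2 + (cmod (poly G z))\<^sup>2)\<^sup>2" by simp
  then show ?thesis
    unfolding energy_density_grad[OF stereo_in_sphere d] g sum_3 D_def[symmetric] by (simp only: distrib_left)
qed

text \<open>Laplacian and energy density carry the same conformal factor, which cancels; the north
  pole is covered by continuity of both sides.\<close>

lemma eigenfunction_iff_stereo:
  assumes v: "sphere_smooth v"
  shows "eigenfunction (cp1_map F G) v \<longleftrightarrow>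
    (\<forall>z. Re (pull_dbar v z) = - 2 * (cmod (poly W z))\<^sup>2 / ((cmod (poly F z))\<^sup>2 + (cmod (poly G z))\<^sup>2)\<^sup>2 * v (stereo z))"
proof -
  have v2: "sphere_Ck 2 v" using v by (simp only: sphere_smooth_def)
  have pt: "sphere_laplacian v (stereo z) = energy_density \<Phi> (stereo z) * v (stereo z) \<longleftrightarrow>
     Re (pull_dbar v z) = - 2 * (cmod (poly W z))\<^sup>2 / ((cmod (poly F z))\<^sup>2 + (cmod (poly G z))\<^sup>2)\<^sup>2 * v (stereo z)" for z
  proof -
    define D where "D = (1 + (cmod z)\<^sup>2)\<^sup>2"
    have D: "D > 0" using one_plus_pos[of z] by (simp add: D_def)
    show ?thesis
      unfolding Re_pull_dbar[OF v2] energy_density_stereo D_def[symmetric] using D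
      by (auto simp: field_simps)
  qed
  have cl: "continuous_on unit_sphere (sphere_laplacian v)"
  proof -
    have "sphere_Ck (Suc (Suc 0)) v" using v2 by (simp only: numeral_2_eq_2)
    then have "\<forall>i. sphere_Ck 0 (\<lambda>x. sphere_grad (\<lambda>y. sphere_grad v y $ i) x $ i)" by (simp del: sphere_Ck.simps(1))
    then have "continuous_on unit_sphere (\<lambda>x. - (\<Sum>i\<in>UNIV. sphere_grad (\<lambda>y. sphere_grad v y $ i) x $ i))"
      by (intro continuous_on_minus continuous_on_sum) simp
    then show ?thesis by (rule continuous_on_cong[THEN iffD1, rotated -1]) (simp_all add: sphere_laplacian_trace[OF _ v2])
  qed
  have ce: "continuous_on unit_sphere (\<lambda>x. energy_density \<Phi> x * v x)"
  proof -
    have g: "continuous_on unit_sphere (\<lambda>x. sphere_grad (\<lambda>y. \<Phi> y $ k) x $ j)" for k j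
      using sphere_smooth_Phi[of k] unfolding sphere_smooth_def by (metis sphere_Ck.simps)
    have "continuous_on unit_sphere (\<lambda>x. \<Sum>i\<in>UNIV. sphere_grad (\<lambda>y. \<Phi> y $ i) x \<bullet> sphere_grad (\<lambda>y. \<Phi> y $ i) x)"
      unfolding inner_vec_def inner_real_def by (intro continuous_on_sum continuous_on_mult g)
    then have "continuous_on unit_sphere (energy_density \<Phi>)"
      by (rule continuous_on_cong[THEN iffD1, rotated -1])
         (simp_all add: energy_density_grad sphere_smooth_differentiable[OF sphere_smooth_Phi])
    moreover have "continuous_on unit_sphere v" using v unfolding sphere_smooth_def by (metis sphere_Ck.simps(1))
    ultimately show ?thesis by (rule continuous_on_mult)
  qed
  show ?thesis
    unfolding eigenfunction_def pt[symmetric]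
    using v continuous_on_sphere_eq[OF cl ce] stereo_in_sphere by blast
qed

text \<open>Already the complex function u = C / N satisfies the equation: its mixed derivative is
  -2 |W|^2 / N^2 times u. Since the coefficient is real, the real part inherits it.\<close>

lemma eigenfunction_jacobi:
  assumes d: "degree F1 \<le> 3" "degree F3 \<le> 3" and h: "horizontal F F1 G F3"
  shows "eigenfunction (cp1_map F G) (jacobi F1 F3)"
proof -
  define C where "C z = poly F1 z * cnj (poly G z) - poly F3 z * cnj (poly F z)" for z
  define C1 where "C1 z = poly (pderiv F1) z * cnj (poly G z) - poly (pderiv F3) z * cnj (poly F z)" for z
  define S where "S = F * F1 + G * F3"
  define p where "p z = (C1 z * N z - C z * Nz z) / (N z)\<^sup>2" for z
  define r where "r z = - cnj (poly W z) * poly S z / (N z)\<^sup>2" for z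
  define \<kappa> where "\<kappa> z = - 2 * poly W z * cnj (poly W z) * C z / (N z) ^ 3" for z
  have eq: "a / d = b / d" if "a = b" for a b d :: complex using that by simp
  have hz: "poly F1 z * poly (pderiv F) z - poly F z * poly (pderiv F1) z + poly F3 z * poly (pderiv G) z
     - poly G z * poly (pderiv F3) z = 0" for z
    using arg_cong[OF h[unfolded horizontal_def], of "\<lambda>P. poly P z"] by simp
  have wu: "wirtinger (\<lambda>z. C z / N z) z (p z) (r z)" for z
    unfolding C_def p_def r_def C1_def S_def
    by (rule wirtinger_cong, (rule wirtinger_intros wirtinger_poly wirtinger_N N_nonzero)+;
        rule eq; simp only: N_def Nz_def cnj_W complex_cnj_add complex_cnj_mult complex_cnj_cnj complex_cnj_zero poly_add poly_mult; algebra)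
  have wr: "\<exists>b. wirtinger r z (\<kappa> z) b" for z
  proof -
    have N2: "(N z)\<^sup>2 \<noteq> 0" using N_nonzero by simp
    have N2d: "wirtinger (\<lambda>z. (N z)\<^sup>2) z (2 * N z * Nz z) (2 * N z * cnj (Nz z))"
      unfolding power2_eq_square by (rule wirtinger_cong, (rule wirtinger_mult wirtinger_N)+) simp_all
    have cw: "wirtinger (\<lambda>z. - cnj (poly W z)) z 0 (- cnj (poly (pderiv W) z))"
      using wirtinger_cmult[OF wirtinger_cnj[OF wirtinger_poly], of "- 1" W z] by simp
    have "((0 * poly S z + - cnj (poly W z) * poly (pderiv S) z) * (N z)\<^sup>2 - - cnj (poly W z) * poly S z * (2 * N z * Nz z)) / ((N z)\<^sup>2)\<^sup>2 = \<kappa> z"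
    proof -
      \<comment> \<open>The one place where horizontality is used: it replaces the derivatives of
        \<open>F1\<close> and \<open>F3\<close> in the derivative of \<open>S\<close>.\<close>
      have "poly (pderiv S) z * N z - 2 * poly S z * Nz z = 2 * poly W z * C z"
        unfolding S_def N_def Nz_def C_def poly_W pderiv_add pderiv_mult poly_add poly_mult using hz[of z] by algebra
      then have "(0 * poly S z + - cnj (poly W z) * poly (pderiv S) z) * (N z)\<^sup>2 - - cnj (poly W z) * poly S z * (2 * N z * Nz z)
         = - cnj (poly W z) * N z * (2 * poly W z * C z)" by algebra
      then show ?thesis unfolding \<kappa>_def using N_nonzero[of z]
        by (simp add: divide_simps power2_eq_square power3_eq_cube)
    qed
    then show ?thesis
      unfolding r_def[abs_def] using wirtinger_divide[OF wirtinger_mult[OF cw wirtinger_poly[of S]] N2d N2] by metis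
  qed
  have wp: "\<exists>a b. wirtinger p z a b" for z
    unfolding p_def C1_def C_def Nz_def power2_eq_square
    by (intro exI, (rule wirtinger_intros wirtinger_poly wirtinger_N)+) (simp add: N_nonzero)
  \<comment> \<open>The derivative of \<open>p\<close> in \<open>cnj z\<close> is obtained from that
    of \<open>r\<close> in z by equality of mixed derivatives.\<close>
  have wp': "\<exists>a. wirtinger p z a (\<kappa> z)" for z
  proof -
    obtain a b where ab: "wirtinger p z a b" using wp by blast
    obtain b' where b': "wirtinger r z (\<kappa> z) b'" using wr by blast
    have "b = \<kappa> z" by (rule wirtinger_mixed[OF wu ab b'])
    then show ?thesis using ab by blast
  qed
  have jac: "complex_of_real (jacobi F1 F3 (stereo z)) = 1 / 2 * (C z / N z + cnj (C z / N z))" for z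
    unfolding jacobi_stereo[OF d] C_def by simp
  have pd: "pull_d (jacobi F1 F3) z = 1 / 2 * (p z + cnj (r z))" for z
    by (rule pull_d_eqI[OF sphere_smooth_jacobi])
       (unfold jac, rule wirtinger_cmult[OF wirtinger_add[OF wu wirtinger_cnj[OF wu]]])
  have "pull_dbar (jacobi F1 F3) z = 1 / 2 * (\<kappa> z + cnj (\<kappa> z))" for z
  proof -
    obtain a where a: "wirtinger p z a (\<kappa> z)" using wp' by blast
    obtain b where b: "wirtinger r z (\<kappa> z) b" using wr by blast
    have 1: "wirtinger (pull_d (jacobi F1 F3)) z (1 / 2 * (a + cnj b)) (1 / 2 * (\<kappa> z + cnj (\<kappa> z)))"
      unfolding pd[abs_def] by (rule wirtinger_cmult[OF wirtinger_add[OF a wirtinger_cnj[OF b]]])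
    have "sphere_Ck 2 (jacobi F1 F3)" using sphere_smooth_jacobi unfolding sphere_smooth_def by blast
    from wirtinger_unique(2)[OF wirtinger_pull_d[OF this] 1] show ?thesis .
  qed
  then have "Re (pull_dbar (jacobi F1 F3) z) = Re (\<kappa> z)" for z by (simp add: complex_add_cnj)
  moreover have "Re (\<kappa> z) = - 2 * (cmod (poly W z))\<^sup>2 / ((cmod (poly F z))\<^sup>2 + (cmod (poly G z))\<^sup>2)\<^sup>2 * jacobi F1 F3 (stereo z)" for z
  proof -
    have "\<kappa> z = - 2 * (poly W z * cnj (poly W z)) / (N z)\<^sup>2 * (C z / N z)"
      by (simp add: \<kappa>_def power2_eq_square power3_eq_cube)
    also have "- 2 * (poly W z * cnj (poly W z)) / (N z)\<^sup>2 = of_real (- 2 * (cmod (poly W z))\<^sup>2 / ((cmod (poly F z))\<^sup>2 + (cmod (poly G z))\<^sup>2)\<^sup>2)"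
      unfolding complex_norm_square[symmetric] N_real by simp
    finally have "Re (\<kappa> z) = - 2 * (cmod (poly W z))\<^sup>2 / ((cmod (poly F z))\<^sup>2 + (cmod (poly G z))\<^sup>2)\<^sup>2 * Re (C z / N z)"
      by (simp only: times_complex.sel Re_complex_of_real Im_complex_of_real mult_zero_left diff_zero)
    moreover have "complex_of_real (jacobi F1 F3 (stereo z)) = of_real (Re (C z / N z))"
      unfolding jac complex_add_cnj by simp
    ultimately show ?thesis unfolding of_real_eq_iff by simp
  qed
  ultimately show ?thesis unfolding eigenfunction_iff_stereo[OF sphere_smooth_jacobi] by simp
qed

text \<open>A trivial representation is an identity in z and \<open>cnj z\<close>. After
  polarization, each fixed w gives a linear relation between \<open>F\<close>, \<open>F1\<close>,
  \<open>G\<close>, \<open>F3\<close> whose coefficients at \<open>F1\<close> and \<open>F3\<close>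
  are, up to sign, the conjugated cubics at w. Independence makes both vanish for all w, which is
  absurd.\<close>

lemma jacobi_not_trivial:
  assumes d: "degree F1 \<le> 3" "degree F3 \<le> 3" and li: "lin_indep4 F F1 G F3"
  shows "\<not> (\<exists>c1 c2 c3. \<forall>x\<in>unit_sphere. jacobi F1 F3 x = c1 * \<Phi> x $ 1 + c2 * \<Phi> x $ 2 + c3 * \<Phi> x $ 3)"
proof
  assume "\<exists>c1 c2 c3. \<forall>x\<in>unit_sphere. jacobi F1 F3 x = c1 * \<Phi> x $ 1 + c2 * \<Phi> x $ 2 + c3 * \<Phi> x $ 3"
  then obtain c1 c2 c3 where c: "\<And>z. jacobi F1 F3 (stereo z) = c1 * \<Phi> (stereo z) $ 1 + c2 * \<Phi> (stereo z) $ 2 + c3 * \<Phi> (stereo z) $ 3"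
    using stereo_in_sphere by blast
  \<comment> \<open>Multiplying the representation by 2 N, these are the coefficients of F
    \<open>cnj G\<close> and of |F|^2 - |G|^2.\<close>
  define \<alpha> where "\<alpha> = complex_of_real (2 * c1) - \<i> * of_real (2 * c2)"
  define \<beta> where "\<beta> = complex_of_real (2 * c3)"
  define A where "A = F1 - smult \<alpha> F + smult \<beta> G"
  define B where "B = - F3 - smult (cnj \<alpha>) G - smult \<beta> F"
  have E: "poly A z * poly (map_poly cnj G) (cnj z) + poly B z * poly (map_poly cnj F) (cnj z) +
      poly G z * poly (map_poly cnj F1) (cnj z) + poly (- F) z * poly (map_poly cnj F3) (cnj z) = 0" for z
  proof -
    define n where "n = N z"
    have n: "n \<noteq> 0" "cnj n = n" using N_nonzero cnj_N by (simp_all add: n_def)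
    have "2 * n * complex_of_real (jacobi F1 F3 (stereo z)) = 2 * n * (of_real c1 * complex_of_real (\<Phi> (stereo z) $ 1) +
       of_real c2 * complex_of_real (\<Phi> (stereo z) $ 2) + of_real c3 * complex_of_real (\<Phi> (stereo z) $ 3))"
      unfolding c by simp
    then show ?thesis
      unfolding jacobi_stereo[OF d] Phi_stereo poly_cnj[symmetric] n_def[symmetric] A_def B_def \<alpha>_def \<beta>_def
      using n by (simp add: field_simps)
  qed
  have Z: "poly (map_poly cnj F) w = 0 \<and> poly (map_poly cnj G) w = 0" for w
  proof -
    define g where "g = poly (map_poly cnj G) w"
    define f where "f = poly (map_poly cnj F) w"
    define s where "s = poly (map_poly cnj F1) w"
    define t where "t = poly (map_poly cnj F3) w"
    have "poly (smult g A + smult f B + smult s G - smult t F) z = 0" for z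
      using polarization[OF E, of z w] by (simp add: f_def g_def s_def t_def algebra_simps)
    then have "smult g A + smult f B + smult s G - smult t F = 0" using poly_all_0_iff_0 by blast
    moreover have "smult g A + smult f B + smult s G - smult t F =
      smult (- g * \<alpha> - f * \<beta> - t) F + smult g F1 + smult (g * \<beta> - f * cnj \<alpha> + s) G + smult (- f) F3"
      unfolding A_def B_def by (simp add: smult_add_right smult_diff_right smult_add_left smult_diff_left algebra_simps)
    ultimately have "smult (- g * \<alpha> - f * \<beta> - t) F + smult g F1 + smult (g * \<beta> - f * cnj \<alpha> + s) G + smult (- f) F3 = 0"
      by simp
    then have "g = 0" "- f = 0" using li unfolding lin_indep4_def by blast+
    then show ?thesis by (simp add: f_def g_def)
  qed
  have "cnj (poly F 0) = 0" "cnj (poly G 0) = 0" unfolding poly_cnj using Z by blast+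
  then show False using N_pos[of 0] by simp
qed

end

lemma omega_imp_extra_eigenfunction:
  assumes FG: "cubic_pair F G" and om: "omega F G = 0"
  shows "\<exists>v. extra_eigenfunction (cp1_map F G) v"
proof -
  obtain F1 F3 where 1: "degree F1 \<le> 3" "degree F3 \<le> 3" "horizontal F F1 G F3" "lin_indep4 F F1 G F3"
    using omega_imp_horizontal[OF FG om] by blast
  interpret cubic_sphere_map F G using FG by unfold_locales
  show ?thesis
    unfolding extra_eigenfunction_def using eigenfunction_jacobi[OF 1(1-3)] jacobi_not_trivial[OF 1(1,2,4)] by blast
qed


section \<open>Every extra eigenfunction forces \<open>omega\<close> to vanish\<close>

text \<open>The 1-jet (U, A) solves a linear total differential system. On a small disc around a
  zero of the jet, the mean value inequality bounds the maximum of its norm by half of itself, so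
  the zero set is open; it is relatively closed, and \<open>S\<close> is connected.\<close>

lemma wirtinger_ode_unique:
  fixes U A p r :: "complex \<Rightarrow> complex"
  assumes S: "open S" "connected S" and pr: "continuous_on S p" "continuous_on S r"
    and U: "\<And>z. z \<in> S \<Longrightarrow> wirtinger U z (A z) (cnj (A z))"
    and A: "\<And>z. z \<in> S \<Longrightarrow> wirtinger A z (p z * A z) (r z * U z)"
    and z1: "z1 \<in> S" "U z1 = 0" "A z1 = 0" and z: "z \<in> S"
  shows "U z = 0"
proof -
  define Y where "Y z = (U z, A z)" for z
  define D where "D z h = (A z * h + cnj (A z) * cnj h, p z * A z * h + r z * U z * cnj h)" for z h
  have der: "(Y has_derivative D z) (at z)" if "z \<in> S" for z
    using U[OF that] A[OF that] unfolding wirtinger_def Y_def D_def by (rule has_derivative_Pair)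
  have contY: "continuous_on S Y"
    using der by (intro continuous_at_imp_continuous_on) (auto intro: has_derivative_continuous)
  define E where "E = {z \<in> S. Y z = 0}"
  have "open E"
    unfolding open_contains_cball
  proof
    fix z0 assume "z0 \<in> E"
    then have z0: "z0 \<in> S" "Y z0 = 0" by (simp_all add: E_def)
    obtain \<rho>0 where \<rho>0: "\<rho>0 > 0" "cball z0 \<rho>0 \<subseteq> S" using S(1) z0(1) open_contains_cball by blast
    have "bounded (p ` cball z0 \<rho>0)" "bounded (r ` cball z0 \<rho>0)"
      using pr \<rho>0(2) by (auto intro!: compact_imp_bounded compact_continuous_image intro: continuous_on_subset)
    then obtain C1 C2 where C1: "\<And>z. z \<in> cball z0 \<rho>0 \<Longrightarrow> norm (p z) \<le> C1" and C2: "\<And>z. z \<in> cball z0 \<rho>0 \<Longrightarrow> norm (r z) \<le> C2"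
      unfolding bounded_iff by blast
    define C where "C = max C1 C2"
    have C: "norm (p z) \<le> C" "norm (r z) \<le> C" if "z \<in> cball z0 \<rho>0" for z
      using C1[OF that] C2[OF that] by (auto simp: C_def)
    have C0: "C \<ge> 0" using C(1)[of z0] \<rho>0(1) by (smt (verit) centre_in_cball norm_ge_zero)
    \<comment> \<open>On the disc the differential of the jet is bounded by (2 + 2 C) times the
      maximum; this radius makes the product at most one half.\<close>
    define \<rho> where "\<rho> = min \<rho>0 (1 / (2 * (2 + 2 * C)))"
    have \<rho>: "\<rho> > 0" "\<rho> \<le> \<rho>0" "(2 + 2 * C) * \<rho> \<le> 1 / 2"
    proof -
      show "\<rho> > 0" "\<rho> \<le> \<rho>0" using \<rho>0 C0 by (auto simp: \<rho>_def)
      have "(2 + 2 * C) * \<rho> \<le> (2 + 2 * C) * (1 / (2 * (2 + 2 * C)))"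
        using C0 by (intro mult_left_mono) (auto simp: \<rho>_def)
      also have "\<dots> = 1 / 2" using C0 by (simp add: field_simps)
      finally show "(2 + 2 * C) * \<rho> \<le> 1 / 2" .
    qed
    have sub: "cball z0 \<rho> \<subseteq> cball z0 \<rho>0" using \<rho> by (simp add: subset_cball)
    have "continuous_on (cball z0 \<rho>) (\<lambda>z. norm (Y z))"
      using contY sub \<rho>0(2) by (intro continuous_on_norm) (auto intro: continuous_on_subset)
    then obtain zs where zs: "zs \<in> cball z0 \<rho>" "\<And>z. z \<in> cball z0 \<rho> \<Longrightarrow> norm (Y z) \<le> norm (Y zs)"
      using continuous_attains_sup[of "cball z0 \<rho>" "\<lambda>z. norm (Y z)"] \<rho>(1) by auto
    define M where "M = norm (Y zs)"
    have M0: "M \<ge> 0" by (simp add: M_def)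
    have "norm (Y zs - Y z0) \<le> ((2 + 2 * C) * M) * norm (zs - z0)"
    proof (rule differentiable_bound[where S="cball z0 \<rho>" and f'=D])
      fix z assume z: "z \<in> cball z0 \<rho>"
      then have zS: "z \<in> S" using sub \<rho>0(2) by blast
      show "(Y has_derivative D z) (at z within cball z0 \<rho>)" by (rule has_derivative_at_withinI[OF der[OF zS]])
      have AU: "norm (A z) \<le> M" "norm (U z) \<le> M"
        using zs(2)[OF z] norm_fst_le[of "U z" "A z"] norm_snd_le[of "A z" "U z"] unfolding Y_def M_def by linarith+
      show "onorm (D z) \<le> (2 + 2 * C) * M"
      proof (rule onorm_le)
        fix h
        have c: "norm (p z) \<le> C" "norm (r z) \<le> C" using C z sub by blast+
        have "norm (D z h) \<le> norm (A z * h + cnj (A z) * cnj h) + norm (p z * A z * h + r z * U z * cnj h)"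
          unfolding D_def by (rule norm_Pair_le)
        also have "\<dots> \<le> (norm (A z) * norm h + norm (A z) * norm h) + (norm (p z) * norm (A z) * norm h + norm (r z) * norm (U z) * norm h)"
          by (intro add_mono order_trans[OF norm_triangle_ineq]) (simp_all add: norm_mult)
        also have "\<dots> \<le> (M * norm h + M * norm h) + (C * M * norm h + C * M * norm h)"
          using AU c C0 M0 by (intro add_mono mult_right_mono mult_mono) auto
        finally show "norm (D z h) \<le> (2 + 2 * C) * M * norm h" by (simp add: algebra_simps)
      qed
    qed (use zs(1) \<rho>(1) in auto)
    also have "\<dots> \<le> ((2 + 2 * C) * M) * \<rho>"
      using zs(1) C0 M0 by (intro mult_left_mono) (auto simp: dist_norm norm_minus_commute)
    also have "\<dots> = ((2 + 2 * C) * \<rho>) * M" by simp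
    also have "\<dots> \<le> 1 / 2 * M" by (intro mult_right_mono \<rho>(3) M0)
    finally have "M \<le> 1 / 2 * M" using z0(2) by (simp add: M_def)
    then have "M = 0" using M0 by simp
    then have "cball z0 \<rho> \<subseteq> E" using zs(2) sub \<rho>0(2) unfolding E_def M_def by fastforce
    then show "\<exists>e>0. cball z0 e \<subseteq> E" using \<rho>(1) by blast
  qed
  moreover have "open (S \<inter> Y -` (- {0}))"
    using contY S(1) by (simp add: continuous_on_open_vimage Int_commute open_Compl)
  moreover have "E \<inter> (S \<inter> Y -` (- {0})) \<inter> S = {}" "S \<subseteq> E \<union> (S \<inter> Y -` (- {0}))" by (auto simp: E_def)
  ultimately have "E \<inter> S = {} \<or> (S \<inter> Y -` (- {0})) \<inter> S = {}"
    using connectedD[OF S(2)] by blast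
  moreover have "z1 \<in> E \<inter> S" using z1 by (simp add: E_def Y_def zero_prod_def)
  ultimately have "Y z = 0" using z by blast
  then show ?thesis by (simp add: Y_def zero_prod_def)
qed

section \<open>Growth at infinity and the quadratic differential of an eigenfunction\<close>

lemma poly_growth:
  fixes p :: "complex poly"
  assumes "degree p \<le> n"
  obtains K where "K > 0" "\<And>z. 1 \<le> cmod z \<Longrightarrow> cmod (poly p z) \<le> K * cmod z ^ n"
proof (rule that[of "1 + (\<Sum>i\<le>n. cmod (coeff p i))"])
  show "0 < 1 + (\<Sum>i\<le>n. cmod (coeff p i))" by (smt (verit) norm_ge_zero sum_nonneg)
  fix z assume z: "1 \<le> cmod z"
  have "poly p z = (\<Sum>i\<le>n. coeff p i * z ^ i)"
    unfolding poly_altdef using assms by (intro sum.mono_neutral_left) (auto simp: coeff_eq_0)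
  then have "cmod (poly p z) \<le> (\<Sum>i\<le>n. cmod (coeff p i) * cmod z ^ i)"
    by (metis (no_types, lifting) norm_mult norm_power norm_sum sum.cong)
  also have "\<dots> \<le> (\<Sum>i\<le>n. cmod (coeff p i) * cmod z ^ n)"
    using z by (intro sum_mono mult_left_mono power_increasing) auto
  also have "\<dots> = (\<Sum>i\<le>n. cmod (coeff p i)) * cmod z ^ n" by (simp add: sum_distrib_right)
  also have "\<dots> \<le> (1 + (\<Sum>i\<le>n. cmod (coeff p i))) * cmod z ^ n" by (intro mult_right_mono) auto
  finally show "cmod (poly p z) \<le> (1 + (\<Sum>i\<le>n. cmod (coeff p i))) * cmod z ^ n" .
qed

text \<open>In top degree z p' is (n + 1) p. The difference is the error term that survives when
  leading parts cancel in \<open>connection_growth\<close>.\<close>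

lemma degree_euler:
  fixes p :: "complex poly"
  assumes "degree p \<le> Suc n"
  shows "degree (smult (of_nat (Suc n)) p - pCons 0 (pderiv p)) \<le> n"
proof (rule degree_le, intro allI impI)
  fix i assume i: "n < i"
  show "coeff (smult (of_nat (Suc n)) p - pCons 0 (pderiv p)) i = 0"
  proof (cases i)
    case (Suc j)
    show ?thesis
    proof (cases "i = Suc n")
      case True
      then show ?thesis using Suc by (simp add: coeff_pderiv)
    next
      case False
      then have "coeff p i = 0" using assms i by (intro coeff_eq_0) simp
      then show ?thesis using Suc by (simp add: coeff_pderiv)
    qed
  qed (use i in simp)
qed

context cubic_sphere_map
begin

text \<open>The logarithmic derivative of \<open>N\<close>. The Christoffel symbol of the pulled
  back metric |W|^2 / N^2 is W'/W - 2 Q.\<close>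

definition Q :: "complex \<Rightarrow> complex" where "Q z = Nz z / N z"

text \<open>The potential: in the chart the eigenfunction equation reads
  \<open>pull_dbar v = - R v\<close>.\<close>

definition R :: "complex \<Rightarrow> complex" where "R z = 2 * poly W z * cnj (poly W z) / (N z)\<^sup>2"

lemma wirtinger_Q: "\<exists>a. wirtinger Q z a (poly W z * cnj (poly W z) / (N z)\<^sup>2)"
proof -
  have m: "wirtinger (\<lambda>z. poly P z * cnj (poly P' z)) z (poly (pderiv P) z * cnj (poly P' z)) (poly P z * cnj (poly (pderiv P') z))" for P P'
    by (rule wirtinger_cong[OF wirtinger_mult[OF wirtinger_poly wirtinger_cnj[OF wirtinger_poly]]]) simp_all
  have d: "wirtinger Nz z (poly (pderiv (pderiv F)) z * cnj (poly F z) + poly (pderiv (pderiv G)) z * cnj (poly G z))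
     (poly (pderiv F) z * cnj (poly (pderiv F) z) + poly (pderiv G) z * cnj (poly (pderiv G) z))"
    unfolding Nz_def[abs_def] by (rule wirtinger_add[OF m m])
  have "(poly (pderiv F) z * cnj (poly (pderiv F) z) + poly (pderiv G) z * cnj (poly (pderiv G) z)) * N z - Nz z * cnj (Nz z)
     = poly W z * cnj (poly W z)"
    unfolding N_def Nz_def poly_W complex_cnj_diff complex_cnj_add complex_cnj_mult complex_cnj_cnj by algebra
  then show ?thesis
    using wirtinger_divide[OF d wirtinger_N N_nonzero] unfolding Q_def[abs_def] by metis
qed

lemma wirtinger_R:
  "\<exists>b. wirtinger R z (2 * cnj (poly W z) * (poly (pderiv W) z * N z - 2 * poly W z * Nz z) / (N z) ^ 3) b"
proof -
  have m: "wirtinger (\<lambda>z. 2 * poly W z * cnj (poly W z)) z (2 * poly (pderiv W) z * cnj (poly W z)) (2 * poly W z * cnj (poly (pderiv W) z))"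
    by (rule wirtinger_cong[OF wirtinger_mult[OF wirtinger_cmult[OF wirtinger_poly] wirtinger_cnj[OF wirtinger_poly]]]) simp_all
  have N2d: "wirtinger (\<lambda>z. (N z)\<^sup>2) z (2 * N z * Nz z) (2 * N z * cnj (Nz z))"
    unfolding power2_eq_square by (rule wirtinger_cong, (rule wirtinger_mult wirtinger_N)+) simp_all
  have "(2 * poly (pderiv W) z * cnj (poly W z) * (N z)\<^sup>2 - 2 * poly W z * cnj (poly W z) * (2 * N z * Nz z)) / ((N z)\<^sup>2)\<^sup>2
     = 2 * cnj (poly W z) * (poly (pderiv W) z * N z - 2 * poly W z * Nz z) / (N z) ^ 3"
    using N_nonzero[of z] by (simp add: divide_simps power2_eq_square power3_eq_cube algebra_simps)
  moreover have "(N z)\<^sup>2 \<noteq> 0" using N_nonzero by simp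
  ultimately show ?thesis
    using wirtinger_divide[OF m N2d] unfolding R_def[abs_def] by metis
qed

text \<open>In the chart at infinity N / |z|^6 becomes a positive continuous function on the closed
  unit disc and has a positive minimum there.\<close>

lemma N_lower_bound:
  obtains c where "c > 0" "\<And>z. 1 \<le> cmod z \<Longrightarrow> c * cmod z ^ 6 \<le> cmod (N z)"
proof -
  let ?A = "localize None F" and ?B = "localize None G"
  define g where "g w = (cmod (poly ?A w))\<^sup>2 + (cmod (poly ?B w))\<^sup>2" for w
  have "continuous_on (cball 0 1) g" unfolding g_def by (intro continuous_intros)
  then obtain w0 where "\<forall>w\<in>cball 0 1. g w0 \<le> g w"
    using continuous_attains_inf[of "cball (0 :: complex) 1" g] by fastforce
  then have w0: "g w0 \<le> g w" if "w \<in> cball 0 1" for w using that by blast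
  have "nonvanishing ?A ?B" by (rule nonvanishing_localize[OF nonvanishing_cubic_pair[OF pair]])
  then have "poly ?A w0 \<noteq> 0 \<or> poly ?B w0 \<noteq> 0" unfolding cubic_form_localize by (auto simp: nonvanishing_def)
  then have g0: "g w0 > 0"
    unfolding g_def by (metis add_nonneg_pos add_pos_nonneg zero_le_power2 zero_less_norm_iff zero_less_power)
  have rev: "poly P z = z ^ 3 * poly (localize None P) (1 / z)" if "degree P \<le> 3" "z \<noteq> 0" for P z
  proof -
    have alg: "c0 + c1 * z + c2 * z\<^sup>2 + c3 * z ^ 3 = z ^ 3 * (c3 + c2 * u + c1 * u\<^sup>2 + c0 * u ^ 3)"
      if "z * u = 1" for c0 c1 c2 c3 u :: complex using that by algebra
    show ?thesis unfolding poly_cubic[OF that(1)] poly_cubic[OF degree_localize] coeff_localize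
      by (rule alg) (use that(2) in simp)
  qed
  have "g w0 * cmod z ^ 6 \<le> cmod (N z)" if z: "1 \<le> cmod z" for z
  proof -
    have z0: "z \<noteq> 0" using z by auto
    have "1 / z \<in> cball 0 1" using z by (simp add: norm_divide divide_le_eq_1)
    then have "g w0 \<le> g (1 / z)" by (rule w0)
    then have "g w0 * cmod z ^ 6 \<le> g (1 / z) * cmod z ^ 6" by (intro mult_right_mono) auto
    also have "\<dots> = (cmod (poly F z))\<^sup>2 + (cmod (poly G z))\<^sup>2"
      unfolding rev[OF deg(1) z0] rev[OF deg(2) z0] norm_mult norm_power power_mult_distrib g_def
      by (simp add: algebra_simps power_mult[symmetric])
    also have "\<dots> = cmod (N z)" unfolding N_real norm_of_real using N_pos[of z] by simp
    finally show ?thesis .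
  qed
  then show ?thesis using that[OF g0] by blast
qed

text \<open>Both terms of the bracket below grow like \<open>z\<^sup>3\<close>; their leading parts cancel because the weights of
  \<open>W\<close>, \<open>N\<close> and the metric at infinity add up to zero.\<close>

lemma connection_growth:
  obtains K where "K > 0" "\<And>z. 1 \<le> cmod z \<Longrightarrow>
    cmod (- 2 * cnj z / (1 + z * cnj z) * poly W z - poly (pderiv W) z + 2 * poly W z * Q z) \<le> K * cmod z ^ 2"
proof -
  have degW: "degree W \<le> 4" unfolding W_def by (rule coeff_wronskian(6)[OF deg])
  define E where "E n p = smult (of_nat (Suc n)) p - pCons 0 (pderiv p)" for n and p :: "complex poly"
  have E: "z * poly (pderiv p) z = of_nat (Suc n) * poly p z - poly (E n p) z" for n p z by (simp add: E_def)
  obtain c where c: "c > 0" "\<And>z. 1 \<le> cmod z \<Longrightarrow> c * cmod z ^ 6 \<le> cmod (N z)" using N_lower_bound by blast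
  obtain KW where KW: "KW > 0" "\<And>z. 1 \<le> cmod z \<Longrightarrow> cmod (poly W z) \<le> KW * cmod z ^ 4"
    using poly_growth[OF degW] by blast
  obtain KE where KE: "KE > 0" "\<And>z. 1 \<le> cmod z \<Longrightarrow> cmod (poly (E 3 W) z) \<le> KE * cmod z ^ 3"
    using poly_growth[of "E 3 W" 3] degree_euler[of W 3] degW unfolding E_def by auto
  obtain KF where KF: "KF > 0" "\<And>z. 1 \<le> cmod z \<Longrightarrow> cmod (poly F z) \<le> KF * cmod z ^ 3"
    using poly_growth[OF deg(1)] by blast
  obtain KG where KG: "KG > 0" "\<And>z. 1 \<le> cmod z \<Longrightarrow> cmod (poly G z) \<le> KG * cmod z ^ 3"
    using poly_growth[OF deg(2)] by blast
  obtain KF' where KF': "KF' > 0" "\<And>z. 1 \<le> cmod z \<Longrightarrow> cmod (poly (E 2 F) z) \<le> KF' * cmod z ^ 2"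
    using poly_growth[of "E 2 F" 2] degree_euler[of F 2] deg unfolding E_def by auto
  obtain KG' where KG': "KG' > 0" "\<And>z. 1 \<le> cmod z \<Longrightarrow> cmod (poly (E 2 G) z) \<le> KG' * cmod z ^ 2"
    using poly_growth[of "E 2 G" 2] degree_euler[of G 2] deg unfolding E_def by auto
  define KM where "KM = KF' * KF + KG' * KG"
  define K where "K = 2 * KW + KE + 2 * KW * KM / c"
  have KM: "KM > 0" using KF KG KF' KG' by (simp add: KM_def add_pos_pos)
  have Kpos: "K > 0" using KW KE KM c by (simp add: K_def add_pos_pos)
  have "cmod (- 2 * cnj z / (1 + z * cnj z) * poly W z - poly (pderiv W) z + 2 * poly W z * Q z) \<le> K * cmod z ^ 2"
    if z: "1 \<le> cmod z" for z
  proof -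
    define T where "T = - 2 * cnj z / (1 + z * cnj z) * poly W z - poly (pderiv W) z + 2 * poly W z * Q z"
    define M where "M = poly (E 2 F) z * cnj (poly F z) + poly (E 2 G) z * cnj (poly G z)"
    have zN: "z * Nz z = 3 * N z - M"
    proof -
      have "z * Nz z = (z * poly (pderiv F) z) * cnj (poly F z) + (z * poly (pderiv G) z) * cnj (poly G z)"
        by (simp add: Nz_def algebra_simps)
      then show ?thesis unfolding E[of z F 2] E[of z G 2] by (simp add: N_def M_def algebra_simps)
    qed
    have zQ: "z * Q z = 3 - M / N z"
    proof -
      have "z * Q z = (z * Nz z) / N z" by (simp add: Q_def)
      then show ?thesis unfolding zN using N_nonzero[of z] by (simp add: diff_divide_distrib)
    qed
    have zD: "- 2 * (z * cnj z) / (1 + z * cnj z) = - 2 + 2 / (1 + z * cnj z)"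
      using one_plus_nonzero[of z] by (simp add: divide_simps)
    have "z * T = (- 2 * (z * cnj z) / (1 + z * cnj z)) * poly W z - z * poly (pderiv W) z + 2 * poly W z * (z * Q z)"
      unfolding T_def by (simp add: algebra_simps)
    \<comment> \<open>The leading parts -2 W, -4 W and 6 W cancel here; each remaining term is at
      most of order |z|^3.\<close>
    also have "\<dots> = 2 / (1 + z * cnj z) * poly W z + poly (E 3 W) z - 2 * poly W z * (M / N z)"
      unfolding zD zQ E[of z W 3] by (simp add: algebra_simps)
    finally have "cmod (z * T) \<le> cmod (2 / (1 + z * cnj z) * poly W z) + cmod (poly (E 3 W) z) + cmod (2 * poly W z * (M / N z))"
      by (metis (no_types, lifting) add_right_mono norm_triangle_ineq norm_triangle_ineq4 order_trans)
    also have "\<dots> \<le> 2 * KW * cmod z ^ 3 + KE * cmod z ^ 3 + 2 * KW * KM / c * cmod z ^ 3"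
    proof (intro add_mono KE(2) z)
      have zp: "cmod z > 0" using z by linarith
      have "cmod (2 / (1 + z * cnj z) * poly W z) = 2 * cmod (poly W z) / (1 + (cmod z)\<^sup>2)"
        unfolding one_plus_norm norm_mult norm_divide norm_of_real using one_plus_pos[of z] by simp
      also have "\<dots> \<le> 2 * (KW * cmod z ^ 4) / (cmod z)\<^sup>2"
        using KW(2)[OF z] zp KW(1) by (intro frac_le) auto
      also have "\<dots> = 2 * KW * cmod z ^ 2" using zp by (simp add: power2_eq_square power4_eq_xxxx)
      also have "\<dots> \<le> 2 * KW * cmod z ^ 3" using z KW(1) by (intro mult_left_mono power_increasing) auto
      finally show "cmod (2 / (1 + z * cnj z) * poly W z) \<le> 2 * KW * cmod z ^ 3" .
      have "cmod M \<le> cmod (poly (E 2 F) z) * cmod (poly F z) + cmod (poly (E 2 G) z) * cmod (poly G z)"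
        unfolding M_def by (rule order_trans[OF norm_triangle_ineq]) (simp add: norm_mult)
      also have "\<dots> \<le> (KF' * cmod z ^ 2) * (KF * cmod z ^ 3) + (KG' * cmod z ^ 2) * (KG * cmod z ^ 3)"
        using KF KG KF' KG' z by (intro add_mono mult_mono) auto
      also have "\<dots> = KM * cmod z ^ 5" by (simp add: KM_def algebra_simps power_add[symmetric])
      finally have M: "cmod M \<le> KM * cmod z ^ 5" .
      have "cmod (2 * poly W z * (M / N z)) = 2 * cmod (poly W z) * cmod M / cmod (N z)"
        by (simp add: norm_mult norm_divide)
      also have "\<dots> \<le> 2 * (KW * cmod z ^ 4) * (KM * cmod z ^ 5) / (c * cmod z ^ 6)"
        using KW(2)[OF z] M c(2)[OF z] c(1) zp KW(1) KM by (intro frac_le mult_mono) auto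
      also have "\<dots> = 2 * KW * KM / c * cmod z ^ 3"
      proof -
        have "cmod z ^ 4 * cmod z ^ 5 = cmod z ^ 6 * cmod z ^ 3" by (simp add: power_add[symmetric])
        then have fe: "2 * (KW * cmod z ^ 4) * (KM * cmod z ^ 5) = 2 * KW * KM * (cmod z ^ 6 * cmod z ^ 3)"
          by (simp add: algebra_simps)
        have "t * (d * e) / (c * d) = t / c * e" if "d \<noteq> 0" for t d e :: real using that by simp
        then show ?thesis unfolding fe using zp by (metis power_not_zero less_irrefl)
      qed
      finally show "cmod (2 * poly W z * (M / N z)) \<le> 2 * KW * KM / c * cmod z ^ 3" .
    qed
    also have "\<dots> = cmod z * (K * cmod z ^ 2)" by (simp add: K_def algebra_simps power2_eq_square power3_eq_cube)
    finally have "cmod z * cmod T \<le> cmod z * (K * cmod z ^ 2)" by (simp add: norm_mult)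
    moreover have "cmod z > 0" using z by linarith
    ultimately have "cmod T \<le> K * cmod z ^ 2" by (simp only: mult_le_cancel_left_pos)
    then show ?thesis by (simp add: T_def)
  qed
  then show ?thesis using that[OF Kpos] by blast
qed

definition hopf :: "(real ^ 3 \<Rightarrow> real) \<Rightarrow> complex \<Rightarrow> complex" where
  "hopf v z = poly W z * pull_dd v z - poly (pderiv W) z * pull_d v z + 2 * poly W z * Q z * pull_d v z"

text \<open>As \<open>v\<close> is real, equality of mixed derivatives shows that the mixed
  derivative is real; the equation for its real part therefore determines it.\<close>

lemma eigenfunction_pull_dbar:
  assumes v: "sphere_smooth v" and e: "eigenfunction (cp1_map F G) v"
  shows "pull_dbar v z = - (R z * of_real (v (stereo z)))"
proof -
  have v2: "sphere_Ck 2 v" using v unfolding sphere_smooth_def by blast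
  have wv: "wirtinger (\<lambda>z. complex_of_real (v (stereo z))) z (pull_d v z) (cnj (pull_d v z))" for z
    by (rule wirtinger_pull[OF sphere_smooth_differentiable[OF v stereo_in_sphere]])
  have "pull_dbar v z = cnj (pull_dbar v z)"
    by (rule wirtinger_mixed[OF wv wirtinger_pull_d[OF v2] wirtinger_cnj[OF wirtinger_pull_d[OF v2]]])
  then have "pull_dbar v z = of_real (Re (pull_dbar v z))" by (simp add: complex_eq_iff)
  also have "Re (pull_dbar v z) = - 2 * (cmod (poly W z))\<^sup>2 / ((cmod (poly F z))\<^sup>2 + (cmod (poly G z))\<^sup>2)\<^sup>2 * v (stereo z)"
    using e unfolding eigenfunction_iff_stereo[OF v] by blast
  also have "complex_of_real \<dots> = - (R z * of_real (v (stereo z)))"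
    unfolding R_def N_real mult.assoc[of 2] complex_norm_square[symmetric] by simp
  finally show ?thesis .
qed

lemma wirtinger_pull_dd:
  assumes v: "sphere_smooth v"
  shows "\<exists>a b. wirtinger (pull_dd v) z a b"
proof -
  have v2: "sphere_Ck 2 v" using v unfolding sphere_smooth_def by blast
  have "sphere_Ck (Suc 2) v" using v unfolding sphere_smooth_def by blast
  note g = sphere_Ck_grad[OF this]
  have c: "wirtinger (\<lambda>z. 2 * cnj z) z 0 2"
    using wirtinger_cmult[OF wirtinger_cnj[OF wirtinger_id], of 2] by simp
  have d: "wirtinger (\<lambda>z. 1 + z * cnj z) z (0 + (1 * cnj z + z * cnj 0)) (0 + (0 * cnj z + z * cnj 1))"
    by (intro wirtinger_add wirtinger_const wirtinger_mult wirtinger_id wirtinger_cnj)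
  have "\<exists>a b. wirtinger (\<lambda>z. \<Sum>k\<in>UNIV. pull_d (\<lambda>x. sphere_grad v x $ k) z * dstereo z $ k) z a b"
    by (intro exI, rule wirtinger_sum[OF wirtinger_mult[OF wirtinger_pull_d[OF g] wirtinger_dstereo]])
  then show ?thesis
    unfolding pull_dd_def[of v, abs_def]
    using wirtinger_diff wirtinger_mult[OF wirtinger_divide[OF c d one_plus_nonzero] wirtinger_pull_d[OF v2]] by blast
qed

text \<open>\<open>hopf v\<close> is \<open>W\<close> times the Hopf-type differential of \<open>v\<close>: the traceless Hessian of \<open>v\<close>
  with respect to the metric pulled back by the map.\<close>

lemma hopf_holomorphic:
  assumes v: "sphere_smooth v" and e: "eigenfunction (cp1_map F G) v"
    and w: "wirtinger (pull_dd v) z b1 b2"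
  shows "\<exists>c. wirtinger Q z c (poly W z * cnj (poly W z) / (N z)\<^sup>2) \<and> wirtinger (hopf v) z
     (poly W z * b1 - poly (pderiv (pderiv W)) z * pull_d v z
       + 2 * (poly (pderiv W) z * Q z * pull_d v z + poly W z * c * pull_d v z + poly W z * Q z * pull_dd v z)) 0"
proof -
  have v2: "sphere_Ck 2 v" using v unfolding sphere_smooth_def by blast
  obtain c where c: "wirtinger Q z c (poly W z * cnj (poly W z) / (N z)\<^sup>2)" using wirtinger_Q by blast
  define u where "u = complex_of_real (v (stereo z))"
  note pd = wirtinger_pull_d[OF v2]
  have pbar: "pull_dbar v = (\<lambda>z. - (R z * of_real (v (stereo z))))" using eigenfunction_pull_dbar[OF v e] by blast
  obtain rb where r: "wirtinger R z (2 * cnj (poly W z) * (poly (pderiv W) z * N z - 2 * poly W z * Nz z) / (N z) ^ 3) rb"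
    using wirtinger_R by blast
  have wv: "wirtinger (\<lambda>z. complex_of_real (v (stereo z))) z (pull_d v z) (cnj (pull_d v z))"
    by (rule wirtinger_pull[OF sphere_smooth_differentiable[OF v stereo_in_sphere]])
  have "wirtinger (\<lambda>z. (- 1) * (R z * of_real (v (stereo z)))) z
     ((- 1) * (2 * cnj (poly W z) * (poly (pderiv W) z * N z - 2 * poly W z * Nz z) / (N z) ^ 3 * u + R z * pull_d v z))
     ((- 1) * (rb * u + R z * cnj (pull_d v z)))"
    unfolding u_def by (intro wirtinger_cmult wirtinger_mult r wv)
  then have wb: "wirtinger (pull_dbar v) z
     ((- 1) * (2 * cnj (poly W z) * (poly (pderiv W) z * N z - 2 * poly W z * Nz z) / (N z) ^ 3 * u + R z * pull_d v z))
     ((- 1) * (rb * u + R z * cnj (pull_d v z)))"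
    unfolding pbar by simp
  \<comment> \<open>The derivative of \<open>pull_dd v\<close> in \<open>cnj z\<close> equals the
    z-derivative of \<open>pull_dbar v\<close>, which the eigenfunction equation makes
    explicit.\<close>
  have b2: "b2 = (- 1) * (2 * cnj (poly W z) * (poly (pderiv W) z * N z - 2 * poly W z * Nz z) / (N z) ^ 3 * u + R z * pull_d v z)"
    by (rule wirtinger_mixed[OF pd w wb])
  have "wirtinger (hopf v) z
     (poly (pderiv W) z * pull_dd v z + poly W z * b1 - (poly (pderiv (pderiv W)) z * pull_d v z + poly (pderiv W) z * pull_dd v z)
       + 2 * ((poly (pderiv W) z * Q z + poly W z * c) * pull_d v z + poly W z * Q z * pull_dd v z))
     (0 * pull_dd v z + poly W z * b2 - (0 * pull_d v z + poly (pderiv W) z * pull_dbar v z)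
       + 2 * ((0 * Q z + poly W z * (poly W z * cnj (poly W z) / (N z)\<^sup>2)) * pull_d v z + poly W z * Q z * pull_dbar v z))"
    unfolding hopf_def[abs_def] mult.assoc[of 2]
    by (intro wirtinger_add wirtinger_diff wirtinger_cmult wirtinger_mult wirtinger_poly pd w c)
  then have "wirtinger (hopf v) z
     (poly W z * b1 - poly (pderiv (pderiv W)) z * pull_d v z
       + 2 * (poly (pderiv W) z * Q z * pull_d v z + poly W z * c * pull_d v z + poly W z * Q z * pull_dd v z)) 0"
  proof (rule wirtinger_cong)
    define m where "m = 1 / N z"
    have m: "N z * m = 1" using N_nonzero by (simp add: m_def)
    have dv: "x / N z = x * m" "x / (N z)\<^sup>2 = x * m\<^sup>2" "x / (N z) ^ 3 = x * m ^ 3" for x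
      by (simp_all add: m_def power_divide)
    show "0 * pull_dd v z + poly W z * b2 - (0 * pull_d v z + poly (pderiv W) z * pull_dbar v z)
       + 2 * ((0 * Q z + poly W z * (poly W z * cnj (poly W z) / (N z)\<^sup>2)) * pull_d v z + poly W z * Q z * pull_dbar v z) = 0"
      unfolding b2 fun_cong[OF pbar] u_def[symmetric] R_def Q_def dv using m by algebra
  qed (simp add: algebra_simps)
  then show ?thesis using c by blast
qed

text \<open>\<open>hopf v\<close> is entire. At infinity the growth |z|^4 of \<open>W\<close> meets
  the decay |z|^-4 of the covariant second derivative, and the growth |z|^2 of the connection term
  meets the decay |z|^-2 of \<open>pull_d v\<close>, so it is bounded.\<close>

lemma hopf_constant:
  assumes v: "sphere_smooth v" and e: "eigenfunction (cp1_map F G) v"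
  obtains c where "\<And>z. hopf v z = c"
proof -
  have v2: "sphere_Ck 2 v" and v1: "sphere_Ck 1 v" using v unfolding sphere_smooth_def by blast+
  have der: "\<exists>d. (hopf v has_field_derivative d) (at z)" for z
  proof -
    obtain b1 b2 where w: "wirtinger (pull_dd v) z b1 b2" using wirtinger_pull_dd[OF v] by blast
    from hopf_holomorphic[OF v e w] obtain d where "wirtinger (hopf v) z d 0" by blast
    then show ?thesis unfolding wirtinger_def has_field_derivative_def by auto
  qed
  then have hol: "hopf v holomorphic_on UNIV"
    unfolding holomorphic_on_def field_differentiable_def by simp
  obtain K where K: "K > 0" "\<And>z. 1 \<le> cmod z \<Longrightarrow>
    cmod (- 2 * cnj z / (1 + z * cnj z) * poly W z - poly (pderiv W) z + 2 * poly W z * Q z) \<le> K * cmod z ^ 2"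
    using connection_growth by blast
  obtain KW where KW: "KW > 0" "\<And>z. 1 \<le> cmod z \<Longrightarrow> cmod (poly W z) \<le> KW * cmod z ^ 4"
    using poly_growth[of W 4] coeff_wronskian(6)[OF deg] unfolding W_def by blast
  obtain B1 where B1: "B1 > 0" "\<And>z. cmod (pull_d v z) \<le> B1 / (1 + (cmod z)\<^sup>2)" using pull_d_bound[OF v1] by blast
  obtain B2 where B2: "B2 > 0" "\<And>z. cmod (pull_dd v z + 2 * cnj z / (1 + z * cnj z) * pull_d v z) \<le> B2 / (1 + (cmod z)\<^sup>2)\<^sup>2"
    using pull_dd_bound[OF v2] by blast
  have far: "cmod (hopf v z) \<le> KW * B2 + K * B1" if z: "1 \<le> cmod z" for z
  proof -
    have zp: "cmod z > 0" using z by linarith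
    \<comment> \<open>The Christoffel term of the round metric is added and subtracted, so that each
      factor has its sharp bound.\<close>
    have "hopf v z = poly W z * (pull_dd v z + 2 * cnj z / (1 + z * cnj z) * pull_d v z) +
       (- 2 * cnj z / (1 + z * cnj z) * poly W z - poly (pderiv W) z + 2 * poly W z * Q z) * pull_d v z"
      by (simp add: hopf_def algebra_simps)
    then have "cmod (hopf v z) \<le> cmod (poly W z) * cmod (pull_dd v z + 2 * cnj z / (1 + z * cnj z) * pull_d v z) +
       cmod (- 2 * cnj z / (1 + z * cnj z) * poly W z - poly (pderiv W) z + 2 * poly W z * Q z) * cmod (pull_d v z)"
      by (metis norm_mult norm_triangle_ineq)
    also have "\<dots> \<le> (KW * cmod z ^ 4) * (B2 / ((cmod z)\<^sup>2)\<^sup>2) + (K * cmod z ^ 2) * (B1 / (cmod z)\<^sup>2)"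
    proof (intro add_mono mult_mono KW(2) K(2) z)
      have "B2 / (1 + (cmod z)\<^sup>2)\<^sup>2 \<le> B2 / ((cmod z)\<^sup>2)\<^sup>2"
        using B2(1) zp by (intro frac_le power_mono) auto
      then show "cmod (pull_dd v z + 2 * cnj z / (1 + z * cnj z) * pull_d v z) \<le> B2 / ((cmod z)\<^sup>2)\<^sup>2"
        using B2(2)[of z] by linarith
      have "B1 / (1 + (cmod z)\<^sup>2) \<le> B1 / (cmod z)\<^sup>2"
        using B1(1) zp by (intro frac_le) auto
      then show "cmod (pull_d v z) \<le> B1 / (cmod z)\<^sup>2" using B1(2)[of z] by linarith
    qed (use KW(1) K(1) in auto)
    also have "\<dots> = KW * B2 + K * B1"
    proof -
      have "((cmod z)\<^sup>2)\<^sup>2 = cmod z ^ 4" by (simp add: power2_eq_square power4_eq_xxxx)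
      moreover have "cmod z ^ 4 \<noteq> 0" "cmod z ^ 2 \<noteq> 0" using zp by auto
      ultimately show ?thesis by simp
    qed
    finally show ?thesis .
  qed
  have "compact (hopf v ` cball 0 1)"
    by (intro compact_continuous_image holomorphic_on_imp_continuous_on holomorphic_on_subset[OF hol]) auto
  then have "bounded (hopf v ` cball 0 1)" by (rule compact_imp_bounded)
  then obtain B where B': "\<forall>y\<in>hopf v ` cball 0 1. cmod y \<le> B" unfolding bounded_iff by blast
  have B: "cmod (hopf v z) \<le> B" if "z \<in> cball 0 1" for z using B' that by blast
  have "cmod (hopf v z) \<le> max B (KW * B2 + K * B1)" for z
  proof (cases "1 \<le> cmod z")
    case True
    show ?thesis using far[OF True] by simp
  next
    case False
    then show ?thesis using B[of z] by simp
  qed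
  then have "bounded (range (hopf v))" unfolding bounded_iff by blast
  then show ?thesis using Liouville_theorem[OF hol] that unfolding constant_on_def by blast
qed

text \<open>Differentiating \<open>hopf v = c\<close> at a zero of \<open>W\<close> gives \<open>W'' F = 2 W' F'\<close> and \<open>W'' G = 2 W' G'\<close> there.\<close>

lemma hopf_nonzero_imp_omega:
  assumes v: "sphere_smooth v" and e: "eigenfunction (cp1_map F G) v"
    and c: "\<And>z. hopf v z = c" "c \<noteq> 0"
  shows "omega F G = 0"
proof (cases "degree W = 0")
  \<comment> \<open>A constant \<open>W\<close> has no finite zero to expand at; as a quartic it has
    its whole root at infinity, and the invariant vanishes outright.\<close>
  case True
  then have "coeff W n = 0" if "n > 0" for n using that by (simp add: coeff_eq_0)
  then have "(omega F G)\<^sup>2 = 0"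
    unfolding quartic_invariant[OF deg, symmetric] W_def[symmetric] by simp
  then show ?thesis by simp
next
  case False
  then have "\<not> constant (poly W)" by (simp add: constant_degree)
  then obtain z where z: "poly W z = 0" using fundamental_theorem_of_algebra by blast
  define W1 where "W1 = poly (pderiv W) z"
  define W2 where "W2 = poly (pderiv (pderiv W)) z"
  define a where "a = pull_d v z"
  \<comment> \<open>At a zero of \<open>W\<close> only one term of \<open>hopf v\<close> survives,
    so a nonzero constant makes the first derivative of \<open>v\<close> nonzero there.\<close>
  have "- W1 * a = c" using c(1)[of z] by (simp add: hopf_def z W1_def a_def)
  then have a0: "a \<noteq> 0" using c(2) by auto
  obtain b1 b2 where w: "wirtinger (pull_dd v) z b1 b2" using wirtinger_pull_dd[OF v] by blast
  from hopf_holomorphic[OF v e w] obtain d where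
    "wirtinger (hopf v) z (- W2 * a + 2 * (W1 * Q z * a)) 0" by (auto simp: z W1_def W2_def a_def)
  moreover have "wirtinger (hopf v) z 0 0" using c(1) wirtinger_const[of c z] by (metis ext)
  ultimately have "- W2 * a + 2 * (W1 * Q z * a) = 0" by (rule wirtinger_unique(1))
  then have "(2 * W1 * Q z - W2) * a = 0" by (simp add: algebra_simps)
  then have W2: "W2 = 2 * W1 * Q z" using a0 by simp
  \<comment> \<open>At a zero of \<open>W\<close> the vector (F', G') is parallel to (F, G), with
    factor \<open>Q z\<close>.\<close>
  have "poly (pderiv F) z * poly G z = poly F z * poly (pderiv G) z" using z by (simp add: poly_W)
  then have "poly F z * Nz z = poly (pderiv F) z * N z" "poly G z * Nz z = poly (pderiv G) z * N z"
    unfolding Nz_def N_def by algebra+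
  then have QF: "Q z * poly F z = poly (pderiv F) z" "Q z * poly G z = poly (pderiv G) z"
    using N_nonzero[of z] by (simp_all add: Q_def field_simps)
  let ?A = "localize (Some z) F" and ?B = "localize (Some z) G"
  have p0: "coeff (localize (Some z) P) 0 = poly P z" "coeff (localize (Some z) P) 1 = poly (pderiv P) z"
    if "degree P \<le> 3" for P
  proof -
    have pd: "poly (pderiv [:p0, p1, p2, p3:]) z = p1 + 2 * p2 * z + 3 * p3 * z\<^sup>2" for p0 p1 p2 p3
      by (simp add: pderiv_pCons algebra_simps power2_eq_square)
    show "coeff (localize (Some z) P) 0 = poly P z" unfolding coeff_localize poly_cubic[OF that] ..
    show "coeff (localize (Some z) P) 1 = poly (pderiv P) z"
      unfolding coeff_localize using pd cubic_coeffs[OF that] by metis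
  qed
  have d1: "poly (pderiv [:w0, w1, w2, w3, w4:]) z = w1 + 2 * w2 * z + 3 * w3 * z\<^sup>2 + 4 * w4 * z ^ 3"
    and d2: "poly (pderiv (pderiv [:w0, w1, w2, w3, w4:])) z = 2 * w2 + 6 * w3 * z + 12 * w4 * z\<^sup>2" for w0 w1 w2 w3 w4
    by (simp_all add: pderiv_pCons algebra_simps power2_eq_square power3_eq_cube)
  have W1': "W1 = 2 * plucker ?A ?B 2 0"
    unfolding W1_def W_def wronskian_cubic[OF deg] d1 coeff_localize by algebra
  have W2': "W2 = 2 * (3 * plucker ?A ?B 3 0 + plucker ?A ?B 2 1)"
    unfolding W2_def W_def wronskian_cubic[OF deg] d2 coeff_localize by algebra
  have pl: "plucker ?A ?B 1 0 = 0"
    using \<open>poly (pderiv F) z * poly G z = poly F z * poly (pderiv G) z\<close> unfolding p0[OF deg(1)] p0[OF deg(2)] by simp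
  have eqs: "W2 * coeff ?A 0 = 2 * W1 * coeff ?A 1" "W2 * coeff ?B 0 = 2 * W1 * coeff ?B 1"
    unfolding W2 p0[OF deg(1)] p0[OF deg(2)] QF[symmetric] by algebra+
  have om: "omega ?A ?B * coeff ?A 0 = 0" "omega ?A ?B * coeff ?B 0 = 0"
    using eqs pl unfolding W1' W2' omega_def by algebra+
  have "poly F z \<noteq> 0 \<or> poly G z \<noteq> 0" using N_nonzero[of z] by (auto simp: N_def)
  then have "omega ?A ?B = 0" using om unfolding p0[OF deg(1)] p0[OF deg(2)] by auto
  then show ?thesis by (simp add: localize_def omega_pullback)
qed

section \<open>Linear combinations of the coordinates of the map\<close>

definition trivial_jacobi :: "complex \<Rightarrow> real \<Rightarrow> real ^ 3 \<Rightarrow> real" where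
  "trivial_jacobi \<alpha> \<beta> x = Re \<alpha> * \<Phi> x $ 1 - Im \<alpha> * \<Phi> x $ 2 + \<beta> * \<Phi> x $ 3"

text \<open>The z-derivative of \<open>trivial_jacobi\<close> is \<open>W\<close> times this over
  N^2. It is a polynomial in the conjugated cubics, hence antiholomorphic.\<close>

definition trivial_k :: "complex \<Rightarrow> real \<Rightarrow> complex \<Rightarrow> complex" where
  "trivial_k \<alpha> \<beta> z = \<alpha> * (cnj (poly G z))\<^sup>2 - cnj \<alpha> * (cnj (poly F z))\<^sup>2 + 2 * of_real \<beta> * cnj (poly F z) * cnj (poly G z)"

lemma trivial_jacobi_stereo:
  "complex_of_real (trivial_jacobi \<alpha> \<beta> (stereo z)) = (\<alpha> * poly F z * cnj (poly G z) + cnj \<alpha> * cnj (poly F z) * poly G z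
     + of_real \<beta> * (poly F z * cnj (poly F z) - poly G z * cnj (poly G z))) / N z"
proof -
  define q where "q = poly F z * cnj (poly G z) / N z"
  have al: "\<alpha> = of_real (Re \<alpha>) + \<i> * of_real (Im \<alpha>)" "cnj \<alpha> = of_real (Re \<alpha>) - \<i> * of_real (Im \<alpha>)"
    by (simp_all add: complex_eq_iff)
  have "complex_of_real (trivial_jacobi \<alpha> \<beta> (stereo z)) = of_real (Re \<alpha>) * (q + cnj q) - of_real (Im \<alpha>) * (- \<i> * (q - cnj q))
     + of_real \<beta> * ((poly F z * cnj (poly F z) - poly G z * cnj (poly G z)) / N z)"
    unfolding trivial_jacobi_def of_real_add of_real_diff of_real_mult Phi_stereo q_def ..
  also have "of_real (Re \<alpha>) * (q + cnj q) - of_real (Im \<alpha>) * (- \<i> * (q - cnj q)) = \<alpha> * q + cnj \<alpha> * cnj q"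
    unfolding al(2) by (subst (3) al(1)) (simp add: algebra_simps)
  finally show ?thesis by (simp add: q_def cnj_N add_divide_distrib diff_divide_distrib algebra_simps)
qed

lemma wirtinger_trivial:
  "wirtinger (\<lambda>z. complex_of_real (trivial_jacobi \<alpha> \<beta> (stereo z))) z (poly W z * trivial_k \<alpha> \<beta> z / (N z)\<^sup>2)
     (cnj (poly W z * trivial_k \<alpha> \<beta> z / (N z)\<^sup>2))"
proof -
  note r1 = wirtinger_ratio(1)[of z] and r2 = wirtinger_ratio(2)[of z]
  have w: "wirtinger (\<lambda>z. \<alpha> * (poly F z * cnj (poly G z) / N z) + cnj \<alpha> * cnj (poly F z * cnj (poly G z) / N z)
      + of_real \<beta> * ((poly F z * cnj (poly F z) - poly G z * cnj (poly G z)) / N z)) z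
     (\<alpha> * (poly W z * (cnj (poly G z))\<^sup>2 / (N z)\<^sup>2) + cnj \<alpha> * cnj (- ((poly F z)\<^sup>2 * cnj (poly W z)) / (N z)\<^sup>2)
        + of_real \<beta> * (2 * poly W z * cnj (poly F z) * cnj (poly G z) / (N z)\<^sup>2))
     (\<alpha> * (- ((poly F z)\<^sup>2 * cnj (poly W z)) / (N z)\<^sup>2) + cnj \<alpha> * cnj (poly W z * (cnj (poly G z))\<^sup>2 / (N z)\<^sup>2)
        + of_real \<beta> * (2 * cnj (poly W z) * poly F z * poly G z / (N z)\<^sup>2))"
    by (intro wirtinger_add wirtinger_cmult wirtinger_cnj[OF r1] r1 r2)
  have eq: "(\<lambda>z. \<alpha> * (poly F z * cnj (poly G z) / N z) + cnj \<alpha> * cnj (poly F z * cnj (poly G z) / N z)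
      + of_real \<beta> * ((poly F z * cnj (poly F z) - poly G z * cnj (poly G z)) / N z)) = (\<lambda>z. complex_of_real (trivial_jacobi \<alpha> \<beta> (stereo z)))"
    unfolding trivial_jacobi_stereo by (rule ext) (simp add: cnj_N add_divide_distrib diff_divide_distrib algebra_simps)
  show ?thesis
    unfolding trivial_k_def
    by (rule wirtinger_cong[OF w[unfolded eq]]) (simp_all add: cnj_N add_divide_distrib diff_divide_distrib algebra_simps)
qed

text \<open>Since \<open>trivial_k\<close> is antiholomorphic, the z-derivative acts on W / N^2
  alone. So these combinations obey the first order equation that \<open>hopf v = 0\<close> imposes
  on the derivative of \<open>v\<close>.\<close>

lemma wirtinger_trivial_d:
  "wirtinger (\<lambda>z. poly W z * trivial_k \<alpha> \<beta> z / (N z)\<^sup>2) z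
     ((poly (pderiv W) z - 2 * poly W z * Q z) * trivial_k \<alpha> \<beta> z / (N z)\<^sup>2)
     (- (R z * of_real (trivial_jacobi \<alpha> \<beta> (stereo z))))"
proof -
  define k' where "k' = \<alpha> * (2 * cnj (poly G z) * cnj (poly (pderiv G) z)) - cnj \<alpha> * (2 * cnj (poly F z) * cnj (poly (pderiv F) z))
     + 2 * of_real \<beta> * (cnj (poly (pderiv F) z) * cnj (poly G z) + cnj (poly F z) * cnj (poly (pderiv G) z))"
  have cp: "wirtinger (\<lambda>z. cnj (poly P z)) z 0 (cnj (poly (pderiv P) z))" for P
    using wirtinger_cnj[OF wirtinger_poly] by (metis complex_cnj_zero)
  have k: "wirtinger (trivial_k \<alpha> \<beta>) z 0 k'"
    unfolding trivial_k_def[abs_def] power2_eq_square mult.assoc[of "2 * of_real \<beta>"]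
    by (rule wirtinger_cong, (rule wirtinger_add wirtinger_diff wirtinger_cmult wirtinger_mult cp)+)
       (simp_all add: k'_def algebra_simps)
  have N2d: "wirtinger (\<lambda>z. (N z)\<^sup>2) z (2 * N z * Nz z) (2 * N z * cnj (Nz z))"
    unfolding power2_eq_square by (rule wirtinger_cong, (rule wirtinger_mult wirtinger_N)+) simp_all
  have N2: "(N z)\<^sup>2 \<noteq> 0" using N_nonzero by simp
  define m where "m = 1 / N z"
  have m: "N z * m = 1" using N_nonzero by (simp add: m_def)
  have dv: "x / N z = x * m" "x / (N z)\<^sup>2 = x * m\<^sup>2" "x / ((N z)\<^sup>2)\<^sup>2 = x * m ^ 4" for x
    by (simp_all add: m_def power_divide power_mult[symmetric])
  have key: "k' * N z - 2 * trivial_k \<alpha> \<beta> z * cnj (Nz z) = - 2 * cnj (poly W z) *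
     (\<alpha> * poly F z * cnj (poly G z) + cnj \<alpha> * cnj (poly F z) * poly G z
     + of_real \<beta> * (poly F z * cnj (poly F z) - poly G z * cnj (poly G z)))"
    unfolding k'_def trivial_k_def N_def Nz_def cnj_W complex_cnj_add complex_cnj_mult complex_cnj_cnj by algebra
  show ?thesis
  proof (rule wirtinger_cong[OF wirtinger_divide[OF wirtinger_mult[OF wirtinger_poly k] N2d N2]])
    show "((poly (pderiv W) z * trivial_k \<alpha> \<beta> z + poly W z * 0) * (N z)\<^sup>2 - poly W z * trivial_k \<alpha> \<beta> z * (2 * N z * Nz z)) / ((N z)\<^sup>2)\<^sup>2
      = (poly (pderiv W) z - 2 * poly W z * Q z) * trivial_k \<alpha> \<beta> z / (N z)\<^sup>2"
      unfolding Q_def dv using m by algebra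
    have "((0 * trivial_k \<alpha> \<beta> z + poly W z * k') * (N z)\<^sup>2 - poly W z * trivial_k \<alpha> \<beta> z * (2 * N z * cnj (Nz z))) / ((N z)\<^sup>2)\<^sup>2
      = poly W z * (k' * N z - 2 * trivial_k \<alpha> \<beta> z * cnj (Nz z)) * m ^ 3"
      unfolding dv using m by algebra
    also have "\<dots> = - (R z * of_real (trivial_jacobi \<alpha> \<beta> (stereo z)))"
      unfolding key trivial_jacobi_stereo R_def dv by algebra
    finally show "((0 * trivial_k \<alpha> \<beta> z + poly W z * k') * (N z)\<^sup>2 - poly W z * trivial_k \<alpha> \<beta> z * (2 * N z * cnj (Nz z))) / ((N z)\<^sup>2)\<^sup>2
      = - (R z * of_real (trivial_jacobi \<alpha> \<beta> (stereo z)))" .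
  qed
qed

text \<open>A real value and a complex derivative are three real data, as many as \<alpha> and
  \<beta> provide; away from the zeros of \<open>W\<close> the linear system is invertible.\<close>

lemma trivial_jacobi_jet:
  assumes W: "poly W z \<noteq> 0"
  obtains \<alpha> \<beta> where "trivial_jacobi \<alpha> \<beta> (stereo z) = t" "poly W z * trivial_k \<alpha> \<beta> z / (N z)\<^sup>2 = a"
proof -
  define f where "f = poly F z"
  define g where "g = poly G z"
  define fc where "fc = cnj f"
  define gc where "gc = cnj g"
  define n where "n = N z"
  have n: "n \<noteq> 0" "cnj n = n" "n = f * fc + g * gc"
    using N_nonzero cnj_N by (simp_all add: n_def N_def f_def g_def fc_def gc_def)
  define m where "m = 1 / n"
  have m: "n * m = 1" "cnj m = m" using n by (simp_all add: m_def)
  define K where "K = a * n\<^sup>2 / poly W z"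
  define Kc where "Kc = cnj K"
  \<comment> \<open>\<alpha> and \<beta> are the entries of a traceless Hermitian form, prescribed
    here in the orthogonal basis (f, g), (- \<open>cnj g\<close>, \<open>cnj f\<close>):
    \<open>t\<close> on the diagonal and \<open>K\<close> off it, up to powers of
    \<open>n\<close>.\<close>
  define \<alpha> where "\<alpha> = 2 * of_real t * fc * g * m + (K * g\<^sup>2 - Kc * fc\<^sup>2) * m\<^sup>2"
  define b where "b = of_real t * (f * fc - g * gc) * m + (K * f * g + Kc * fc * gc) * m\<^sup>2"
  define \<beta> where "\<beta> = Re b"
  have "cnj b = b" unfolding b_def by (simp add: m fc_def gc_def Kc_def algebra_simps)
  then have \<beta>: "of_real \<beta> = b" by (simp add: \<beta>_def complex_eq_iff)
  have \<alpha>c: "cnj \<alpha> = 2 * of_real t * f * gc * m + (Kc * gc\<^sup>2 - K * f\<^sup>2) * m\<^sup>2"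
    unfolding \<alpha>_def by (simp add: m fc_def gc_def Kc_def)
  have m': "(f * fc + g * gc) * m = 1" using m n by simp
  have "\<alpha> * gc\<^sup>2 - cnj \<alpha> * fc\<^sup>2 + 2 * b * fc * gc = K"
    unfolding \<alpha>c unfolding \<alpha>_def b_def using m' by algebra
  then have k: "trivial_k \<alpha> \<beta> z = K"
    by (simp only: trivial_k_def \<beta> f_def[symmetric] g_def[symmetric] fc_def[symmetric] gc_def[symmetric])
  have "(\<alpha> * f * gc + cnj \<alpha> * fc * g + b * (f * fc - g * gc)) * m = of_real t"
    unfolding \<alpha>c unfolding \<alpha>_def b_def using m' by algebra
  then have "complex_of_real (trivial_jacobi \<alpha> \<beta> (stereo z)) = of_real t"
    unfolding trivial_jacobi_stereo \<beta> f_def[symmetric] g_def[symmetric] fc_def[symmetric] gc_def[symmetric] n_def[symmetric]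
    by (simp add: m_def)
  then have "trivial_jacobi \<alpha> \<beta> (stereo z) = t" unfolding of_real_eq_iff .
  moreover have "poly W z * trivial_k \<alpha> \<beta> z / (N z)\<^sup>2 = a"
    unfolding k n_def[symmetric] using W n by (simp add: K_def)
  ultimately show ?thesis by (rule that)
qed

text \<open>If \<open>hopf v\<close> vanishes, \<open>v\<close> and the linear combination of the \<open>\<Phi> $ k\<close> with the same 1-jet at a
  point solve the same total differential system for the 1-jet.\<close>

lemma hopf_zero_imp_trivial:
  assumes v: "sphere_smooth v" and e: "eigenfunction (cp1_map F G) v"
    and c: "\<And>z. hopf v z = 0"
  shows "\<exists>\<alpha> \<beta>. \<forall>x\<in>unit_sphere. v x = trivial_jacobi \<alpha> \<beta> x"
proof -
  have v2: "sphere_Ck 2 v" using v unfolding sphere_smooth_def by blast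
  have W0: "W \<noteq> 0" unfolding W_def by (rule wronskian_nonzero[OF nonvanishing_cubic_pair[OF pair] deg])
  define Z where "Z = {z. poly W z = 0}"
  have fin: "finite Z" unfolding Z_def by (rule poly_roots_finite[OF W0])
  define S where "S = UNIV - Z"
  have S: "open S" "connected S"
    using fin by (auto simp: S_def open_Diff finite_imp_closed intro!: connected_open_delete_finite)
  have "S \<noteq> {}" using fin infinite_UNIV_char_0[where 'a=complex] unfolding S_def by (metis Diff_eq_empty_iff finite_subset)
  then obtain z1 where z1: "z1 \<in> S" by blast
  then obtain \<alpha> \<beta> where ab: "trivial_jacobi \<alpha> \<beta> (stereo z1) = v (stereo z1)"
    "poly W z1 * trivial_k \<alpha> \<beta> z1 / (N z1)\<^sup>2 = pull_d v z1"
    using trivial_jacobi_jet[of z1 "v (stereo z1)" "pull_d v z1"] by (auto simp: S_def Z_def)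
  define U where "U z = complex_of_real (v (stereo z)) - of_real (trivial_jacobi \<alpha> \<beta> (stereo z))" for z
  define A where "A z = pull_d v z - poly W z * trivial_k \<alpha> \<beta> z / (N z)\<^sup>2" for z
  \<comment> \<open>The Christoffel symbol of the pulled back metric, which is singular exactly at
    the zeros of \<open>W\<close>; removing finitely many points keeps the plane connected.\<close>
  define p where "p z = poly (pderiv W) z / poly W z - 2 * Q z" for z
  have wv: "wirtinger (\<lambda>z. complex_of_real (v (stereo z))) z (pull_d v z) (cnj (pull_d v z))" for z
    by (rule wirtinger_pull[OF sphere_smooth_differentiable[OF v stereo_in_sphere]])
  have wU: "wirtinger U z (A z) (cnj (A z))" for z
    unfolding U_def[abs_def] A_def complex_cnj_diff by (intro wirtinger_diff wv wirtinger_trivial)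
  have wA: "wirtinger A z (p z * A z) (- R z * U z)" if z: "z \<in> S" for z
  proof -
    have Wz: "poly W z \<noteq> 0" using z by (simp add: S_def Z_def)
    have "poly W z * pull_dd v z = poly W z * (p z * pull_d v z)"
      using c[of z] Wz unfolding hopf_def p_def by (simp add: algebra_simps)
    then have dd: "pull_dd v z = p z * pull_d v z" using Wz by simp
    have k: "(poly (pderiv W) z - 2 * poly W z * Q z) * trivial_k \<alpha> \<beta> z / (N z)\<^sup>2 = p z * (poly W z * trivial_k \<alpha> \<beta> z / (N z)\<^sup>2)"
      using Wz unfolding p_def by (simp add: algebra_simps diff_divide_distrib)
    show ?thesis
      unfolding A_def[abs_def]
    proof (rule wirtinger_cong[OF wirtinger_diff[OF wirtinger_pull_d[OF v2] wirtinger_trivial_d]])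
      show "pull_dd v z - (poly (pderiv W) z - 2 * poly W z * Q z) * trivial_k \<alpha> \<beta> z / (N z)\<^sup>2
         = p z * (pull_d v z - poly W z * trivial_k \<alpha> \<beta> z / (N z)\<^sup>2)"
        unfolding dd k right_diff_distrib ..
      show "pull_dbar v z - - (R z * of_real (trivial_jacobi \<alpha> \<beta> (stereo z))) = - R z * U z"
        unfolding U_def eigenfunction_pull_dbar[OF v e] by (simp add: algebra_simps)
    qed
  qed
  have contN: "continuous_on X N" for X
    using wirtinger_continuous[OF wirtinger_N] by (simp add: continuous_at_imp_continuous_on)
  have contQ: "continuous_on X Q" for X
    using wirtinger_Q wirtinger_continuous by (metis continuous_at_imp_continuous_on)
  have cp: "continuous_on S p"
    unfolding p_def[abs_def] by (intro continuous_intros contQ) (auto simp: S_def Z_def)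
  have cr: "continuous_on S (\<lambda>z. - R z)"
    unfolding R_def by (intro continuous_intros contN) (simp add: N_nonzero)
  have U0: "U z = 0" if "z \<in> S" for z
    by (rule wirtinger_ode_unique[OF S cp cr wU wA z1 _ _ that]) (simp_all add: U_def A_def ab)
  \<comment> \<open>The zeros of \<open>W\<close> are recovered by continuity: the set where
    \<open>U\<close> is nonzero is open and contained in a finite set.\<close>
  have "open {z. U z \<noteq> 0}"
  proof -
    have "continuous_on UNIV U" using wirtinger_continuous[OF wU] by (simp add: continuous_at_imp_continuous_on)
    then show ?thesis by (intro open_Collect_neq continuous_intros)
  qed
  moreover have "finite {z. U z \<noteq> 0}" using U0 fin by (elim rev_finite_subset) (auto simp: S_def)
  ultimately have "{z. U z \<noteq> 0} = {}" using finite_imp_not_open by blast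
  then have eq: "v (stereo z) = trivial_jacobi \<alpha> \<beta> (stereo z)" for z by (auto simp: U_def)
  have "continuous_on unit_sphere (\<lambda>x. \<Phi> x $ k)" for k
    using sphere_smooth_Phi[of k] unfolding sphere_smooth_def by (metis sphere_Ck.simps(1))
  then have "continuous_on unit_sphere (trivial_jacobi \<alpha> \<beta>)"
    unfolding trivial_jacobi_def[abs_def] by (intro continuous_on_add continuous_on_diff continuous_on_mult continuous_on_const)
  moreover have "continuous_on unit_sphere v" using v unfolding sphere_smooth_def by (metis sphere_Ck.simps(1))
  ultimately show ?thesis using continuous_on_sphere_eq[of v "trivial_jacobi \<alpha> \<beta>"] eq by blast
qed

end

lemma extra_eigenfunction_imp_omega:
  assumes FG: "cubic_pair F G" and v: "extra_eigenfunction (cp1_map F G) v"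
  shows "omega F G = 0"
proof -
  interpret cubic_sphere_map F G using FG by unfold_locales
  have e: "eigenfunction (cp1_map F G) v" and s: "sphere_smooth v"
    using v by (simp_all add: extra_eigenfunction_def eigenfunction_def)
  obtain c where c: "\<And>z. hopf v z = c" using hopf_constant[OF s e] by blast
  show ?thesis
  proof (cases "c = 0")
    case True
    then obtain \<alpha> \<beta> where "\<forall>x\<in>unit_sphere. v x = trivial_jacobi \<alpha> \<beta> x"
      using hopf_zero_imp_trivial[OF s e] c by blast
    then have "\<forall>x\<in>unit_sphere. v x = Re \<alpha> * \<Phi> x $ 1 + (- Im \<alpha>) * \<Phi> x $ 2 + \<beta> * \<Phi> x $ 3"
      by (simp add: trivial_jacobi_def del: mem_sphere_0)
    then show ?thesis using v unfolding extra_eigenfunction_def by blast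
  next
    case False
    then show ?thesis by (rule hopf_nonzero_imp_omega[OF s e c])
  qed
qed

theorem mainTheorem5:
  fixes f :: "riemann_sphere \<Rightarrow> riemann_sphere"
  assumes "f \<in> Hol 3"
  defines "a \<equiv> collapse_point 3 f"
    and "b \<equiv> \<exists>v. extra_eigenfunction f v"
    and "c \<equiv> \<exists>\<phi> \<psi>. fractional_linear \<phi> \<and> fractional_linear \<psi> \<and>
               f = \<psi> \<circ> cp1_map [:2, 0, 0, 1:] [:0, - (1 / 3):] \<circ> \<phi>"
    and "d \<equiv> (\<forall>p. branch_point f p \<longrightarrow> simple_branch_point f p) \<and>
               equianharmonic {p. branch_point f p}"
  shows "(a \<longleftrightarrow> b) \<and> (b \<longleftrightarrow> c) \<and> (c \<longleftrightarrow> d)"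
proof -
  obtain F G where FG: "cubic_pair F G" and f: "f = cp1_map F G"
    using assms(1) by (rule Hol_3E)
  have "a \<longleftrightarrow> omega F G = 0"
    unfolding a_def f using collapse_imp_omega[OF FG] omega_imp_collapse[OF FG] by blast
  moreover have "b \<longleftrightarrow> omega F G = 0"
    unfolding b_def f using extra_eigenfunction_imp_omega[OF FG] omega_imp_extra_eigenfunction[OF FG] by blast
  moreover have "c \<longleftrightarrow> omega F G = 0"
    using model_imp_omega[OF FG] omega_imp_model[OF FG] unfolding c_def f mobius_equivalent_model_def by blast
  moreover have "d \<longleftrightarrow> omega F G = 0"
    unfolding d_def f using omega_iff_equianharmonic[OF FG] by blast
  ultimately show ?thesis by blast
qed

end
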